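(* For any link $L$, any $L$-generating subset of the directed oriented Reidemeister moves contains at least: - one move from the set $\{\Omega1a^\uparrow,\Omega1d^\downarrow\}$, - one move from the set $\{\Omega1a^\downarrow,\Omega1d^\uparrow\}$, - one move from the set $\{\Omega1b^\uparrow,\Omega1c^\downarrow\}$, - one move from the set $\{\Omega1b^\downarrow,\Omega1c^\uparrow\}$.
   Context: Links are oriented, with at least one component; link diagrams are oriented generic planar diagrams in $\mathbb{R}^2$, up to planar isotopy. Each crossing has a sign $\pm1$. Directed oriented Reidemeister moves are the 32 types of moves obtained from the 16 types of oriented Reidemeister moves (four of type $\Omega1$, four of type $\Omega2$, eight of type $\Omega3$, distinguished by orientations and over/under information of the strands) by distinguishing the two directions (forward $\uparrow$, backward $\downarrow$) in which each may be performed. For $\Omega1$: the forward move replaces a crossingless arc by an arc with a single curl (one new crossing); the backward move is the inverse. The four types are determined by the sign of the created crossing and by the change of the winding number (sum over components of the total number of counterclockwise full turns of the tangent vector) under the forward move: $\Omega1a$: sign $+1$, winding $-1$; $\Omega1b$: sign $+1$, winding $+1$; $\Omega1c$: sign $-1$, winding $-1$; $\Omega1d$: sign $-1$, winding $+1$. An $\Omega2$ move pushes one arc over another neighbouring arc, creating two crossings of opposite signs that bound a bigon (forward), or is the inverse of this (backward). An $\Omega3$ move passes a strand across the crossing of two other strands, where the three strands (top, middle, bottom) pairwise cross once; the three crossings keep their signs. A set $A$ of directed moves is $L$-generating if for any two diagrams $L_1,L_2$ of $L$, $L_2$ can be obtained from $L_1$ by a finite sequence of moves from $A$ (each used only in its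 specified direction). *)

theory Defs
  imports "HOL-Complex_Analysis.Complex_Analysis"
begin

section \<open>Systems of oriented closed curves\<close>

text \<open>
  An oriented closed curve is a function on the reals of period 1, oriented by increasing
  parameter; a finite list of them is a parametrised one-dimensional object with a numbered
  set of components.  Parametrisations and numberings are forgotten below: the notions of
  isotopy allow reparametrising and renumbering.
\<close>

definition smooth_curve :: "(real \<Rightarrow> 'a::real_normed_vector) \<Rightarrow> bool" where
  "smooth_curve \<gamma> \<longleftrightarrow>
     (\<exists>F. F 0 = \<gamma> \<and> (\<forall>k::nat. \<forall>t. (F k has_vector_derivative F (Suc k) t) (at t)))"

definition regular_closed_curve :: "(real \<Rightarrow> 'a::real_normed_vector) \<Rightarrow> bool" where
  "regular_closed_curve \<gamma> \<longleftrightarrow>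
     smooth_curve \<gamma> \<and> (\<forall>t. \<gamma> (t + 1) = \<gamma> t) \<and> (\<forall>t. vector_derivative \<gamma> (at t) \<noteq> 0)"

text \<open>
  The disjoint union of the parameter circles: a pair \<open>(i, t)\<close> is the parameter
  \<open>t\<close> on component \<open>i\<close>, with \<open>[0,1)\<close> as fundamental domain.
\<close>

definition params :: "(real \<Rightarrow> 'a) list \<Rightarrow> (nat \<times> real) set" where
  "params \<Gamma> = {..<length \<Gamma>} \<times> {0..<1}"

definition point :: "(real \<Rightarrow> 'a) list \<Rightarrow> nat \<times> real \<Rightarrow> 'a" where
  "point \<Gamma> x = (\<Gamma> ! fst x) (snd x)"

definition velocity :: "(real \<Rightarrow> 'a::real_normed_vector) list \<Rightarrow> nat \<times> real \<Rightarrow> 'a" where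
  "velocity \<Gamma> x = vector_derivative (\<Gamma> ! fst x) (at (snd x))"

section \<open>Ambient isotopy\<close>

text \<open>
  Continuous paths of \<open>C\<^sup>1\<close> diffeomorphisms of the whole space, starting at the identity.
  On smooth links, and on smooth link diagrams, these give the same isotopy classes as smooth
  isotopies do.
\<close>

definition diffeotopy :: "(real \<Rightarrow> 'a::euclidean_space \<Rightarrow> 'a) \<Rightarrow> bool" where
  "diffeotopy h \<longleftrightarrow>
     (\<forall>x. h 0 x = x) \<and>
     (\<forall>s\<in>{0..1}. bij (h s)) \<and>
     continuous_on ({0..1} \<times> UNIV) (\<lambda>(s, x). h s x) \<and>
     (\<exists>h' :: real \<Rightarrow> 'a \<Rightarrow> 'a \<Rightarrow>\<^sub>L 'a.
        (\<forall>s\<in>{0..1}. \<forall>x. (h s has_derivative blinfun_apply (h' s x)) (at x) \<and>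
                        bij (blinfun_apply (h' s x))) \<and>
        continuous_on ({0..1} \<times> UNIV) (\<lambda>(s, x). h' s x))"

text \<open>Lifts to the reals of orientation preserving diffeomorphisms of the circle.\<close>

definition circle_reparam :: "(real \<Rightarrow> real) \<Rightarrow> bool" where
  "circle_reparam \<rho> \<longleftrightarrow>
     (\<forall>t. \<rho> (t + 1) = \<rho> t + 1) \<and>
     (\<exists>\<rho>'. continuous_on UNIV \<rho>' \<and>
           (\<forall>t. (\<rho> has_real_derivative \<rho>' t) (at t) \<and> \<rho>' t > 0))"

definition carries ::
  "('a \<Rightarrow> 'a) \<Rightarrow> (nat \<Rightarrow> nat) \<Rightarrow> (nat \<Rightarrow> real \<Rightarrow> real) \<Rightarrow>
   (real \<Rightarrow> 'a) list \<Rightarrow> (real \<Rightarrow> 'a) list \<Rightarrow> bool" where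
  "carries f \<sigma> \<rho> \<Gamma> \<Delta> \<longleftrightarrow>
     length \<Delta> = length \<Gamma> \<and>
     bij_betw \<sigma> {..<length \<Gamma>} {..<length \<Gamma>} \<and>
     (\<forall>i<length \<Gamma>. circle_reparam (\<rho> i) \<and>
        (\<forall>t. f ((\<Gamma> ! i) t) = (\<Delta> ! \<sigma> i) (\<rho> i t)))"

definition carry_param ::
  "(nat \<Rightarrow> nat) \<Rightarrow> (nat \<Rightarrow> real \<Rightarrow> real) \<Rightarrow> nat \<times> real \<Rightarrow> nat \<times> real" where
  "carry_param \<sigma> \<rho> x = (\<sigma> (fst x), frac (\<rho> (fst x) (snd x)))"

definition ambient_isotopic ::
  "(real \<Rightarrow> 'a::euclidean_space) list \<Rightarrow> (real \<Rightarrow> 'a) list \<Rightarrow> bool" where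
  "ambient_isotopic \<Gamma> \<Delta> \<longleftrightarrow> (\<exists>h \<sigma> \<rho>. diffeotopy h \<and> carries (h 1) \<sigma> \<rho> \<Gamma> \<Delta>)"

section \<open>Links\<close>

text \<open>
  Euclidean 3-space is \<open>complex \<times> real\<close>: the plane of projection times the height.
\<close>

type_synonym link = "(real \<Rightarrow> complex \<times> real) list"

definition oriented_link :: "link \<Rightarrow> bool" where
  "oriented_link K \<longleftrightarrow>
     K \<noteq> [] \<and> (\<forall>\<gamma>\<in>set K. regular_closed_curve \<gamma>) \<and> inj_on (point K) (params K)"

section \<open>Link diagrams\<close>

text \<open>
  The predicate \<open>over\<close> is meaningful only at the two parameters of each double point,
  where it tells which of the two passages is the upper one.
\<close>

datatype diagram = Diagram (curves: "(real \<Rightarrow> complex) list") (over: "nat \<times> real \<Rightarrow> bool")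

text \<open>A crossing is the pair of its upper and its lower parameter, in this order.\<close>

definition crossings :: "diagram \<Rightarrow> ((nat \<times> real) \<times> (nat \<times> real)) set" where
  "crossings D =
     {(x, y). x \<in> params (curves D) \<and> y \<in> params (curves D) \<and> x \<noteq> y \<and>
              point (curves D) x = point (curves D) y \<and> over D x \<and> \<not> over D y}"

definition det2 :: "complex \<Rightarrow> complex \<Rightarrow> real" where
  "det2 u v = Re u * Im v - Im u * Re v"

definition link_diagram :: "diagram \<Rightarrow> bool" where
  "link_diagram D \<longleftrightarrow>
     curves D \<noteq> [] \<and>
     (\<forall>\<gamma>\<in>set (curves D). regular_closed_curve \<gamma>) \<and>
     (\<forall>x\<in>params (curves D). \<forall>y\<in>params (curves D).
        x \<noteq> y \<and> point (curves D) x = point (curves D) y \<longrightarrow>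
          det2 (velocity (curves D) x) (velocity (curves D) y) \<noteq> 0 \<and>
          (over D x \<longleftrightarrow> \<not> over D y) \<and>
          (\<forall>z\<in>params (curves D). point (curves D) z = point (curves D) x \<longrightarrow> z = x \<or> z = y)) \<and>
     finite (crossings D)"

datatype crossing_sign = Pos | Neg

fun opposite :: "crossing_sign \<Rightarrow> crossing_sign" where
  "opposite Pos = Neg"
| "opposite Neg = Pos"

text \<open>
  A crossing is positive if turning the upper strand counterclockwise, by less than a half
  turn, takes it to the direction of the lower strand.
\<close>

definition sign_at :: "diagram \<Rightarrow> (nat \<times> real) \<times> (nat \<times> real) \<Rightarrow> crossing_sign" where
  "sign_at D q =
     (if det2 (velocity (curves D) (fst q)) (velocity (curves D) (snd q)) > 0 then Pos else Neg)"

definition total_winding :: "diagram \<Rightarrow> real" where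
  "total_winding D =
     (\<Sum>\<gamma>\<leftarrow>curves D. Re (winding_number (\<lambda>t. vector_derivative \<gamma> (at t)) 0))"

definition planar_isotopic :: "diagram \<Rightarrow> diagram \<Rightarrow> bool" where
  "planar_isotopic D D' \<longleftrightarrow>
     link_diagram D \<and> link_diagram D' \<and>
     (\<exists>h \<sigma> \<rho>. diffeotopy h \<and> carries (h 1) \<sigma> \<rho> (curves D) (curves D') \<and>
        (\<forall>(x, y)\<in>crossings D. (carry_param \<sigma> \<rho> x, carry_param \<sigma> \<rho> y) \<in> crossings D'))"

definition projects_to :: "link \<Rightarrow> diagram \<Rightarrow> bool" where
  "projects_to K D \<longleftrightarrow>
     curves D = map (\<lambda>\<gamma> t. fst (\<gamma> t)) K \<and>
     (\<forall>(x, y)\<in>crossings D. snd (point K x) > snd (point K y))"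

definition diagram_of :: "link \<Rightarrow> diagram \<Rightarrow> bool" where
  "diagram_of L D \<longleftrightarrow>
     link_diagram D \<and> (\<exists>K. oriented_link K \<and> ambient_isotopic L K \<and> projects_to K D)"

section \<open>Oriented Reidemeister moves\<close>

text \<open>
  The round disc \<open>cball c r\<close> meets the diagram exactly in the listed arcs, an entry
  \<open>(i, a, b)\<close> being the part of component \<open>i\<close> with parameters from \<open>a\<close> to \<open>b\<close>.  The arcs
  run through the open disc, apart from their end points, which lie on the boundary circle
  and are pairwise distinct.  Asking for a round disc and for \<open>0 < a\<close>, \<open>b < 1\<close> is no
  restriction, since moves are combined with planar isotopies, which may also change the
  parametrisation.
\<close>

definition closed_arc :: "nat \<times> real \<times> real \<Rightarrow> (nat \<times> real) set" where
  "closed_arc = (\<lambda>(i, a, b). {i} \<times> {a..b})"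

definition open_arc :: "nat \<times> real \<times> real \<Rightarrow> (nat \<times> real) set" where
  "open_arc = (\<lambda>(i, a, b). {i} \<times> {a<..<b})"

definition tangle_in ::
  "complex \<Rightarrow> real \<Rightarrow> (nat \<times> real \<times> real) list \<Rightarrow> diagram \<Rightarrow> bool" where
  "tangle_in c r arcs D \<longleftrightarrow>
     r > 0 \<and>
     (\<forall>(i, a, b)\<in>set arcs. 0 < a \<and> a < b \<and> b < 1) \<and>
     (\<forall>k<length arcs. \<forall>l<k. closed_arc (arcs ! k) \<inter> closed_arc (arcs ! l) = {}) \<and>
     {x \<in> params (curves D). point (curves D) x \<in> cball c r} = (\<Union>\<alpha>\<in>set arcs. closed_arc \<alpha>) \<and>
     {x \<in> params (curves D). point (curves D) x \<in> ball c r} = (\<Union>\<alpha>\<in>set arcs. open_arc \<alpha>) \<and>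
     inj_on (point (curves D)) {x \<in> params (curves D). point (curves D) x \<in> sphere c r}"

text \<open>Both diagrams are such tangles in the disc, and they agree outside of it.\<close>

definition local_change ::
  "complex \<Rightarrow> real \<Rightarrow> (nat \<times> real \<times> real) list \<Rightarrow> diagram \<Rightarrow> diagram \<Rightarrow> bool" where
  "local_change c r arcs D D' \<longleftrightarrow>
     link_diagram D \<and> link_diagram D' \<and>
     tangle_in c r arcs D \<and> tangle_in c r arcs D' \<and>
     length (curves D') = length (curves D) \<and>
     (\<forall>x \<in> params (curves D) - (\<Union>\<alpha>\<in>set arcs. open_arc \<alpha>).
        point (curves D') x = point (curves D) x \<and> over D' x = over D x)"

definition crossings_in ::
  "complex \<Rightarrow> real \<Rightarrow> diagram \<Rightarrow> ((nat \<times> real) \<times> (nat \<times> real)) set" where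
  "crossings_in c r D = {q \<in> crossings D. point (curves D) (fst q) \<in> cball c r}"

text \<open>A crossingless arc is replaced by an arc with a single curl.\<close>

definition omega1 :: "crossing_sign \<Rightarrow> real \<Rightarrow> diagram \<Rightarrow> diagram \<Rightarrow> bool" where
  "omega1 \<epsilon> w D D' \<longleftrightarrow>
     (\<exists>c r \<alpha> q. local_change c r [\<alpha>] D D' \<and>
        crossings_in c r D = {} \<and>
        crossings_in c r D' = {q} \<and>
        sign_at D' q = \<epsilon> \<and>
        total_winding D' = total_winding D + w)"

text \<open>
  The arc \<open>\<alpha>\<close> is pushed over the arc \<open>\<beta>\<close>, which creates first \<open>p\<close> and then
  \<open>q\<close> along \<open>\<alpha>\<close>.  Two transverse simple arcs of a disc that meet exactly twice bound a
  bigon, so this need not be demanded.  The four types are told apart by the sign \<open>\<epsilon>\<close> of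
  \<open>p\<close> and by whether \<open>\<beta>\<close> also passes \<open>p\<close> first (\<open>co\<close>), i.e. by the side of the upper arc
  on which the lower one lies and by whether the two arcs run in the same direction.
\<close>

definition omega2 :: "crossing_sign \<Rightarrow> bool \<Rightarrow> diagram \<Rightarrow> diagram \<Rightarrow> bool" where
  "omega2 \<epsilon> co D D' \<longleftrightarrow>
     (\<exists>c r \<alpha> \<beta> p q. local_change c r [\<alpha>, \<beta>] D D' \<and>
        crossings_in c r D = {} \<and>
        crossings_in c r D' = {p, q} \<and>
        {p, q} \<subseteq> closed_arc \<alpha> \<times> closed_arc \<beta> \<and>
        snd (fst p) < snd (fst q) \<and>
        (co \<longleftrightarrow> snd (snd p) < snd (snd q)) \<and>
        sign_at D' p = \<epsilon> \<and> sign_at D' q = opposite \<epsilon>)"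

text \<open>
  The arcs \<open>\<alpha>\<close>, \<open>\<beta>\<close>, \<open>\<gamma>\<close> are the top, the middle and the bottom strand, crossing
  pairwise exactly once.  Three such arcs with given end points form one of two
  triangles, told apart by the order in which the top strand meets the other two.  The eight
  types are told apart by the three signs, which determine how the ends of the oriented
  strands are arranged on the boundary of the disc.  Which of the two triangles is the
  source of the forward move is a matter of convention.
\<close>

definition triangle_in ::
  "complex \<Rightarrow> real \<Rightarrow> nat \<times> real \<times> real \<Rightarrow> nat \<times> real \<times> real \<Rightarrow> nat \<times> real \<times> real \<Rightarrow>
   crossing_sign \<Rightarrow> crossing_sign \<Rightarrow> crossing_sign \<Rightarrow> bool \<Rightarrow> diagram \<Rightarrow> bool" where
  "triangle_in c r \<alpha> \<beta> \<gamma> \<epsilon>1 \<epsilon>2 \<epsilon>3 middle_first D \<longleftrightarrow>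
     (\<exists>p1 p2 p3. crossings_in c r D = {p1, p2, p3} \<and>
        p1 \<in> closed_arc \<alpha> \<times> closed_arc \<beta> \<and> sign_at D p1 = \<epsilon>1 \<and>
        p2 \<in> closed_arc \<alpha> \<times> closed_arc \<gamma> \<and> sign_at D p2 = \<epsilon>2 \<and>
        p3 \<in> closed_arc \<beta> \<times> closed_arc \<gamma> \<and> sign_at D p3 = \<epsilon>3 \<and>
        (if middle_first then snd (fst p1) < snd (fst p2) else snd (fst p2) < snd (fst p1)))"

definition omega3 ::
  "crossing_sign \<Rightarrow> crossing_sign \<Rightarrow> crossing_sign \<Rightarrow> diagram \<Rightarrow> diagram \<Rightarrow> bool" where
  "omega3 \<epsilon>1 \<epsilon>2 \<epsilon>3 D D' \<longleftrightarrow>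
     (\<exists>c r \<alpha> \<beta> \<gamma>. local_change c r [\<alpha>, \<beta>, \<gamma>] D D' \<and>
        triangle_in c r \<alpha> \<beta> \<gamma> \<epsilon>1 \<epsilon>2 \<epsilon>3 True D \<and>
        triangle_in c r \<alpha> \<beta> \<gamma> \<epsilon>1 \<epsilon>2 \<epsilon>3 False D')"

datatype move_type =
    Omega1a | Omega1b | Omega1c | Omega1d
  | Omega2 crossing_sign bool
  | Omega3 crossing_sign crossing_sign crossing_sign

datatype direction = Forward | Backward

type_synonym directed_move = "move_type \<times> direction"

fun forward_move :: "move_type \<Rightarrow> diagram \<Rightarrow> diagram \<Rightarrow> bool" where
  "forward_move Omega1a = omega1 Pos (-1)"
| "forward_move Omega1b = omega1 Pos 1"
| "forward_move Omega1c = omega1 Neg (-1)"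
| "forward_move Omega1d = omega1 Neg 1"
| "forward_move (Omega2 \<epsilon> co) = omega2 \<epsilon> co"
| "forward_move (Omega3 \<epsilon>1 \<epsilon>2 \<epsilon>3) = omega3 \<epsilon>1 \<epsilon>2 \<epsilon>3"

fun directed_move :: "directed_move \<Rightarrow> diagram \<Rightarrow> diagram \<Rightarrow> bool" where
  "directed_move (m, Forward) D D' = forward_move m D D'"
| "directed_move (m, Backward) D D' = forward_move m D' D"

definition step :: "directed_move set \<Rightarrow> diagram \<Rightarrow> diagram \<Rightarrow> bool" where
  "step A D D' \<longleftrightarrow> planar_isotopic D D' \<or> (\<exists>m\<in>A. directed_move m D D')"

definition generating :: "link \<Rightarrow> directed_move set \<Rightarrow> bool" where
  "generating L A \<longleftrightarrow>
     (\<forall>D1 D2. diagram_of L D1 \<and> diagram_of L D2 \<longrightarrow> (step A)\<^sup>*\<^sup>* D1 D2)"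

end

theory Submission
  imports Defs
begin

text \<open>
  For a diagram let \<open>w\<close> be its writhe, the sum of the signs of its crossings, and \<open>W\<close> its
  total winding number.  Both are invariants of planar isotopy, and the moves \<open>\<Omega>2\<close> and
  \<open>\<Omega>3\<close> preserve both: the writhe by comparing signs, the winding number because every
  arc in the disc of the move is embedded, before and after it, and keeps its ends.  By the secant
  argument of Hopf the total turning of an embedded arc that joins two boundary points of a
  round disc depends only on its end points and end tangents (\<open>winding_number_replace_arc\<close>).
  Hence \<open>w - W\<close> changes under \<open>\<Omega>1a\<close> and \<open>\<Omega>1d\<close> only, and \<open>w + W\<close> under
  \<open>\<Omega>1b\<close> and \<open>\<Omega>1c\<close> only; the four sets in the theorem consist of the moves that
  increase or decrease one of these two numbers.  If a set of moves misses one of the four, then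
  one of the numbers is monotone along all its sequences of moves.

  It remains to see that neither number is constant on the diagrams of a given link.  A half turn
  of space about a horizontal axis reflects a diagram and exchanges over and under; this preserves
  \<open>w\<close> and negates \<open>W\<close> (\<open>writhe_reflected\<close>, \<open>total_winding_reflected\<close>).  So a single
  diagram with \<open>W \<noteq> 0\<close> suffices: it and its image differ in \<open>w - W\<close> and in
  \<open>w + W\<close>, and a generating set leads from each of them to the other.

  Such a diagram is obtained by deforming the link with shears of space, which are isotopic
  to the identity for a trivial reason.  With coordinates \<open>x\<close>, \<open>y\<close> in the plane of
  projection and the height \<open>z\<close>, a theorem of Sard yields a shear whose projection is an immersion
  with finitely many transverse double points (\<open>exists_small_generic_shear\<close>).  If \<open>W = 0\<close>, the
  link is moved so that \<open>y\<close> has a unique nondegenerate maximum on it, with a tangent there that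
  is not horizontal in space.  A shear in the direction of \<open>x\<close> that grows with \<open>z\<close> and is concentrated near
  the level of the maximum then reverses the direction in which the projection passes its maximum,
  and has no such effect elsewhere.  The tangent now turns from the upper to the lower half plane through the other half
  of the real axis, so one component gains or loses a full turn
  (\<open>deformation_with_nonzero_winding_if_strict_maximum\<close>).  A further small
  shear makes the projection generic again without changing \<open>W\<close>.
\<close>

section \<open>Winding numbers of tangent loops\<close>

lemma winding_number_loop_homotopy:
  fixes H :: "real \<Rightarrow> real \<Rightarrow> complex"
  assumes "continuous_on ({0..1} \<times> {0..1}) (\<lambda>(u, t). H u t)"
    and "\<And>u t. u \<in> {0..1} \<Longrightarrow> t \<in> {0..1} \<Longrightarrow> H u t \<noteq> 0"
    and "\<And>u. u \<in> {0..1} \<Longrightarrow> H u 1 = H u 0"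
  shows "winding_number (H 0) 0 = winding_number (H 1) 0"
  by (rule winding_number_homotopic_loops, unfold homotopic_loops,
      rule exI[of _ "\<lambda>(u, t). H u t"])
     (use assms in \<open>auto simp: pathstart_def pathfinish_def\<close>)

text \<open>
  The mean of \<open>f\<close> over the parameters between \<open>s\<close> and \<open>t\<close>.  If \<open>f\<close> is the derivative of a
  curve, this is the difference quotient of the curve, extended continuously to the diagonal.
\<close>

definition secant :: "(real \<Rightarrow> complex) \<Rightarrow> real \<times> real \<Rightarrow> complex" where
  "secant f = (\<lambda>(s, t). integral {0..1} (\<lambda>u. f (s + u * (t - s))))"

lemma secant_diagonal [simp]: "secant f (t, t) = f t"
  by (simp add: secant_def)

lemma continuous_on_secant:
  assumes "continuous_on UNIV f"
  shows "continuous_on UNIV (secant f)"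
proof -
  have "continuous_on (UNIV \<times> cbox 0 1) (\<lambda>(x :: real \<times> real, u). f (fst x + u * (snd x - fst x)))"
    unfolding case_prod_beta
    by (rule continuous_on_compose2[OF assms]) (auto intro!: continuous_intros)
  from integral_continuous_on_param[OF this] show ?thesis
    by (simp add: secant_def case_prod_beta)
qed

lemma scaleR_secant:
  assumes f: "continuous_on UNIV f"
    and \<gamma>: "\<And>t. t \<in> {a..b} \<Longrightarrow> (\<gamma> has_vector_derivative f t) (at t within {a..b})"
    and st: "a \<le> s" "s \<le> t" "t \<le> b"
  shows "(t - s) *\<^sub>R secant f (s, t) = \<gamma> t - \<gamma> s"
proof -
  let ?p = "\<lambda>u. s + u * (t - s)"
  have p: "?p u \<in> {a..b}" if "u \<in> {0..1}" for u
    using st that mult_left_le_one_le[of "t - s" u] mult_nonneg_nonneg[of u "t - s"]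
    by (auto simp: algebra_simps)
  have "((\<lambda>u. (t - s) *\<^sub>R f (?p u)) has_integral (\<gamma> \<circ> ?p) 1 - (\<gamma> \<circ> ?p) 0) {0..1}"
  proof (rule fundamental_theorem_of_calculus)
    fix u :: real assume u: "u \<in> {0..1}"
    have "(?p has_vector_derivative (t - s)) (at u within {0..1})"
      by (auto intro!: derivative_eq_intros)
    moreover have "(\<gamma> has_vector_derivative f (?p u)) (at (?p u) within ?p ` {0..1})"
      by (rule has_vector_derivative_within_subset[OF \<gamma>]) (use p u in auto)
    ultimately show "((\<gamma> \<circ> ?p) has_vector_derivative (t - s) *\<^sub>R f (?p u)) (at u within {0..1})"
      by (rule vector_diff_chain_within)
  qed auto
  then have "((\<lambda>u. (t - s) *\<^sub>R f (?p u)) has_integral \<gamma> t - \<gamma> s) {0..1}"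
    by simp
  moreover have "(\<lambda>u. f (?p u)) integrable_on {0..1}"
    by (intro integrable_continuous_interval continuous_on_compose2[OF f] continuous_intros) auto
  then have "((\<lambda>u. (t - s) *\<^sub>R f (?p u)) has_integral (t - s) *\<^sub>R secant f (s, t)) {0..1}"
    unfolding secant_def by (auto intro: has_integral_cmul dest: integrable_integral)
  ultimately show ?thesis
    by (blast dest: has_integral_unique)
qed

text \<open>
  Strict convexity of the ball: a chord makes an acute angle with the inner normal at its end on
  the sphere.
\<close>

lemma inner_chord_pos:
  fixes A P c :: "'a::real_inner"
  assumes "A \<in> sphere c r" "P \<in> cball c r" "P \<noteq> A"
  shows "(P - A) \<bullet> (c - A) > 0"
proof -
  have "norm (P - c) \<le> r" "norm (A - c) = r"
    using assms by (auto simp: dist_norm norm_minus_commute)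
  then have "(P - c) \<bullet> (P - c) \<le> (A - c) \<bullet> (A - c)"
    by (metis norm_ge_zero norm_eq_sqrt_inner power2_norm_eq_inner power_mono)
  moreover have "(P - A) \<bullet> (P - A) > 0"
    using assms by simp
  ultimately show ?thesis
    by (simp add: inner_diff_left inner_diff_right inner_commute)
qed

text \<open>
  For \<open>t\<close> from \<open>a\<close> to \<open>b\<close> this path runs from \<open>(a, a)\<close> to \<open>(b, b)\<close> along the two legs of the
  triangle \<open>a \<le> s \<le> t \<le> b\<close>; for other \<open>t\<close> it stays on the diagonal.  Minima and maxima
  in place of a case distinction make its continuity evident.
\<close>

definition corner :: "real \<Rightarrow> real \<Rightarrow> real \<Rightarrow> real \<times> real" where
  "corner a b t = (max (min t a) (min t (2 * t - b)), min (max t b) (max t (2 * t - a)))"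

lemma corner_outside: "a < b \<Longrightarrow> t \<notin> {a<..<b} \<Longrightarrow> corner a b t = (t, t)"
  by (auto simp: corner_def max_def min_def)

lemma corner_inside:
  assumes "a < b" "t \<in> {a..b}"
  shows "(\<exists>x\<in>{a..b}. corner a b t = (a, x)) \<or> (\<exists>x\<in>{a..b}. corner a b t = (x, b))"
  using assms by (auto simp: corner_def max_def min_def)

lemma continuous_on_corner: "continuous_on S (corner a b)"
  unfolding corner_def[abs_def] by (intro continuous_intros)

text \<open>
  The secants of an injective arc with nonvanishing derivative vanish nowhere on the triangle, so
  the diagonal, where the secant is the tangent, can be pushed to the two legs.
\<close>

lemma winding_number_corner:
  assumes f: "continuous_on UNIV f" "\<And>t. f t \<noteq> 0" "f 1 = f 0"
    and ab: "0 < a" "a < b" "b < 1"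
    and \<gamma>: "\<And>t. t \<in> {a..b} \<Longrightarrow> (\<gamma> has_vector_derivative f t) (at t within {a..b})"
    and inj: "inj_on \<gamma> {a..b}"
  shows "winding_number f 0 = winding_number (\<lambda>t. secant f (corner a b t)) 0"
proof -
  define H where "H u t = secant f ((1 - u) *\<^sub>R (t, t) + u *\<^sub>R corner a b t)" for u t
  have "winding_number (H 0) 0 = winding_number (H 1) 0"
  proof (rule winding_number_loop_homotopy)
    show "continuous_on ({0..1} \<times> {0..1}) (\<lambda>(u, t). H u t)"
      unfolding H_def case_prod_beta
      by (rule continuous_on_compose2[OF continuous_on_secant[OF f(1)]])
         (auto intro!: continuous_intros continuous_on_compose2[OF continuous_on_corner])
    show "H u 1 = H u 0" for u
      using ab f(3) by (simp add: H_def corner_outside)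
    fix u t :: real assume ut: "u \<in> {0..1}" "t \<in> {0..1}"
    show "H u t \<noteq> 0"
    proof (cases "t \<in> {a<..<b}")
      case False
      then show ?thesis using ab f(2) by (simp add: H_def corner_outside algebra_simps)
    next
      case True
      obtain x y where xy: "corner a b t = (x, y)" by fastforce
      then have "a \<le> x" "x \<le> t" "t \<le> y" "y \<le> b"
        using True by (auto simp: corner_def max_def min_def split: if_splits)
      define s s' where "s = (1 - u) * t + u * x" and "s' = (1 - u) * t + u * y"
      have s: "a \<le> s" "s \<le> s'" "s' \<le> b"
        unfolding s_def s'_def using convex_bound_le[of "-t" "-a" "-x" "1 - u" u] ut True
          convex_bound_le[of t b y "1 - u" u] mult_left_mono[of x y u]
          \<open>a \<le> x\<close> \<open>x \<le> t\<close> \<open>t \<le> y\<close> \<open>y \<le> b\<close>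
        by (auto simp: algebra_simps)
      have H: "H u t = secant f (s, s')"
        by (simp add: H_def xy s_def s'_def)
      show ?thesis
      proof (cases "s = s'")
        case True
        then show ?thesis using H f(2) by simp
      next
        case False
        then have "\<gamma> s' - \<gamma> s \<noteq> 0"
          using inj s by (auto simp: inj_on_def)
        then show ?thesis
          using scaleR_secant[OF f(1) \<gamma> s] H by auto
      qed
    qed
  qed
  then show ?thesis by (simp add: H_def[abs_def] zero_prod_def[symmetric])
qed

text \<open>
  On the legs of the triangle every secant has an end of the arc as one of its ends.  Since this
  end lies on the circle, the secants of both arcs lie in the open half plane given by the normal
  there, so the segment between them avoids the origin.
\<close>

lemma winding_number_replace_arc:
  assumes f: "continuous_on UNIV f" "\<And>t. f t \<noteq> 0" "f 1 = f 0"
    and g: "continuous_on UNIV g" "\<And>t. g t \<noteq> 0" "g 1 = g 0"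
    and ab: "0 < a" "a < b" "b < 1"
    and fg: "\<And>t. t \<in> {0..1} - {a<..<b} \<Longrightarrow> f t = g t"
    and \<gamma>: "\<And>t. t \<in> {a..b} \<Longrightarrow> (\<gamma> has_vector_derivative f t) (at t within {a..b})"
    and \<delta>: "\<And>t. t \<in> {a..b} \<Longrightarrow> (\<delta> has_vector_derivative g t) (at t within {a..b})"
    and inj: "inj_on \<gamma> {a..b}" "inj_on \<delta> {a..b}"
    and ends: "\<gamma> a = \<delta> a" "\<gamma> b = \<delta> b" "\<gamma> a \<in> sphere c r" "\<gamma> b \<in> sphere c r"
    and disc: "\<gamma> ` {a..b} \<subseteq> cball c r" "\<delta> ` {a..b} \<subseteq> cball c r"
  shows "winding_number f 0 = winding_number g 0"
proof -
  have side: "\<exists>n. secant f (corner a b t) \<bullet> n > 0 \<and> secant g (corner a b t) \<bullet> n > 0"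
    if t: "t \<in> {0..1}" for t
  proof -
    have *: "\<exists>n. secant h (corner a b t) \<bullet> n > 0 \<and> secant k (corner a b t) \<bullet> n > 0"
      if eq: "secant h (corner a b t) = secant k (corner a b t)" "secant h (corner a b t) \<noteq> 0" for h k
      using eq by (intro exI[of _ "secant h (corner a b t)"]) auto
    show ?thesis
    proof (cases "t \<in> {a<..<b}")
      case False
      then show ?thesis
        using fg[of t] f(2)[of t] ab t by (intro *) (auto simp: corner_outside)
    next
      case True
      then consider x where "x \<in> {a..b}" "corner a b t = (a, x)"
        | x where "x \<in> {a..b}" "corner a b t = (x, b)"
        using corner_inside[of a b t] ab by auto
      then show ?thesis
      proof cases
        case 1
        show ?thesis
        proof (cases "x = a")
          case True
          then show ?thesis using 1 fg[of a] f(2)[of a] ab by (intro *) auto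
        next
          case False
          then have "\<gamma> x \<noteq> \<gamma> a" "\<delta> x \<noteq> \<delta> a"
            using 1 ab inj_onD[OF inj(1), of x a] inj_onD[OF inj(2), of x a] by auto
          then have "(\<gamma> x - \<gamma> a) \<bullet> (c - \<gamma> a) > 0" "(\<delta> x - \<delta> a) \<bullet> (c - \<delta> a) > 0"
            using 1 ends disc ab by (auto intro!: inner_chord_pos)
          then have "((x - a) *\<^sub>R secant f (a, x)) \<bullet> (c - \<gamma> a) > 0"
            "((x - a) *\<^sub>R secant g (a, x)) \<bullet> (c - \<gamma> a) > 0"
            using scaleR_secant[OF f(1) \<gamma>, of a x] scaleR_secant[OF g(1) \<delta>, of a x] 1 ab ends
            by auto
          then show ?thesis
            using 1 False by (auto simp: zero_less_mult_iff)
        qed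
      next
        case 2
        show ?thesis
        proof (cases "x = b")
          case True
          then show ?thesis using 2 fg[of b] f(2)[of b] ab by (intro *) auto
        next
          case False
          then have "\<gamma> x \<noteq> \<gamma> b" "\<delta> x \<noteq> \<delta> b"
            using 2 ab inj_onD[OF inj(1), of x b] inj_onD[OF inj(2), of x b] by auto
          then have "(\<gamma> x - \<gamma> b) \<bullet> (c - \<gamma> b) > 0" "(\<delta> x - \<delta> b) \<bullet> (c - \<delta> b) > 0"
            using 2 ends disc ab by (auto intro!: inner_chord_pos)
          then have "((b - x) *\<^sub>R secant f (x, b)) \<bullet> (\<gamma> b - c) > 0"
            "((b - x) *\<^sub>R secant g (x, b)) \<bullet> (\<gamma> b - c) > 0"
            using scaleR_secant[OF f(1) \<gamma>, of x b] scaleR_secant[OF g(1) \<delta>, of x b] 2 ab ends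
            by (auto simp: inner_diff_left inner_diff_right)
          then show ?thesis
            using 2 False by (auto simp: zero_less_mult_iff)
        qed
      qed
    qed
  qed
  have cont: "continuous_on A (\<lambda>t. secant h (corner a b t))" if "continuous_on UNIV h" for h A
    by (rule continuous_on_compose2[OF continuous_on_secant[OF that] continuous_on_corner]) auto
  have "winding_number f 0 = winding_number (\<lambda>t. secant f (corner a b t)) 0"
    by (rule winding_number_corner[OF f ab \<gamma> inj(1)])
  also have "\<dots> = winding_number (\<lambda>t. secant g (corner a b t)) 0"
  proof (rule winding_number_loops_linear_eq)
    fix t :: real assume "t \<in> {0..1}"
    then obtain n where n: "secant f (corner a b t) \<bullet> n > 0" "secant g (corner a b t) \<bullet> n > 0"
      using side by blast
    have "convex {z. n \<bullet> z > 0}" by (rule convex_halfspace_gt)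
    then have "closed_segment (secant g (corner a b t)) (secant f (corner a b t)) \<subseteq> {z. n \<bullet> z > 0}"
      using n by (intro closed_segment_subset) (auto simp: inner_commute)
    then show "0 \<notin> closed_segment (secant g (corner a b t)) (secant f (corner a b t))"
      by auto
  qed (use f g ab in \<open>auto simp: path_def pathstart_def pathfinish_def corner_outside intro!: cont\<close>)
  also have "\<dots> = winding_number g 0"
    by (rule winding_number_corner[symmetric, OF g ab \<delta> inj(2)])
  finally show ?thesis .
qed

lemma winding_number_shift:
  fixes f :: "real \<Rightarrow> complex"
  assumes "continuous_on UNIV f" "\<And>t. f t \<noteq> 0" "\<And>t. f (t + 1) = f t"
  shows "winding_number (\<lambda>t. f (t + c)) 0 = winding_number f 0"
proof -
  have "winding_number (\<lambda>t. f (t + 0 * c)) 0 = winding_number (\<lambda>t. f (t + 1 * c)) 0"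
    by (rule winding_number_loop_homotopy[where H = "\<lambda>u t. f (t + u * c)"])
       (use assms(2) assms(3)[of "_ * c"] in \<open>auto simp: add.commute case_prod_beta
          intro!: continuous_on_compose2[OF assms(1)] continuous_intros\<close>)
  then show ?thesis by simp
qed

text \<open>
  If the winding numbers were equal, the difference of the arguments of \<open>w\<close> and \<open>v\<close> would be
  periodic.  But it takes values in the odd multiples of \<open>pi\<close> at \<open>t0\<close> only, and crosses such a
  value there in a definite direction, so it ends on the other side of it than it started.
\<close>

lemma winding_number_neq_if_one_negative_crossing:
  fixes v w :: "real \<Rightarrow> complex"
  assumes v: "continuous_on UNIV v" "\<And>t. v t \<noteq> 0" "\<And>t. v (t + 1) = v t"
    and w: "continuous_on UNIV w" "\<And>t. w t \<noteq> 0" "\<And>t. w (t + 1) = w t"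
    and away: "\<And>t. t \<in> {t0 - 1/2..t0 + 1/2} \<Longrightarrow> t \<noteq> t0 \<Longrightarrow> w t * cnj (v t) \<notin> \<real>\<^sub>\<le>\<^sub>0"
    and at: "w t0 * cnj (v t0) \<in> \<real>\<^sub>\<le>\<^sub>0"
    and d: "d > 0" "\<And>t. t \<in> {t0<..<t0 + d} \<Longrightarrow> Im (w t * cnj (v t)) > 0"
      "\<And>t. t \<in> {t0 - d<..<t0} \<Longrightarrow> Im (w t * cnj (v t)) < 0"
  shows "winding_number v 0 \<noteq> winding_number w 0"
proof
  assume eq: "winding_number v 0 = winding_number w 0"
  have log: "\<exists>l. continuous_on {0..1} l \<and>
       l 1 - l 0 = 2 * of_real pi * \<i> * winding_number f 0 \<and>
       (\<forall>t\<in>{0..1}. f (t + (t0 - 1/2)) = exp (l t))"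
    if "continuous_on UNIV f" "\<And>t. f t \<noteq> 0" "\<And>t. f (t + 1) = f t" for f :: "real \<Rightarrow> complex"
  proof -
    have "path (\<lambda>t. f (t + (t0 - 1/2)))"
      unfolding path_def
      by (rule continuous_on_compose2[OF that(1)]) (auto intro!: continuous_intros)
    moreover have "0 \<notin> path_image (\<lambda>t. f (t + (t0 - 1/2)))"
      using that(2) by (metis imageE path_image_def)
    ultimately obtain l where "path l"
      "pathfinish l - pathstart l = 2 * of_real pi * \<i> * winding_number (\<lambda>t. f (t + (t0 - 1/2))) 0"
      "\<And>t. t \<in> {0..1} \<Longrightarrow> f (t + (t0 - 1/2)) = 0 + exp (l t)"
      by (rule winding_number_as_continuous_log) blast
    then show ?thesis
      using winding_number_shift[OF that, of "t0 - 1/2"]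
      by (intro exI[of _ l]) (auto simp: path_def pathstart_def pathfinish_def)
  qed
  obtain lv where lv: "continuous_on {0..1} lv" "lv 1 - lv 0 = 2 * of_real pi * \<i> * winding_number v 0"
    "\<And>t. t \<in> {0..1} \<Longrightarrow> v (t + (t0 - 1/2)) = exp (lv t)"
    using log[OF v] by blast
  obtain lw where lw: "continuous_on {0..1} lw" "lw 1 - lw 0 = 2 * of_real pi * \<i> * winding_number w 0"
    "\<And>t. t \<in> {0..1} \<Longrightarrow> w (t + (t0 - 1/2)) = exp (lw t)"
    using log[OF w] by blast
  \<comment> \<open>The parameters are shifted so that \<open>t0\<close> becomes \<open>1/2\<close>; \<open>n\<close> is the difference of the arguments,
    normalised to vanish there.\<close>
  define r where "r t = w (t + (t0 - 1/2)) * cnj (v (t + (t0 - 1/2)))" for t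
  define n where "n t = Im (lw t - lv t) - Im (lw (1/2) - lv (1/2))" for t
  define K where "K t = exp (Re (lw t) + Re (lv t))" for t
  have r: "r t = K t *\<^sub>R cis (Im (lw t - lv t))" if "t \<in> {0..1}" for t
  proof -
    have "r t = exp (lw t) * cnj (exp (lv t))"
      unfolding r_def using that by (simp only: lv(3) lw(3))
    then show ?thesis
      by (simp add: K_def complex_eq_iff Re_exp Im_exp cos_diff sin_diff exp_add algebra_simps)
  qed
  have half: "cis (Im (lw (1/2) - lv (1/2))) = -1"
  proof -
    have "r (1/2) \<in> \<real>\<^sub>\<le>\<^sub>0"
      using at by (simp add: r_def)
    moreover have "K (1/2) > 0" by (simp add: K_def)
    ultimately have "sin (Im (lw (1/2) - lv (1/2))) = 0" "cos (Im (lw (1/2) - lv (1/2))) \<le> 0"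
      using r[of "1/2"] by (auto simp: complex_nonpos_Reals_iff mult_le_0_iff)
    then have "cos (Im (lw (1/2) - lv (1/2))) = -1"
      using sin_cos_squared_add[of "Im (lw (1/2) - lv (1/2))"] by (auto simp: power2_eq_1_iff)
    with \<open>sin _ = 0\<close> show ?thesis by (simp add: complex_eq_iff)
  qed
  have rn: "r t = - K t *\<^sub>R cis (n t)" if "t \<in> {0..1}" for t
  proof -
    have "cis (Im (lw t - lv t)) = cis (n t) * cis (Im (lw (1/2) - lv (1/2)))"
      by (simp add: cis_mult n_def)
    then show ?thesis using r[OF that] half by simp
  qed
  have K: "K t > 0" for t by (simp add: K_def)
  have n_neq_0: "n t \<noteq> 0" if "t \<in> {0..1}" "t \<noteq> 1/2" for t
  proof
    assume "n t = 0"
    with rn[OF that(1)] K[of t] have "r t \<in> \<real>\<^sub>\<le>\<^sub>0"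
      by (simp add: complex_nonpos_Reals_iff)
    with away[of "t + (t0 - 1/2)"] that show False by (auto simp: r_def)
  qed
  have cont_n: "continuous_on {0..1} n"
    unfolding n_def by (intro continuous_intros lv lw)
  then have "continuous (at (1/2) within {0..1}) n"
    by (auto simp: continuous_on_eq_continuous_within)
  then obtain e where e: "e > 0" "\<And>t. t \<in> {0..1} \<Longrightarrow> \<bar>t - 1/2\<bar> < e \<Longrightarrow> \<bar>n t\<bar> < pi"
    unfolding continuous_within_eps_delta dist_real_def
    using pi_gt_zero by (metis diff_zero n_def diff_self)
  define h where "h = min (min d e) (1/2) / 2"
  have h: "h > 0" "h < d" "h < e" "h < 1/2"
    using d e by (auto simp: h_def)
  have sin_neg: "x < 0" if "sin x < 0" "\<bar>x\<bar> < pi" for x :: real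
    using that sin_ge_zero[of x] by linarith
  have Im_r: "Im (r t) = - (K t * sin (n t))" if "t \<in> {0..1}" for t
    using rn[OF that] by simp
  have Im_r_pos: "n t < 0" if "Im (r t) > 0" "t \<in> {0..1}" "\<bar>t - 1/2\<bar> < e" for t
  proof (rule sin_neg)
    have "K t * sin (n t) < 0" using that Im_r by simp
    then show "sin (n t) < 0" using K[of t] by (simp add: mult_less_0_iff)
  qed (use e that in blast)
  have Im_r_neg: "- n t < 0" if "Im (r t) < 0" "t \<in> {0..1}" "\<bar>t - 1/2\<bar> < e" for t
  proof (rule sin_neg)
    have "K t * sin (n t) > 0" using that Im_r by simp
    then show "sin (- n t) < 0" using K[of t] by (simp add: zero_less_mult_iff)
    show "\<bar>- n t\<bar> < pi" using e that by simp
  qed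
  have "r (1/2 + h) = w (t0 + h) * cnj (v (t0 + h))" "r (1/2 - h) = w (t0 - h) * cnj (v (t0 - h))"
    by (simp_all add: r_def algebra_simps)
  then have "Im (r (1/2 + h)) > 0" "Im (r (1/2 - h)) < 0"
    using d(2)[of "t0 + h"] d(3)[of "t0 - h"] h by auto
  then have right: "n (1/2 + h) < 0" and left: "- n (1/2 - h) < 0"
    using h Im_r_pos[of "1/2 + h"] Im_r_neg[of "1/2 - h"] by auto
  have "n 1 < 0"
  proof (rule ccontr)
    assume "\<not> n 1 < 0"
    then obtain x where "1/2 + h \<le> x" "x \<le> 1" "n x = 0"
      using IVT'[of n "1/2 + h" 0 1] right h continuous_on_subset[OF cont_n, of "{1/2 + h..1}"] by auto
    then show False using n_neq_0[of x] h by auto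
  qed
  moreover have "n 0 > 0"
  proof (rule ccontr)
    assume "\<not> n 0 > 0"
    then obtain x where "0 \<le> x" "x \<le> 1/2 - h" "n x = 0"
      using IVT'[of n 0 0 "1/2 - h"] left h continuous_on_subset[OF cont_n, of "{0..1/2 - h}"] by auto
    then show False using n_neq_0[of x] h by auto
  qed
  moreover have "lw 1 - lw 0 = lv 1 - lv 0"
    using lv(2) lw(2) eq by simp
  then have "n 1 = n 0"
    by (simp add: n_def complex_eq_iff)
  ultimately show False by simp
qed

section \<open>Smooth curves and deformations of space\<close>

text \<open>
  Smoothness is the weakest property of differentiable curves that passes to the derivative.
\<close>

lemma smooth_curve_coinduct:
  assumes "f \<in> S"
    and "\<And>f. f \<in> S \<Longrightarrow> \<exists>f'\<in>S. \<forall>t. (f has_vector_derivative f' t) (at t)"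
  shows "smooth_curve f"
proof -
  obtain d where d: "\<And>f. f \<in> S \<Longrightarrow> d f \<in> S \<and> (\<forall>t. (f has_vector_derivative d f t) (at t))"
    using assms(2) by metis
  have "(d ^^ k) f \<in> S" for k
    by (induction k) (use assms(1) d in auto)
  then show ?thesis
    unfolding smooth_curve_def by (intro exI[of _ "\<lambda>k. (d ^^ k) f"]) (use d in auto)
qed

lemma smooth_curveE:
  assumes "smooth_curve f"
  obtains f' where "smooth_curve f'" "\<And>t. (f has_vector_derivative f' t) (at t)"
proof -
  obtain F where F: "F 0 = f" "\<forall>k::nat. \<forall>t. (F k has_vector_derivative F (Suc k) t) (at t)"
    using assms unfolding smooth_curve_def by blast
  have "smooth_curve (F 1)"
    unfolding smooth_curve_def by (rule exI[of _ "\<lambda>k. F (Suc k)"]) (use F in auto)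
  moreover have "(f has_vector_derivative F 1 t) (at t)" for t
    using F by (metis One_nat_def)
  ultimately show ?thesis using that by blast
qed

lemma smooth_curve_vector_derivative:
  assumes "smooth_curve f"
  shows "(f has_vector_derivative vector_derivative f (at t)) (at t)"
    and "smooth_curve (\<lambda>t. vector_derivative f (at t))"
proof -
  obtain f' where f': "smooth_curve f'" "\<And>t. (f has_vector_derivative f' t) (at t)"
    using assms smooth_curveE by blast
  then have "(\<lambda>t. vector_derivative f (at t)) = f'"
    by (auto simp: vector_derivative_at)
  with f' show "(f has_vector_derivative vector_derivative f (at t)) (at t)"
    "smooth_curve (\<lambda>t. vector_derivative f (at t))"
    by (metis, simp)
qed

lemma smooth_curve_continuous_on: "smooth_curve f \<Longrightarrow> continuous_on S f"
  by (meson continuous_at_imp_continuous_on has_vector_derivative_continuous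
      smooth_curve_vector_derivative(1))

lemma smooth_curve_const: "smooth_curve (\<lambda>t. c)"
  by (rule smooth_curve_coinduct[where S = "range (\<lambda>c t. c)"])
     (auto intro!: bexI[of _ "\<lambda>t. 0"] derivative_eq_intros)

lemma smooth_curve_bounded_linear:
  assumes "bounded_linear h" "smooth_curve f"
  shows "smooth_curve (\<lambda>t. h (f t))"
proof (rule smooth_curve_coinduct[where S = "{\<lambda>t. h (f t) |f. smooth_curve f}"])
  show "(\<lambda>t. h (f t)) \<in> {\<lambda>t. h (f t) |f. smooth_curve f}" using assms by blast
  fix g assume "g \<in> {\<lambda>t. h (f t) |f. smooth_curve f}"
  then obtain f where f: "g = (\<lambda>t. h (f t))" "smooth_curve f" by blast
  then obtain f' where f': "smooth_curve f'" "\<And>t. (f has_vector_derivative f' t) (at t)"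
    using smooth_curveE by blast
  have "\<forall>t. (g has_vector_derivative h (f' t)) (at t)"
    unfolding f by (auto intro!: bounded_linear.has_vector_derivative[OF assms(1)] f')
  with f'(1) show "\<exists>f'\<in>{\<lambda>t. h (f t) |f. smooth_curve f}. \<forall>t. (g has_vector_derivative f' t) (at t)"
    by (intro bexI[of _ "\<lambda>t. h (f' t)"]) auto
qed

lemma smooth_curve_Pair:
  assumes "smooth_curve f" "smooth_curve g"
  shows "smooth_curve (\<lambda>t. (f t, g t))"
proof (rule smooth_curve_coinduct[where S = "{\<lambda>t. (f t, g t) |f g. smooth_curve f \<and> smooth_curve g}"])
  show "(\<lambda>t. (f t, g t)) \<in> {\<lambda>t. (f t, g t) |f g. smooth_curve f \<and> smooth_curve g}"
    using assms by blast
  fix k :: "real \<Rightarrow> 'a \<times> 'b" assume "k \<in> {\<lambda>t. (f t, g t) |f g. smooth_curve f \<and> smooth_curve g}"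
  then obtain f g where k: "k = (\<lambda>t. (f t, g t))" "smooth_curve f" "smooth_curve g" by blast
  obtain f' where f': "smooth_curve f'" "\<And>t. (f has_vector_derivative f' t) (at t)"
    using k smooth_curveE by blast
  obtain g' where g': "smooth_curve g'" "\<And>t. (g has_vector_derivative g' t) (at t)"
    using k smooth_curveE by blast
  have "\<forall>t. (k has_vector_derivative (f' t, g' t)) (at t)"
    unfolding k by (auto intro!: has_vector_derivative_Pair f' g')
  with f'(1) g'(1) show "\<exists>k'\<in>{\<lambda>t. (f t, g t) |f g. smooth_curve f \<and> smooth_curve g}.
      \<forall>t. (k has_vector_derivative k' t) (at t)"
    by (intro bexI[of _ "\<lambda>t. (f' t, g' t)"]) auto
qed

lemma smooth_curve_add:
  fixes f g :: "real \<Rightarrow> 'a::real_normed_vector"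
  assumes "smooth_curve f" "smooth_curve g"
  shows "smooth_curve (\<lambda>t. f t + g t)"
proof -
  have "bounded_linear (\<lambda>p :: 'a \<times> 'a. fst p + snd p)"
    by (intro bounded_linear_add bounded_linear_fst bounded_linear_snd)
  from smooth_curve_bounded_linear[OF this smooth_curve_Pair[OF assms]] show ?thesis by simp
qed

text \<open>
  By the product rule this class of curves is closed under differentiation, which single products
  are not.
\<close>

inductive sum_of_products ::
  "('a::real_normed_vector \<Rightarrow> 'b::real_normed_vector \<Rightarrow> 'c::real_normed_vector) \<Rightarrow>
   (real \<Rightarrow> 'c) \<Rightarrow> bool" for prod where
  product: "smooth_curve f \<Longrightarrow> smooth_curve g \<Longrightarrow> sum_of_products prod (\<lambda>t. prod (f t) (g t))"
| sum: "sum_of_products prod f \<Longrightarrow> sum_of_products prod g \<Longrightarrow> sum_of_products prod (\<lambda>t. f t + g t)"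

lemma (in bounded_bilinear) smooth_curve:
  assumes "smooth_curve f" "smooth_curve g"
  shows "smooth_curve (\<lambda>t. prod (f t) (g t))"
proof (rule smooth_curve_coinduct[where S = "Collect (sum_of_products prod)"])
  show "(\<lambda>t. prod (f t) (g t)) \<in> Collect (sum_of_products prod)"
    using assms by (auto intro: sum_of_products.product)
  fix k assume "k \<in> Collect (sum_of_products prod)"
  then have "sum_of_products prod k" by simp
  then have "\<exists>k'. sum_of_products prod k' \<and> (\<forall>t. (k has_vector_derivative k' t) (at t))"
  proof induction
    case (product f g)
    obtain f' where f': "smooth_curve f'" "\<And>t. (f has_vector_derivative f' t) (at t)"
      using product smooth_curveE by blast
    obtain g' where g': "smooth_curve g'" "\<And>t. (g has_vector_derivative g' t) (at t)"
      using product smooth_curveE by blast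
    have "sum_of_products prod (\<lambda>t. prod (f t) (g' t) + prod (f' t) (g t))"
      using f' g' product by (auto intro!: sum_of_products.intros)
    moreover have "\<forall>t. ((\<lambda>t. prod (f t) (g t)) has_vector_derivative
        prod (f t) (g' t) + prod (f' t) (g t)) (at t)"
      using f' g' by (auto intro!: has_vector_derivative)
    ultimately show ?case by blast
  next
    case (sum f g)
    then obtain f' g' where "sum_of_products prod f'" "\<forall>t. (f has_vector_derivative f' t) (at t)"
      "sum_of_products prod g'" "\<forall>t. (g has_vector_derivative g' t) (at t)" by blast
    then show ?case
      by (intro exI[of _ "\<lambda>t. f' t + g' t"])
         (auto intro: sum_of_products.sum has_vector_derivative_add)
  qed
  then show "\<exists>k'\<in>Collect (sum_of_products prod). \<forall>t. (k has_vector_derivative k' t) (at t)"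
    by blast
qed

lemmas smooth_curve_scaleR = bounded_bilinear.smooth_curve[OF bounded_bilinear_scaleR]
  and smooth_curve_mult = bounded_bilinear.smooth_curve[OF bounded_bilinear_mult]
  and smooth_curve_fst = smooth_curve_bounded_linear[OF bounded_linear_fst]
  and smooth_curve_snd = smooth_curve_bounded_linear[OF bounded_linear_snd]
  and smooth_curve_Re = smooth_curve_bounded_linear[OF bounded_linear_Re]
  and smooth_curve_Im = smooth_curve_bounded_linear[OF bounded_linear_Im]

lemma smooth_curve_power:
  fixes f :: "real \<Rightarrow> 'a::real_normed_algebra_1"
  shows "smooth_curve f \<Longrightarrow> smooth_curve (\<lambda>t. f t ^ n)"
  by (induction n) (auto intro: smooth_curve_mult smooth_curve_const)

lemma smooth_curve_diff:
  assumes "smooth_curve f" "smooth_curve g"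
  shows "smooth_curve (\<lambda>t. f t - g t)"
  using smooth_curve_add[OF assms(1) smooth_curve_bounded_linear[OF bounded_linear_minus[OF bounded_linear_ident] assms(2)]]
  by simp

lemmas smooth_curve_intros =
  smooth_curve_const smooth_curve_add smooth_curve_diff smooth_curve_scaleR smooth_curve_mult
  smooth_curve_power smooth_curve_fst smooth_curve_snd smooth_curve_Re smooth_curve_Im
  smooth_curve_Pair

text \<open>
  A differentiable inverse makes all derivatives bijective.  In finite dimension the continuity of
  the derivative may be checked on each vector separately.
\<close>

lemma diffeotopyI:
  fixes h :: "real \<Rightarrow> 'a::euclidean_space \<Rightarrow> 'a"
  assumes start: "\<And>x. h 0 x = x"
    and cont: "continuous_on ({0..1} \<times> UNIV) (\<lambda>(s, x). h s x)"
    and D: "\<And>s x. s \<in> {0..1} \<Longrightarrow> (h s has_derivative D s x) (at x)"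
    and cont_D: "\<And>v. continuous_on ({0..1} \<times> UNIV) (\<lambda>(s, x). D s x v)"
    and inverse: "\<And>s x. s \<in> {0..1} \<Longrightarrow> g s (h s x) = x" "\<And>s x. s \<in> {0..1} \<Longrightarrow> h s (g s x) = x"
    and E: "\<And>s x. s \<in> {0..1} \<Longrightarrow> (g s has_derivative E s x) (at x)"
  shows "diffeotopy h"
  unfolding diffeotopy_def
proof (intro conjI ballI allI exI)
  show "h 0 x = x" for x by (rule start)
  show "continuous_on ({0..1} \<times> UNIV) (\<lambda>(s, x). h s x)" by (rule cont)
  fix s :: real assume s: "s \<in> {0..1}"
  show "bij (h s)"
    using inverse[OF s] by (intro o_bij[of "g s"]) auto
  fix x
  have D_eq: "blinfun_apply (Blinfun (D s x)) = D s x"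
    using D[OF s] by (intro bounded_linear_Blinfun_apply has_derivative_bounded_linear)
  show "(h s has_derivative blinfun_apply (Blinfun (D s x))) (at x)"
    unfolding D_eq by (rule D[OF s])
  have "(g s \<circ> h s has_derivative E s (h s x) \<circ> D s x) (at x)"
    by (intro diff_chain_at D E s)
  moreover have "g s \<circ> h s = id" using inverse[OF s] by auto
  ultimately have 1: "E s (h s x) \<circ> D s x = id"
    by (metis has_derivative_unique has_derivative_id eq_id_iff)
  have "(h s \<circ> g s has_derivative D s x \<circ> E s (h s x)) (at (h s x))"
    using diff_chain_at[OF E[OF s] D[OF s], of "h s x"] inverse[OF s] by simp
  moreover have "h s \<circ> g s = id" using inverse[OF s] by auto
  ultimately have 2: "D s x \<circ> E s (h s x) = id"
    by (metis has_derivative_unique has_derivative_id eq_id_iff)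
  show "bij (blinfun_apply (Blinfun (D s x)))"
    unfolding D_eq using 1 2 by (rule o_bij)
next
  show "continuous_on ({0..1} \<times> UNIV) (\<lambda>(s, x). Blinfun (D s x))"
  proof (rule continuous_on_blinfun_componentwise)
    fix i :: 'a
    have "continuous_on ({0..1} \<times> UNIV) (\<lambda>p. D (fst p) (snd p) i)"
      using cont_D[of i] by (simp add: case_prod_beta)
    then show "continuous_on ({0..1} \<times> UNIV) (\<lambda>p. blinfun_apply (case p of (s, x) \<Rightarrow> Blinfun (D s x)) i)"
    proof (rule continuous_on_eq)
      fix p :: "real \<times> 'a" assume "p \<in> {0..1} \<times> UNIV"
      then show "D (fst p) (snd p) i = blinfun_apply (case p of (s, x) \<Rightarrow> Blinfun (D s x)) i"
        using D[of "fst p" "snd p"]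
        by (auto simp: case_prod_beta bounded_linear_Blinfun_apply has_derivative_bounded_linear)
    qed
  qed
qed

text \<open>
  The isotopies are composed at each time, so that their ends compose and time needs no
  reparametrisation.
\<close>

lemma diffeotopy_compose:
  assumes h: "diffeotopy h" and k: "diffeotopy k"
  shows "diffeotopy (\<lambda>s. k s \<circ> h s)"
proof -
  from h obtain h' where h': "\<And>s x. s \<in> {0..1} \<Longrightarrow> (h s has_derivative blinfun_apply (h' s x)) (at x)"
     "\<And>s x. s \<in> {0..1} \<Longrightarrow> bij (blinfun_apply (h' s x))"
     "continuous_on ({0..1} \<times> UNIV) (\<lambda>(s, x). h' s x)"
    and ch: "continuous_on ({0..1} \<times> UNIV) (\<lambda>(s, x). h s x)"
    unfolding diffeotopy_def by blast
  from k obtain k' where k': "\<And>s x. s \<in> {0..1} \<Longrightarrow> (k s has_derivative blinfun_apply (k' s x)) (at x)"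
     "\<And>s x. s \<in> {0..1} \<Longrightarrow> bij (blinfun_apply (k' s x))"
     "continuous_on ({0..1} \<times> UNIV) (\<lambda>(s, x). k' s x)"
    and ck: "continuous_on ({0..1} \<times> UNIV) (\<lambda>(s, x). k s x)"
    unfolding diffeotopy_def by blast
  have sh: "continuous_on ({0..1} \<times> UNIV) (\<lambda>p. (fst p, h (fst p) (snd p)))"
    using ch by (intro continuous_intros) (simp add: case_prod_beta)
  have into: "(\<lambda>p. (fst p, h (fst p) (snd p))) ` ({0..1} \<times> UNIV) \<subseteq> {0..1} \<times> UNIV"
    by auto
  show ?thesis
    unfolding diffeotopy_def
  proof (intro conjI ballI allI exI)
    show "(k 0 \<circ> h 0) x = x" for x using h k by (simp add: diffeotopy_def)
    show "continuous_on ({0..1} \<times> UNIV) (\<lambda>(s, x). (k s \<circ> h s) x)"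
      using continuous_on_compose2[OF ck sh into] by (simp add: case_prod_beta)
    have "continuous_on ({0..1} \<times> UNIV) (\<lambda>p. k' (fst p) (h (fst p) (snd p)))"
      using continuous_on_compose2[OF k'(3) sh into] by (simp add: case_prod_beta)
    then show "continuous_on ({0..1} \<times> UNIV) (\<lambda>(s, x). k' s (h s x) o\<^sub>L h' s x)"
      using h'(3) unfolding case_prod_beta
      by (rule bounded_bilinear.continuous_on[OF bounded_bilinear_blinfun_compose])
    fix s :: real assume s: "s \<in> {0..1}"
    show "bij (k s \<circ> h s)" using h k s by (auto simp: diffeotopy_def intro: bij_comp)
    fix x
    show "(k s \<circ> h s has_derivative blinfun_apply (k' s (h s x) o\<^sub>L h' s x)) (at x)"
      using diff_chain_at[OF h'(1)[OF s] k'(1)[OF s]] by (simp add: blinfun_compose.rep_eq)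
    show "bij (blinfun_apply (k' s (h s x) o\<^sub>L h' s x))"
      using bij_comp[OF h'(2)[OF s] k'(2)[OF s]] by (simp add: blinfun_compose.rep_eq)
  qed
qed

text \<open>
  The maps of an isotopy are only continuously differentiable, so they need not preserve smooth
  curves; this is asked for in addition.
\<close>

definition deformation :: "('a::euclidean_space \<Rightarrow> 'a) \<Rightarrow> bool" where
  "deformation f \<longleftrightarrow> (\<exists>h. diffeotopy h \<and> h 1 = f) \<and>
     (\<forall>\<gamma>. smooth_curve \<gamma> \<longrightarrow> smooth_curve (\<lambda>t. f (\<gamma> t)))"

lemma deformation_compose:
  assumes "deformation f" "deformation g"
  shows "deformation (g \<circ> f)"
proof -
  obtain h k where "diffeotopy h" "h 1 = f" "diffeotopy k" "k 1 = g"
    using assms unfolding deformation_def by blast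
  then have "diffeotopy (\<lambda>s. k s \<circ> h s)" "k 1 \<circ> h 1 = g \<circ> f"
    by (simp_all add: diffeotopy_compose)
  then show ?thesis
    using assms unfolding deformation_def by (intro conjI exI[of _ "\<lambda>s. k s \<circ> h s"]) auto
qed

text \<open>
  As \<open>\<Psi>\<close> is constant along the lines on which it moves the points, the inverse of adding
  \<open>s *\<^sub>R \<Psi> p\<close> is subtracting it.
\<close>

lemma deformation_shear:
  fixes \<Psi> :: "'a::euclidean_space \<Rightarrow> 'a"
  assumes \<Psi>: "\<And>s p. \<Psi> (p + s *\<^sub>R \<Psi> p) = \<Psi> p"
    and D: "\<And>p. (\<Psi> has_derivative D p) (at p)"
    and cont_D: "\<And>v. continuous_on UNIV (\<lambda>p. D p v)"
    and smooth: "\<And>\<gamma>. smooth_curve \<gamma> \<Longrightarrow> smooth_curve (\<lambda>t. \<Psi> (\<gamma> t))"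
  shows "deformation (\<lambda>p. p + \<Psi> p)"
proof -
  have "continuous_on UNIV \<Psi>"
    using D by (meson continuous_at_imp_continuous_on has_derivative_continuous)
  then have \<Psi>_snd: "continuous_on ({0..1} \<times> UNIV) (\<lambda>q :: real \<times> 'a. \<Psi> (snd q))"
    by (rule continuous_on_compose2) (auto intro!: continuous_intros)
  have D_snd: "continuous_on ({0..1} \<times> UNIV) (\<lambda>q :: real \<times> 'a. D (snd q) v)" for v
    by (rule continuous_on_compose2[OF cont_D]) (auto intro!: continuous_intros)
  have "diffeotopy (\<lambda>s p. p + s *\<^sub>R \<Psi> p)"
  proof (rule diffeotopyI[where D = "\<lambda>s p v. v + s *\<^sub>R D p v" and g = "\<lambda>s p. p - s *\<^sub>R \<Psi> p"
        and E = "\<lambda>s p v. v - s *\<^sub>R D p v"])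
    show "continuous_on ({0..1} \<times> UNIV) (\<lambda>(s, x). x + s *\<^sub>R \<Psi> x)"
      using \<Psi>_snd by (auto simp: case_prod_beta intro!: continuous_intros)
    show "continuous_on ({0..1} \<times> UNIV) (\<lambda>(s, x). v + s *\<^sub>R D x v)" for v
      using D_snd by (auto simp: case_prod_beta intro!: continuous_intros)
    show "p - s *\<^sub>R \<Psi> p + s *\<^sub>R \<Psi> (p - s *\<^sub>R \<Psi> p) = p" for s p
      using \<Psi>[of p "- s"] by simp
  qed (auto simp: \<Psi> intro!: derivative_eq_intros D)
  then show ?thesis
    unfolding deformation_def using smooth
    by (auto intro!: exI[of _ "\<lambda>s p. p + s *\<^sub>R \<Psi> p"] smooth_curve_add)
qed

lemma has_vector_derivative_image:
  assumes "(f has_derivative D) (at (\<gamma> t))" "(\<gamma> has_vector_derivative v) (at t)"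
  shows "((\<lambda>t. f (\<gamma> t)) has_vector_derivative D v) (at t)"
  using diff_chain_at[OF assms(2)[unfolded has_vector_derivative_def] assms(1)] linear_cmul[OF has_derivative_linear[OF assms(1)]]
  by (simp add: has_vector_derivative_def o_def)

definition image_link :: "('a \<Rightarrow> 'a) \<Rightarrow> (real \<Rightarrow> 'a) list \<Rightarrow> (real \<Rightarrow> 'a) list" where
  "image_link f K = map (\<lambda>\<gamma> t. f (\<gamma> t)) K"

lemma length_image_link [simp]: "length (image_link f K) = length K"
  by (simp add: image_link_def)

lemma nth_image_link: "i < length K \<Longrightarrow> image_link f K ! i = (\<lambda>t. f ((K ! i) t))"
  by (simp add: image_link_def)

lemma image_link_compose: "image_link g (image_link f K) = image_link (g \<circ> f) K"
  by (simp add: image_link_def)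

lemma ambient_isotopic_image_link:
  assumes "deformation f"
  shows "ambient_isotopic K (image_link f K)"
proof -
  obtain h where "diffeotopy h" "h 1 = f" using assms unfolding deformation_def by blast
  moreover have "circle_reparam (\<lambda>t. t)"
    unfolding circle_reparam_def by (auto intro!: exI[of _ "\<lambda>_. 1"] derivative_eq_intros)
  ultimately show ?thesis
    unfolding ambient_isotopic_def carries_def
    by (intro exI[of _ h] exI[of _ "\<lambda>i. i"] exI[of _ "\<lambda>i t. t"])
       (simp add: nth_image_link bij_betw_def)
qed

lemma oriented_link_image_link:
  assumes K: "oriented_link K" and f: "deformation f"
  shows "oriented_link (image_link f K)"
proof -
  obtain h where h: "diffeotopy h" "h 1 = f" using f unfolding deformation_def by blast
  have "\<forall>s\<in>{0..1}. bij (h s)" using h(1) unfolding diffeotopy_def by blast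
  then have bij: "bij f" using h(2) by force
  have "\<exists>h'. \<forall>s\<in>{0..1}. \<forall>x. (h s has_derivative blinfun_apply (h' s x)) (at x) \<and> bij (blinfun_apply (h' s x))"
    using h(1) unfolding diffeotopy_def by blast
  then have D: "\<exists>f'. (f has_derivative blinfun_apply f') (at x) \<and> bij (blinfun_apply f')" for x
    using h(2) by (metis atLeastAtMost_iff order_refl zero_le_one)
  have "regular_closed_curve (\<lambda>t. f (\<gamma> t))" if "\<gamma> \<in> set K" for \<gamma>
    unfolding regular_closed_curve_def
  proof (intro conjI allI)
    have \<gamma>: "smooth_curve \<gamma>" "\<And>t. \<gamma> (t + 1) = \<gamma> t" "\<And>t. vector_derivative \<gamma> (at t) \<noteq> 0"
      using K that by (auto simp: oriented_link_def regular_closed_curve_def)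
    show "smooth_curve (\<lambda>t. f (\<gamma> t))" using f \<gamma> by (simp add: deformation_def)
    show "f (\<gamma> (t + 1)) = f (\<gamma> t)" for t using \<gamma> by simp
    fix t
    obtain f' where f': "(f has_derivative blinfun_apply f') (at (\<gamma> t))" "bij (blinfun_apply f')"
      using D by blast
    have "vector_derivative (\<lambda>t. f (\<gamma> t)) (at t) = blinfun_apply f' (vector_derivative \<gamma> (at t))"
      by (rule vector_derivative_at[OF has_vector_derivative_image[OF f'(1)
            smooth_curve_vector_derivative(1)[OF \<gamma>(1)]]])
    moreover have "\<dots> \<noteq> 0"
      using injD[OF bij_is_inj[OF f'(2)], of "vector_derivative \<gamma> (at t)" 0] \<gamma>(3)[of t] by auto
    ultimately show "vector_derivative (\<lambda>t. f (\<gamma> t)) (at t) \<noteq> 0"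
      by simp
  qed
  moreover have "inj_on (point (image_link f K)) (params (image_link f K))"
  proof -
    have "point (image_link f K) x = f (point K x)" if "x \<in> params K" for x
      using that by (auto simp: point_def nth_image_link params_def)
    moreover have "params (image_link f K) = params K" by (simp add: params_def)
    moreover have "inj_on (point K) (params K)" using K by (simp add: oriented_link_def)
    ultimately show ?thesis
      by (intro inj_onI) (metis bij bij_is_inj injD inj_onD)
  qed
  ultimately show ?thesis
    using K by (auto simp: oriented_link_def image_link_def)
qed

section \<open>Generic projections\<close>

text \<open>
  The theorem of Sard in dimension 4, carried over from coordinates by linear isometries.
\<close>

lemma negligible_critical_values:
  fixes f :: "'a::euclidean_space \<Rightarrow> 'b::euclidean_space"
  assumes dim: "DIM('a) = 4" "DIM('b) = 4"
    and f: "\<And>x. x \<in> S \<Longrightarrow> (f has_derivative f' x) (at x)"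
    and crit: "\<And>x. x \<in> S \<Longrightarrow> \<exists>v. v \<noteq> 0 \<and> f' x v = 0"
  shows "negligible (f ` S)"
proof -
  obtain \<phi> :: "real^4 \<Rightarrow> 'a" and \<phi>' where \<phi>: "linear \<phi>" "linear \<phi>'" "\<And>x. \<phi> (\<phi>' x) = x" "\<And>x. \<phi>' (\<phi> x) = x"
  proof -
    have "DIM(real^4) = DIM('a)" by (simp add: dim)
    from isomorphisms_UNIV_UNIV[OF this] show ?thesis using that by metis
  qed
  obtain \<theta> :: "'b \<Rightarrow> real^4" and \<theta>' where \<theta>: "linear \<theta>" "linear \<theta>'" "\<And>x. \<theta>' (\<theta> x) = x"
  proof -
    have "DIM('b) = DIM(real^4)" by (simp add: dim)
    from isomorphisms_UNIV_UNIV[OF this] show ?thesis using that by metis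
  qed
  define g where "g = \<theta> \<circ> f \<circ> \<phi>"
  define g' where "g' y = \<theta> \<circ> f' (\<phi> y) \<circ> \<phi>" for y
  have g': "(g has_derivative g' y) (at y)" if "y \<in> \<phi>' ` S" for y
  proof -
    have "(f has_derivative f' (\<phi> y)) (at (\<phi> y))" using that f \<phi>(3) by auto
    then show ?thesis
      unfolding g_def g'_def using \<phi>(1) \<theta>(1)
      by (intro diff_chain_at) (auto simp: linear_imp_has_derivative)
  qed
  have "negligible (g ` (\<phi>' ` S))"
  proof (rule baby_Sard)
    fix y assume y: "y \<in> \<phi>' ` S"
    show "(g has_derivative g' y) (at y within \<phi>' ` S)"
      using g'[OF y] by (rule has_derivative_at_withinI)
    have lin: "linear (g' y)" using g'[OF y] by (rule has_derivative_linear)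
    obtain v where v: "v \<noteq> 0" "f' (\<phi> y) v = 0"
      using crit[of "\<phi> y"] y \<phi>(3) by auto
    then have "g' y (\<phi>' v) = 0" "\<phi>' v \<noteq> 0"
      using \<phi> \<theta> linear_0[of \<theta>] linear_0[of \<phi>] by (auto simp: g'_def) metis
    then have "\<not> inj (g' y)"
      using linear_0[OF lin] by (metis injD)
    moreover have "rank (matrix (g' y)) = CARD(4) \<longleftrightarrow> inj (g' y)"
      using full_rank_injective[of "matrix (g' y)"] unfolding matrix_vector_mul(2)[OF lin] .
    ultimately have "rank (matrix (g' y)) \<noteq> CARD(4)" by simp
    then show "rank (matrix (g' y)) < CARD(4)"
      using rank_bound[of "matrix (g' y)"] by simp
  qed simp
  then have "negligible (\<theta>' ` (g ` (\<phi>' ` S)))"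
    using dim by (intro negligible_differentiable_image_negligible[OF _ _ linear_imp_differentiable_on[OF \<theta>(2)]]) auto
  then show ?thesis
    by (simp add: image_image g_def \<phi> \<theta>)
qed

lemma det2_eq_0_imp_dependent:
  assumes "det2 u v = 0"
  shows "\<exists>a b. (a \<noteq> 0 \<or> b \<noteq> 0) \<and> a *\<^sub>R u = b *\<^sub>R v"
proof (cases "u = 0")
  case True
  then show ?thesis by (intro exI[of _ 1] exI[of _ 0]) auto
next
  case False
  then consider "Re u \<noteq> 0" | "Im u \<noteq> 0" by (auto simp: complex_eq_iff)
  then show ?thesis
  proof cases
    case 1
    then show ?thesis
      using assms by (intro exI[of _ "Re v"] exI[of _ "Re u"]) (simp add: det2_def complex_eq_iff mult.commute)
  next
    case 2
    then show ?thesis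
      using assms by (intro exI[of _ "Im v"] exI[of _ "Im u"]) (simp add: det2_def complex_eq_iff mult.commute)
  qed
qed

lemma has_derivative_compose_real:
  fixes c :: "real \<Rightarrow> 'b::real_normed_vector"
  assumes "\<And>t. (c has_vector_derivative c' t) (at t)"
    and "(f has_derivative f') (at p within S)"
  shows "((\<lambda>x. c (f x)) has_derivative (\<lambda>h. f' h *\<^sub>R c' (f p))) (at p within S)"
  using has_derivative_compose[OF assms(2) assms(1)[unfolded has_vector_derivative_def]]
  by simp

text \<open>
  The projection of the curve \<open>(w, z)\<close> after a shear of space that moves the horizontal plane at
  height \<open>h\<close> by \<open>h *\<^sub>R A + h\<^sup>2 *\<^sub>R B\<close>, and its velocity.  The four real parameters
  in \<open>A\<close> and \<open>B\<close> leave room to exclude triple points.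
\<close>

definition sheared :: "complex \<Rightarrow> complex \<Rightarrow> (real \<Rightarrow> complex) \<Rightarrow> (real \<Rightarrow> real) \<Rightarrow> real \<Rightarrow> complex" where
  "sheared A B w z t = w t + z t *\<^sub>R A + (z t)\<^sup>2 *\<^sub>R B"

definition sheared_velocity ::
  "complex \<Rightarrow> complex \<Rightarrow> (real \<Rightarrow> complex) \<Rightarrow> (real \<Rightarrow> real) \<Rightarrow> (real \<Rightarrow> real) \<Rightarrow> real \<Rightarrow> complex" where
  "sheared_velocity A B w' z z' t = w' t + z' t *\<^sub>R A + (2 * z t * z' t) *\<^sub>R B"

lemma has_vector_derivative_sheared:
  assumes "(w has_vector_derivative w' t) (at t)" "(z has_real_derivative z' t) (at t)"
  shows "(sheared A B w z has_vector_derivative sheared_velocity A B w' z z' t) (at t)"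
  unfolding sheared_def[abs_def] sheared_velocity_def
  using assms by (auto intro!: derivative_eq_intros)

text \<open>
  The parameter \<open>t\<close> and \<open>B\<close> determine \<open>A\<close>, so these pairs are the image of a set of dimension 3
  in a space of dimension 4.
\<close>

lemma negligible_stationary_shears:
  fixes w w' w'' :: "real \<Rightarrow> complex" and z z' z'' :: "real \<Rightarrow> real"
  assumes w'': "\<And>t. (w' has_vector_derivative w'' t) (at t)"
    and z': "\<And>t. (z has_vector_derivative z' t) (at t)"
    and z'': "\<And>t. (z' has_vector_derivative z'' t) (at t)"
  shows "negligible {(A, B). \<exists>t. z' t \<noteq> 0 \<and> sheared_velocity A B w' z z' t = 0}" (is "negligible ?N")
proof (rule negligible_subset)
  let ?S = "{p :: real \<times> complex. z' (fst p) \<noteq> 0}"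
  let ?F = "\<lambda>p. (- (inverse (z' (fst p)) *\<^sub>R w' (fst p)) - (2 * z (fst p)) *\<^sub>R snd p, snd p)"
  show "negligible (?F ` ?S)"
  proof (rule negligible_differentiable_image_lowdim)
    show "?F differentiable_on ?S"
      unfolding differentiable_on_def differentiable_def
    proof
      fix p assume p: "p \<in> ?S"
      show "\<exists>D. (?F has_derivative D) (at p within ?S)"
        by (rule exI, (rule has_derivative_compose_real[OF w''] has_derivative_compose_real[OF z']
            has_derivative_compose_real[OF z''] derivative_intros | use p in simp)+)
    qed
  qed simp
  show "?N \<subseteq> ?F ` ?S"
  proof clarify
    fix A B t assume t: "z' t \<noteq> 0" "sheared_velocity A B w' z z' t = 0"
    then have "z' t *\<^sub>R A = - w' t - (2 * z t * z' t) *\<^sub>R B"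
      by (simp add: sheared_velocity_def eq_neg_iff_add_eq_0 algebra_simps)
    then have "inverse (z' t) *\<^sub>R (z' t *\<^sub>R A) = inverse (z' t) *\<^sub>R (- w' t - (2 * z t * z' t) *\<^sub>R B)"
      by simp
    then have "A = - (inverse (z' t) *\<^sub>R w' t) - (2 * z t) *\<^sub>R B"
      using t by (simp add: scaleR_diff_right)
    with t show "(A, B) \<in> ?F ` ?S" by (intro image_eqI[of _ _ "(t, B)"]) auto
  qed
qed

lemma shear_coefficient:
  assumes "sheared A B w1 z1 s = sheared A B w2 z2 t" "z1 s \<noteq> z2 t"
  shows "A = - (inverse (z1 s - z2 t) *\<^sub>R (w1 s - w2 t)) - (z1 s + z2 t) *\<^sub>R B"
proof -
  have "(z1 s - z2 t) *\<^sub>R A = - (w1 s - w2 t) - ((z1 s - z2 t) * (z1 s + z2 t)) *\<^sub>R B"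
    using assms(1) by (simp add: sheared_def algebra_simps power2_eq_square)
  then have "inverse (z1 s - z2 t) *\<^sub>R ((z1 s - z2 t) *\<^sub>R A) =
      inverse (z1 s - z2 t) *\<^sub>R (- (w1 s - w2 t) - ((z1 s - z2 t) * (z1 s + z2 t)) *\<^sub>R B)"
    by simp
  then show ?thesis
    using assms(2) by (simp add: scaleR_diff_right)
qed

text \<open>
  An overlap of points at different heights determines \<open>A\<close> from \<open>s\<close>, \<open>t\<close> and \<open>B\<close>.  If the two
  velocities are linearly dependent, moving \<open>s\<close> and \<open>t\<close> according to the dependency keeps the
  overlap, and hence \<open>A\<close>, to first order.  So tangencies are critical points of this map.
\<close>

lemma negligible_tangent_shears:
  fixes w1 w1' w2 w2' :: "real \<Rightarrow> complex" and z1 z1' z2 z2' :: "real \<Rightarrow> real"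
  assumes w1: "\<And>t. (w1 has_vector_derivative w1' t) (at t)"
    and z1: "\<And>t. (z1 has_vector_derivative z1' t) (at t)"
    and w2: "\<And>t. (w2 has_vector_derivative w2' t) (at t)"
    and z2: "\<And>t. (z2 has_vector_derivative z2' t) (at t)"
  shows "negligible {(A, B). \<exists>s t. z1 s \<noteq> z2 t \<and> sheared A B w1 z1 s = sheared A B w2 z2 t \<and>
           det2 (sheared_velocity A B w1' z1 z1' s) (sheared_velocity A B w2' z2 z2' t) = 0}"
    (is "negligible ?N")
proof (rule negligible_subset)
  define F where "F = (\<lambda>(s, t, B). (- (inverse (z1 s - z2 t) *\<^sub>R (w1 s - w2 t)) - (z1 s + z2 t) *\<^sub>R B, B))"
  define S where "S = {(s, t, B). z1 s \<noteq> z2 t \<and>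
      det2 (sheared_velocity (fst (F (s, t, B))) B w1' z1 z1' s)
           (sheared_velocity (fst (F (s, t, B))) B w2' z2 z2' t) = 0}"
  define F' where "F' = (\<lambda>(s, t, B) (ds, dt, dB).
     (- (inverse (z1 s - z2 t) *\<^sub>R (ds *\<^sub>R w1' s - dt *\<^sub>R w2' t) -
        ((ds * z1' s - dt * z2' t) * (inverse (z1 s - z2 t))\<^sup>2) *\<^sub>R (w1 s - w2 t)) -
      ((z1 s + z2 t) *\<^sub>R dB + (ds * z1' s + dt * z2' t) *\<^sub>R B), dB :: complex))"
  show "negligible (F ` S)"
  proof (rule negligible_critical_values)
    fix p assume p: "p \<in> S"
    obtain s t B where stB: "p = (s, t, B)" by (cases p) auto
    with p have z: "z1 s \<noteq> z2 t" by (simp add: S_def)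
    show "(F has_derivative F' p) (at p)"
      unfolding F_def F'_def case_prod_beta
      using z stB
      by (auto intro!: derivative_eq_intros has_derivative_compose_real[OF w1]
         has_derivative_compose_real[OF z1] has_derivative_compose_real[OF w2]
         has_derivative_compose_real[OF z2] simp: fun_eq_iff algebra_simps power2_eq_square)
    define A where "A = fst (F p)"
    define u v where "u = sheared_velocity A B w1' z1 z1' s" and "v = sheared_velocity A B w2' z2 z2' t"
    have "det2 u v = 0"
      using p by (simp add: S_def stB A_def u_def v_def)
    then obtain a b where ab: "a \<noteq> 0 \<or> b \<noteq> 0" "a *\<^sub>R u = b *\<^sub>R v"
      using det2_eq_0_imp_dependent by blast
    have W: "w1 s - w2 t = - (z1 s - z2 t) *\<^sub>R (A + (z1 s + z2 t) *\<^sub>R B)"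
    proof -
      have "(z2 t - z1 s) * inverse (z1 s - z2 t) = -1"
        using z by (simp add: field_simps)
      then show ?thesis by (simp add: A_def F_def stB)
    qed
    have "fst (F' p (a, b, 0)) =
       - (inverse (z1 s - z2 t) *\<^sub>R (a *\<^sub>R u - b *\<^sub>R v))"
    proof -
      define d where "d = z1 s - z2 t"
      have d: "d \<noteq> 0" "z1 s = z2 t + d" using z by (auto simp: d_def)
      have "fst (F' p (a, b, 0)) = - (inverse d *\<^sub>R (a *\<^sub>R w1' s - b *\<^sub>R w2' t) -
          ((a * z1' s - b * z2' t) * (inverse d)\<^sup>2) *\<^sub>R (- d *\<^sub>R (A + (z1 s + z2 t) *\<^sub>R B))) -
          (a * z1' s + b * z2' t) *\<^sub>R B"
        unfolding W[folded d_def, symmetric] by (simp add: F'_def stB d_def)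
      note eq = this
      have "d *\<^sub>R fst (F' p (a, b, 0)) = - (a *\<^sub>R u - b *\<^sub>R v)"
        unfolding eq using d by (simp add: u_def v_def sheared_velocity_def
           power2_eq_square complex_eq_iff field_simps)
      then have "inverse d *\<^sub>R (d *\<^sub>R fst (F' p (a, b, 0))) = inverse d *\<^sub>R (- (a *\<^sub>R u - b *\<^sub>R v))"
        by simp
      then show ?thesis
        using d(1) by (simp add: d_def scaleR_minus_right[symmetric] del: scaleR_minus_right)
    qed
    moreover have "snd (F' p (a, b, 0)) = 0" by (simp add: F'_def stB)
    ultimately have "F' p (a, b, 0) = 0"
      using ab by (simp add: prod_eq_iff)
    with ab(1) show "\<exists>v. v \<noteq> 0 \<and> F' p v = 0"
      by (intro exI[of _ "(a, b, 0)"]) (auto simp: zero_prod_def)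
  qed (simp_all)
  show "?N \<subseteq> F ` S"
  proof clarify
    fix A B s t assume h: "z1 s \<noteq> z2 t" "sheared A B w1 z1 s = sheared A B w2 z2 t"
      "det2 (sheared_velocity A B w1' z1 z1' s) (sheared_velocity A B w2' z2 z2' t) = 0"
    from shear_coefficient[OF h(2) h(1)] have "F (s, t, B) = (A, B)"
      by (simp add: F_def)
    with h show "(A, B) \<in> F ` S"
      by (intro image_eqI[of _ _ "(s, t, B)"]) (simp_all add: S_def)
  qed
qed

text \<open>
  Overlaps of one point with two others, all at different heights, determine both \<open>A\<close> and \<open>B\<close> by
  interpolation, so these pairs are the image of a set of dimension 3 in a space of dimension 4.
\<close>

lemma negligible_triple_shears:
  fixes w1 w1' w2 w2' w3 w3' :: "real \<Rightarrow> complex" and z1 z1' z2 z2' z3 z3' :: "real \<Rightarrow> real"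
  assumes w1: "\<And>t. (w1 has_vector_derivative w1' t) (at t)"
    and z1: "\<And>t. (z1 has_vector_derivative z1' t) (at t)"
    and w2: "\<And>t. (w2 has_vector_derivative w2' t) (at t)"
    and z2: "\<And>t. (z2 has_vector_derivative z2' t) (at t)"
    and w3: "\<And>t. (w3 has_vector_derivative w3' t) (at t)"
    and z3: "\<And>t. (z3 has_vector_derivative z3' t) (at t)"
  shows "negligible {(A, B). \<exists>s t u. z1 s \<noteq> z2 t \<and> z1 s \<noteq> z3 u \<and> z2 t \<noteq> z3 u \<and>
           sheared A B w1 z1 s = sheared A B w2 z2 t \<and> sheared A B w1 z1 s = sheared A B w3 z3 u}"
    (is "negligible ?N")
proof (rule negligible_subset)
  define S where "S = {p :: real \<times> real \<times> real. z1 (fst p) \<noteq> z2 (fst (snd p)) \<and>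
      z1 (fst p) \<noteq> z3 (snd (snd p)) \<and> z2 (fst (snd p)) \<noteq> z3 (snd (snd p))}"
  define m where "m p = inverse (z1 (fst p) - z2 (fst (snd p))) *\<^sub>R (w1 (fst p) - w2 (fst (snd p)))"
    for p :: "real \<times> real \<times> real"
  define m' where "m' p = inverse (z1 (fst p) - z3 (snd (snd p))) *\<^sub>R (w1 (fst p) - w3 (snd (snd p)))"
    for p :: "real \<times> real \<times> real"
  define G where "G p = - (inverse (z2 (fst (snd p)) - z3 (snd (snd p))) *\<^sub>R (m p - m' p))"
    for p :: "real \<times> real \<times> real"
  define F where "F p = (- m p - (z1 (fst p) + z2 (fst (snd p))) *\<^sub>R G p, G p)" for p
  note d = has_derivative_compose_real[OF w1]
     has_derivative_compose_real[OF z1] has_derivative_compose_real[OF w2]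
     has_derivative_compose_real[OF z2] has_derivative_compose_real[OF w3]
     has_derivative_compose_real[OF z3]
  show "negligible (F ` S)"
  proof (rule negligible_differentiable_image_lowdim)
    show "F differentiable_on S"
      unfolding differentiable_on_def differentiable_def F_def G_def m_def m'_def
    proof
      fix p assume p: "p \<in> S"
      show "\<exists>D. ((\<lambda>p. (- (inverse (z1 (fst p) - z2 (fst (snd p))) *\<^sub>R (w1 (fst p) - w2 (fst (snd p)))) -
          (z1 (fst p) + z2 (fst (snd p))) *\<^sub>R
          - (inverse (z2 (fst (snd p)) - z3 (snd (snd p))) *\<^sub>R
             (inverse (z1 (fst p) - z2 (fst (snd p))) *\<^sub>R (w1 (fst p) - w2 (fst (snd p))) -
              inverse (z1 (fst p) - z3 (snd (snd p))) *\<^sub>R (w1 (fst p) - w3 (snd (snd p))))),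
          - (inverse (z2 (fst (snd p)) - z3 (snd (snd p))) *\<^sub>R
             (inverse (z1 (fst p) - z2 (fst (snd p))) *\<^sub>R (w1 (fst p) - w2 (fst (snd p))) -
              inverse (z1 (fst p) - z3 (snd (snd p))) *\<^sub>R (w1 (fst p) - w3 (snd (snd p)))))))
          has_derivative D) (at p within S)"
        by (rule exI, (rule d derivative_intros | use p in \<open>simp add: S_def\<close>)+)
    qed
  qed simp
  show "?N \<subseteq> F ` S"
  proof clarify
    fix A B s t u assume h: "z1 s \<noteq> z2 t" "z1 s \<noteq> z3 u" "z2 t \<noteq> z3 u"
      "sheared A B w1 z1 s = sheared A B w2 z2 t" "sheared A B w1 z1 s = sheared A B w3 z3 u"
    let ?p = "(s, t, u)"
    have 1: "A = - m ?p - (z1 s + z2 t) *\<^sub>R B"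
      using shear_coefficient[OF h(4) h(1)] by (simp add: m_def)
    moreover have "A = - m' ?p - (z1 s + z3 u) *\<^sub>R B"
      using shear_coefficient[OF h(5) h(2)] by (simp add: m'_def)
    ultimately have "- m ?p - (z1 s + z2 t) *\<^sub>R B = - m' ?p - (z1 s + z3 u) *\<^sub>R B" by simp
    then have "(z2 t - z3 u) *\<^sub>R B = - (m ?p - m' ?p)"
      by (simp add: algebra_simps)
    then have "inverse (z2 t - z3 u) *\<^sub>R ((z2 t - z3 u) *\<^sub>R B) = inverse (z2 t - z3 u) *\<^sub>R (- (m ?p - m' ?p))"
      by simp
    then have "B = G ?p" using h(3)
      by (simp add: G_def scaleR_minus_right[symmetric] del: scaleR_minus_right)
    with 1 have "F ?p = (A, B)" by (simp add: F_def)
    with h show "(A, B) \<in> F ` S"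
      by (intro image_eqI[of _ _ ?p]) (auto simp: S_def)
  qed
qed


definition quadratic_shear :: "complex \<Rightarrow> complex \<Rightarrow> complex \<times> real \<Rightarrow> complex \<times> real" where
  "quadratic_shear A B p = (fst p + snd p *\<^sub>R A + (snd p)\<^sup>2 *\<^sub>R B, snd p)"

lemma deformation_quadratic_shear: "deformation (quadratic_shear A B)"
proof -
  have "deformation (\<lambda>p. p + (snd p *\<^sub>R A + (snd p)\<^sup>2 *\<^sub>R B, 0))"
  proof (rule deformation_shear[where D = "\<lambda>p v. (snd v *\<^sub>R A + (2 * snd p * snd v) *\<^sub>R B, 0)"])
    show "((\<lambda>p. (snd p *\<^sub>R A + (snd p)\<^sup>2 *\<^sub>R B, 0)) has_derivative
        (\<lambda>v. (snd v *\<^sub>R A + (2 * snd p * snd v) *\<^sub>R B, 0))) (at p)" for p :: "complex \<times> real"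
      by (auto intro!: derivative_eq_intros)
    show "smooth_curve (\<lambda>t. (snd (\<gamma> t) *\<^sub>R A + (snd (\<gamma> t))\<^sup>2 *\<^sub>R B, 0 :: real))"
      if "smooth_curve \<gamma>" for \<gamma> :: "real \<Rightarrow> complex \<times> real"
      by (intro smooth_curve_intros that)
  qed (auto intro!: continuous_intros)
  moreover have "(\<lambda>p. p + (snd p *\<^sub>R A + (snd p)\<^sup>2 *\<^sub>R B, 0)) = quadratic_shear A B"
    by (auto simp: quadratic_shear_def fun_eq_iff)
  ultimately show ?thesis by simp
qed

text \<open>
  The projection is an immersion, its double points are transverse, and it has no triple points.
  All parameters on the line are admitted here, which spares a special treatment of the base points
  of the components; \<open>s - t \<in> \<int>\<close> says that they are the same parameter of the circle.
\<close>

definition generic_projection :: "link \<Rightarrow> bool" where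
  "generic_projection K \<longleftrightarrow>
     (let n = length K; c = (\<lambda>i t. fst ((K ! i) t)) in
        (\<forall>i<n. \<forall>t. vector_derivative (c i) (at t) \<noteq> 0) \<and>
        (\<forall>i<n. \<forall>j<n. \<forall>s t. c i s = c j t \<longrightarrow> i = j \<and> s - t \<in> \<int> \<or>
           det2 (vector_derivative (c i) (at s)) (vector_derivative (c j) (at t)) \<noteq> 0) \<and>
        (\<forall>i<n. \<forall>j<n. \<forall>k<n. \<forall>s t u. c i s = c j t \<and> c i s = c k u \<longrightarrow>
           i = j \<and> s - t \<in> \<int> \<or> i = k \<and> s - u \<in> \<int> \<or> j = k \<and> t - u \<in> \<int>))"

lemma periodic_int:
  fixes f :: "real \<Rightarrow> 'a"
  assumes "\<And>t. f (t + 1) = f t"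
  shows "f (t + of_int k) = f t"
proof (induction k rule: int_induct[where k = 0])
  case (step1 i)
  then show ?case using assms[of "t + of_int i"] by (simp add: algebra_simps)
next
  case (step2 i)
  then show ?case using assms[of "t + of_int (i - 1)"] by (simp add: algebra_simps)
qed simp

lemma periodic_frac:
  fixes f :: "real \<Rightarrow> 'a"
  assumes "\<And>t. f (t + 1) = f t"
  shows "f (frac t) = f t"
  using periodic_int[of f "frac t" "\<lfloor>t\<rfloor>", OF assms] by (simp add: frac_def)

lemma frac_eq_imp_diff_Ints:
  assumes "frac (s :: real) = frac t"
  shows "s - t \<in> \<int>"
proof -
  have "s - t = of_int (\<lfloor>s\<rfloor> - \<lfloor>t\<rfloor>)"
    using assms unfolding frac_def of_int_diff by linarith
  then show ?thesis by (metis Ints_of_int)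
qed

lemma oriented_linkD:
  assumes "oriented_link K" "i < length K"
  shows "smooth_curve (K ! i)" "(K ! i) (t + 1) = (K ! i) t" "vector_derivative (K ! i) (at t) \<noteq> 0"
  using assms nth_mem[of i K] unfolding oriented_link_def regular_closed_curve_def by blast+

lemma oriented_link_injective:
  assumes K: "oriented_link K" "i < length K" "j < length K" and eq: "(K ! i) s = (K ! j) t"
  shows "i = j \<and> s - t \<in> \<int>"
proof -
  have "point K (i, frac s) = point K (j, frac t)"
    using eq periodic_frac[of "K ! i" s] periodic_frac[of "K ! j" t] oriented_linkD(2)[OF K(1)] K
    by (simp add: point_def)
  moreover have "(i, frac s) \<in> params K" "(j, frac t) \<in> params K"
    using K by (auto simp: params_def frac_ge_0 frac_lt_1)
  ultimately have "(i, frac s) = (j, frac t)"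
    using K(1) unfolding oriented_link_def by (meson inj_onD)
  then show ?thesis
    by (simp add: frac_eq_imp_diff_Ints)
qed

text \<open>
  The shear moves distinct points of equal height by the same amount, so they stay apart, and a
  stationary point of the projection must have nonzero vertical velocity.  Hence all failures of genericity are
  covered by the three kinds of negligible sets.
\<close>

lemma exists_small_generic_shear:
  assumes K: "oriented_link K" and e: "e > 0"
  shows "\<exists>A B. norm A < e \<and> norm B < e \<and> generic_projection (image_link (quadratic_shear A B) K)"
proof -
  define n where "n = length K"
  define w z where "w i t = fst ((K ! i) t)" and "z i t = snd ((K ! i) t)" for i t
  have smooth: "smooth_curve (w i)" "smooth_curve (z i)" if "i < n" for i
    unfolding w_def[abs_def] z_def[abs_def] using oriented_linkD(1)[OF K] that
    by (auto simp: n_def intro: smooth_curve_intros)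
  define w' w'' where "w' i t = vector_derivative (w i) (at t)"
    and "w'' i t = vector_derivative (w' i) (at t)" for i t
  define z' z'' where "z' i t = vector_derivative (z i) (at t)"
    and "z'' i t = vector_derivative (z' i) (at t)" for i t
  have w: "(w i has_vector_derivative w' i t) (at t)" "(w' i has_vector_derivative w'' i t) (at t)"
    if "i < n" for i t
    using smooth_curve_vector_derivative[OF smooth(1)[OF that]] smooth_curve_vector_derivative(1)
    unfolding w'_def[abs_def] w''_def by blast+
  have z: "(z i has_vector_derivative z' i t) (at t)" "(z' i has_vector_derivative z'' i t) (at t)"
    if "i < n" for i t
    using smooth_curve_vector_derivative[OF smooth(2)[OF that]] smooth_curve_vector_derivative(1)
    unfolding z'_def[abs_def] z''_def by blast+
  let ?N1 = "\<lambda>i. {(A, B). \<exists>t. z' i t \<noteq> 0 \<and> sheared_velocity A B (w' i) (z i) (z' i) t = 0}"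
  let ?N2 = "\<lambda>i j. {(A, B). \<exists>s t. z i s \<noteq> z j t \<and> sheared A B (w i) (z i) s = sheared A B (w j) (z j) t \<and>
     det2 (sheared_velocity A B (w' i) (z i) (z' i) s) (sheared_velocity A B (w' j) (z j) (z' j) t) = 0}"
  let ?N3 = "\<lambda>i j k. {(A, B). \<exists>s t u. z i s \<noteq> z j t \<and> z i s \<noteq> z k u \<and> z j t \<noteq> z k u \<and>
     sheared A B (w i) (z i) s = sheared A B (w j) (z j) t \<and> sheared A B (w i) (z i) s = sheared A B (w k) (z k) u}"
  define N where "N = (\<Union>i<n. ?N1 i) \<union> (\<Union>i<n. \<Union>j<n. ?N2 i j) \<union> (\<Union>i<n. \<Union>j<n. \<Union>k<n. ?N3 i j k)"
  have "negligible N"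
  proof -
    have UN: "negligible (\<Union>i<n. M i)" if "\<And>i. i < n \<Longrightarrow> negligible (M i)"
      for M :: "nat \<Rightarrow> (complex \<times> complex) set"
      using that by (intro negligible_Union) auto
    have "negligible (?N1 i)" if "i < n" for i
      by (rule negligible_stationary_shears[OF w(2)[OF that] z(1)[OF that] z(2)[OF that]])
    moreover have "negligible (?N2 i j)" if "i < n" "j < n" for i j
      by (rule negligible_tangent_shears[OF w(1)[OF that(1)] z(1)[OF that(1)] w(1)[OF that(2)] z(1)[OF that(2)]])
    moreover have "negligible (?N3 i j k)" if "i < n" "j < n" "k < n" for i j k
      by (rule negligible_triple_shears[OF w(1)[OF that(1)] z(1)[OF that(1)] w(1)[OF that(2)]
            z(1)[OF that(2)] w(1)[OF that(3)] z(1)[OF that(3)]])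
    ultimately show ?thesis
      unfolding N_def by (intro negligible_Un UN)
  qed
  moreover have "\<not> negligible (ball (0 :: complex) e \<times> ball (0 :: complex) e)"
    using e by (intro open_not_negligible open_Times) auto
  ultimately have "\<not> ball (0 :: complex) e \<times> ball (0 :: complex) e \<subseteq> N"
    using negligible_subset by blast
  then obtain q :: "complex \<times> complex" where "q \<in> ball 0 e \<times> ball 0 e" "q \<notin> N"
    by blast
  then obtain A B :: complex where AB: "norm A < e" "norm B < e" "(A, B) \<notin> N"
    by (cases q) auto
  have not_N: "(A, B) \<notin> ?N1 i" "(A, B) \<notin> ?N2 i j" "(A, B) \<notin> ?N3 i j k" if "i < n" "j < n" "k < n" for i j k
  proof -
    have "q \<notin> M1 i \<and> q \<notin> M2 i j \<and> q \<notin> M3 i j k"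
      if "q \<notin> (\<Union>i<n. M1 i) \<union> (\<Union>i<n. \<Union>j<n. M2 i j) \<union> (\<Union>i<n. \<Union>j<n. \<Union>k<n. M3 i j k)"
      for q :: "complex \<times> complex" and M1 M2 M3
    proof (intro conjI notI)
      assume "q \<in> M1 i"
      with \<open>i < n\<close> have "q \<in> (\<Union>i<n. M1 i)" by (intro UN_I) simp_all
      with that show False by simp
    next
      assume "q \<in> M2 i j"
      with \<open>i < n\<close> \<open>j < n\<close> have "q \<in> (\<Union>i<n. \<Union>j<n. M2 i j)" by (intro UN_I) simp_all
      with that show False by simp
    next
      assume "q \<in> M3 i j k"
      with \<open>i < n\<close> \<open>j < n\<close> \<open>k < n\<close> have "q \<in> (\<Union>i<n. \<Union>j<n. \<Union>k<n. M3 i j k)" by (intro UN_I) simp_all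
      with that show False by simp
    qed
    from this[OF AB(3)[unfolded N_def]] have all: "(A, B) \<notin> ?N1 i \<and> (A, B) \<notin> ?N2 i j \<and> (A, B) \<notin> ?N3 i j k" .
    from all show "(A, B) \<notin> ?N1 i" by (rule conjunct1)
    from all show "(A, B) \<notin> ?N2 i j" by (rule conjunct1[OF conjunct2])
    from all show "(A, B) \<notin> ?N3 i j k" by (rule conjunct2[OF conjunct2])
  qed
  let ?K = "image_link (quadratic_shear A B) K"
  have c: "(\<lambda>t. fst ((?K ! i) t)) = sheared A B (w i) (z i)" if "i < n" for i
    using that by (simp add: fun_eq_iff nth_image_link n_def quadratic_shear_def sheared_def w_def z_def)
  have v: "vector_derivative (sheared A B (w i) (z i)) (at t) = sheared_velocity A B (w' i) (z i) (z' i) t"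
    if "i < n" for i t
    using has_vector_derivative_sheared[of "w i" "w' i" t "z i" "z' i"] w(1)[OF that] z(1)[OF that]
    by (simp add: has_real_derivative_iff_has_vector_derivative vector_derivative_at)
  have same_height: "i = j \<and> s - t \<in> \<int>"
    if "i < n" "j < n" "sheared A B (w i) (z i) s = sheared A B (w j) (z j) t" "z i s = z j t" for i j s t
  proof -
    have "w i s = w j t" using that(3,4) by (simp add: sheared_def)
    with that show ?thesis
      by (intro oriented_link_injective[OF K]) (auto simp: w_def z_def n_def prod_eq_iff)
  qed
  have "generic_projection ?K"
    unfolding generic_projection_def Let_def length_image_link n_def[symmetric]
  proof (intro conjI allI impI)
    fix i t assume i: "i < n"
    have "vector_derivative (K ! i) (at t) = (w' i t, z' i t)"
    proof -
      have "K ! i = (\<lambda>t. (w i t, z i t))" by (simp add: w_def z_def)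
      then show ?thesis
        using has_vector_derivative_Pair[OF w(1)[OF i] z(1)[OF i]] by (simp add: vector_derivative_at)
    qed
    then have nz: "(w' i t, z' i t) \<noteq> 0" using oriented_linkD(3)[OF K] i by (metis n_def)
    have "sheared_velocity A B (w' i) (z i) (z' i) t \<noteq> 0"
    proof (cases "z' i t = 0")
      case True
      then show ?thesis using nz by (auto simp: sheared_velocity_def zero_prod_def)
    next
      case False
      then show ?thesis using not_N(1)[OF i i i] by blast
    qed
    then show "vector_derivative (\<lambda>t. fst ((?K ! i) t)) (at t) \<noteq> 0"
      by (simp add: c v i)
  next
    fix i j s t assume h: "i < n" "j < n" "fst ((?K ! i) s) = fst ((?K ! j) t)"
    have eq: "sheared A B (w i) (z i) s = sheared A B (w j) (z j) t"
      using h(3) fun_cong[OF c[OF h(1)], of s] fun_cong[OF c[OF h(2)], of t] by simp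
    show "i = j \<and> s - t \<in> \<int> \<or> det2 (vector_derivative (\<lambda>t. fst ((?K ! i) t)) (at s))
        (vector_derivative (\<lambda>t. fst ((?K ! j) t)) (at t)) \<noteq> 0"
    proof (cases "z i s = z j t")
      case True
      then show ?thesis using same_height[OF h(1,2) eq] by blast
    next
      case False
      then have "det2 (sheared_velocity A B (w' i) (z i) (z' i) s) (sheared_velocity A B (w' j) (z j) (z' j) t) \<noteq> 0"
        using not_N(2)[OF h(1,2,2)] eq by blast
      then show ?thesis by (simp add: c v h(1,2))
    qed
  next
    fix i j k s t u
    assume h: "i < n" "j < n" "k < n" "fst ((?K ! i) s) = fst ((?K ! j) t) \<and> fst ((?K ! i) s) = fst ((?K ! k) u)"
    have eq: "sheared A B (w i) (z i) s = sheared A B (w j) (z j) t"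
       "sheared A B (w i) (z i) s = sheared A B (w k) (z k) u"
      using h fun_cong[OF c] by metis+
    have "z i s = z j t \<or> z i s = z k u \<or> z j t = z k u"
      using not_N(3)[OF h(1-3)] eq by blast
    then show "i = j \<and> s - t \<in> \<int> \<or> i = k \<and> s - u \<in> \<int> \<or> j = k \<and> t - u \<in> \<int>"
      using same_height[OF h(1,2) eq(1)] same_height[OF h(1,3) eq(2)]
        same_height[OF h(2,3) trans[OF sym[OF eq(1)] eq(2)]] by blast
  qed
  with AB show ?thesis by blast
qed

section \<open>The diagram below a link\<close>

text \<open>
  Near \<open>a\<close> the component in the direction of \<open>c' a\<close> is strictly increasing.
\<close>

lemma immersion_locally_injective:
  fixes c :: "real \<Rightarrow> complex"
  assumes c: "\<And>t. (c has_vector_derivative c' t) (at t)" and cont: "continuous_on UNIV c'"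
    and nz: "c' a \<noteq> 0"
  shows "\<exists>d>0. \<forall>s t. \<bar>s - a\<bar> < d \<and> \<bar>t - a\<bar> < d \<and> c s = c t \<longrightarrow> s = t"
proof -
  define g where "g t = c t \<bullet> c' a" for t
  have g: "(g has_real_derivative c' t \<bullet> c' a) (at t)" for t
    unfolding g_def[abs_def] has_real_derivative_iff_has_vector_derivative
    by (rule bounded_linear.has_vector_derivative[OF bounded_linear_inner_left c])
  have "continuous_on UNIV (\<lambda>t. c' t \<bullet> c' a)"
    by (intro continuous_intros cont)
  moreover have "c' a \<bullet> c' a > 0" using nz by simp
  moreover have "((\<lambda>t. c' t \<bullet> c' a) \<longlongrightarrow> c' a \<bullet> c' a) (nhds a)"
    using calculation(1) tendsto_at_iff_tendsto_nhds[of "\<lambda>t. c' t \<bullet> c' a" a]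
    by (simp add: continuous_on_eq_continuous_at isCont_def)
  ultimately have "eventually (\<lambda>t. c' t \<bullet> c' a > 0) (nhds a)"
    by (intro order_tendstoD(1)[of _ "c' a \<bullet> c' a"])
  then obtain d where d: "d > 0" "\<And>t. \<bar>t - a\<bar> < d \<Longrightarrow> c' t \<bullet> c' a > 0"
    by (auto simp: eventually_nhds_metric dist_real_def)
  have less: "g s < g t" if "s < t" "\<bar>s - a\<bar> < d" "\<bar>t - a\<bar> < d" for s t
  proof (rule DERIV_pos_imp_increasing[OF that(1)])
    fix x assume "s \<le> x" "x \<le> t"
    with that have "\<bar>x - a\<bar> < d" by linarith
    with d g show "\<exists>y. (g has_real_derivative y) (at x) \<and> 0 < y" by blast
  qed
  have "s = t" if "\<bar>s - a\<bar> < d" "\<bar>t - a\<bar> < d" "c s = c t" for s t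
    using less[of s t] less[of t s] that by (cases s t rule: linorder_cases) (auto simp: g_def)
  with d(1) show ?thesis by blast
qed

lemma isolated_fibre_point:
  fixes f :: "'a::euclidean_space \<Rightarrow> 'b::euclidean_space"
  assumes f: "(f has_derivative f') (at p)" and inj: "inj f'"
  shows "\<exists>d>0. \<forall>q. norm (q - p) < d \<and> f q = f p \<longrightarrow> q = p"
proof -
  have lin: "linear f'" using f by (rule has_derivative_linear)
  obtain B where B: "B > 0" "\<And>x. B * norm x \<le> norm (f' x)"
    using linear_inj_bounded_below_pos[OF lin inj] by blast
  obtain d where d: "d > 0" "\<And>q. norm (q - p) < d \<Longrightarrow> norm (f q - f p - f' (q - p)) \<le> B / 2 * norm (q - p)"
    using f B(1) unfolding has_derivative_at_alt by (meson half_gt_zero)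
  have "q = p" if "norm (q - p) < d" "f q = f p" for q
  proof -
    have "B * norm (q - p) \<le> B / 2 * norm (q - p)"
      using d(2)[OF that(1)] B(2)[of "q - p"] that(2) by simp
    then have "norm (q - p) \<le> 0" using B(1) by (simp add: mult_le_cancel_right)
    then show ?thesis by simp
  qed
  with d(1) show ?thesis by blast
qed

text \<open>
  Otherwise the double points accumulate.  They cannot do so at a transverse double point, as
  \<open>c s - d t\<close> has an invertible derivative there, nor at coinciding parameters of one
  component, as an immersion is locally injective.  The flag \<open>e\<close> tells whether both curves are the same component.
\<close>

lemma finite_transverse_double_points:
  fixes c d :: "real \<Rightarrow> complex"
  assumes c: "\<And>t. (c has_vector_derivative c' t) (at t)"
    and d: "\<And>t. (d has_vector_derivative d' t) (at t)"
    and transverse: "\<And>s t. c s = d t \<Longrightarrow> e \<and> s - t \<in> \<int> \<or> det2 (c' s) (d' t) \<noteq> 0"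
    and self: "e \<Longrightarrow> c = d \<and> (\<forall>t. c (t + 1) = c t) \<and> (\<forall>t. c' t \<noteq> 0) \<and> continuous_on UNIV c'"
  shows "finite {(s, t). s \<in> {0..<1} \<and> t \<in> {0..<1} \<and> c s = d t \<and> \<not> (e \<and> s - t \<in> \<int>)}" (is "finite ?Q")
proof (rule ccontr)
  assume "infinite ?Q"
  moreover have "?Q \<subseteq> {0..1} \<times> {0..1}" by auto
  moreover have BW: "\<forall>T. infinite T \<and> T \<subseteq> {0..1::real} \<times> {0..1::real} \<longrightarrow>
      (\<exists>p\<in>{0..1} \<times> {0..1}. p islimpt T)"
    using compact_Times[OF compact_Icc compact_Icc] unfolding compact_eq_Bolzano_Weierstrass .
  ultimately have "\<exists>p\<in>{0..1} \<times> {0..1}. p islimpt ?Q"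
    by (intro BW[rule_format] conjI)
  then obtain p where p: "p islimpt ?Q" by blast
  obtain s0 t0 where st: "p = (s0, t0)" by (cases p)
  have cont: "continuous_on UNIV c" "continuous_on UNIV d"
    using c d by (meson continuous_at_imp_continuous_on has_vector_derivative_continuous)+
  have "closed {q. c (fst q) = d (snd q)}"
    by (intro closed_Collect_eq continuous_on_compose2[OF cont(1)] continuous_on_compose2[OF cont(2)]
        continuous_intros) auto
  then have "p \<in> {q. c (fst q) = d (snd q)}"
    by (rule closed_limpt[THEN iffD1, rule_format]) (rule islimpt_subset[OF p], auto)
  then have eq: "c s0 = d t0" by (simp add: st)
  have near: "\<exists>s t. (s, t) \<in> ?Q \<and> (s, t) \<noteq> p \<and> norm ((s, t) - p) < r" if "r > 0" for r
    using p that unfolding islimpt_approachable dist_norm by fast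
  from transverse[OF eq] show False
  proof
    assume "det2 (c' s0) (d' t0) \<noteq> 0"
    define f where "f q = c (fst q) - d (snd q)" for q
    define f' where "f' h = fst h *\<^sub>R c' s0 - snd h *\<^sub>R d' t0" for h
    have "(f has_derivative f') (at p)"
      unfolding f_def[abs_def] f'_def[abs_def]
      using has_derivative_compose_real[OF c, of fst fst p UNIV] has_derivative_compose_real[OF d, of snd snd p UNIV]
      by (intro has_derivative_diff) (simp_all add: st has_derivative_fst has_derivative_snd)
    moreover have "inj f'"
    proof -
      have "linear f'" using calculation by (rule has_derivative_linear)
      moreover have "h = 0" if "f' h = 0" for h
      proof -
        have *: "fst h * Re (c' s0) = snd h * Re (d' t0)" "fst h * Im (c' s0) = snd h * Im (d' t0)"
          using that by (auto simp: f'_def complex_eq_iff)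
        have "fst h * det2 (c' s0) (d' t0) = (fst h * Re (c' s0)) * Im (d' t0) - (fst h * Im (c' s0)) * Re (d' t0)"
          by (simp add: det2_def algebra_simps)
        also have "\<dots> = 0" unfolding * by (simp add: algebra_simps)
        finally have "fst h = 0" using \<open>det2 _ _ \<noteq> 0\<close> by simp
        have "snd h * det2 (c' s0) (d' t0) = Re (c' s0) * (snd h * Im (d' t0)) - Im (c' s0) * (snd h * Re (d' t0))"
          by (simp add: det2_def algebra_simps)
        also have "\<dots> = 0" unfolding *[symmetric] by (simp add: algebra_simps)
        finally have "snd h = 0" using \<open>det2 _ _ \<noteq> 0\<close> by simp
        with \<open>fst h = 0\<close> show "h = 0" by (simp add: prod_eq_iff)
      qed
      ultimately show ?thesis by (auto simp: linear_injective_0)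
    qed
    ultimately obtain r where r: "r > 0" "\<And>q. norm (q - p) < r \<Longrightarrow> f q = f p \<Longrightarrow> q = p"
      using isolated_fibre_point by blast
    obtain s t where st': "(s, t) \<in> ?Q" "(s, t) \<noteq> p" "norm ((s, t) - p) < r"
      using near[OF r(1)] by blast
    then have "f (s, t) = f p" using eq by (simp add: f_def st)
    with r(2)[OF st'(3)] st'(2) show False by blast
  next
    assume e: "e \<and> s0 - t0 \<in> \<int>"
    then have cd: "c = d" "\<And>t. c (t + 1) = c t" "\<And>t. c' t \<noteq> 0" "continuous_on UNIV c'"
      using self by blast+
    obtain r where r: "r > 0" "\<And>s t. \<bar>s - s0\<bar> < r \<Longrightarrow> \<bar>t - s0\<bar> < r \<Longrightarrow> c s = c t \<Longrightarrow> s = t"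
      using immersion_locally_injective[OF c cd(4) cd(3)] by metis
    obtain s t where st': "(s, t) \<in> ?Q" "norm ((s, t) - p) < r"
      using near[OF r(1)] by blast
    then have "\<bar>s - s0\<bar> < r" "\<bar>t - t0\<bar> < r"
      using norm_fst_le[of "s - s0" "t - t0"] norm_snd_le[of "t - t0" "s - s0"] by (auto simp: st)
    moreover obtain k where k: "s0 - t0 = of_int k" using e by (auto elim: Ints_cases)
    moreover have "c s = c (t + of_int k)"
      using st'(1) cd(1) periodic_int[of c t k, OF cd(2)] by simp
    ultimately have "s = t + of_int k" using k by (intro r(2)) auto
    then have "s - t \<in> \<int>" by simp
    with st'(1) e show False by simp
  qed
qed

definition diagram_below :: "link \<Rightarrow> diagram" where
  "diagram_below K = Diagram (map (\<lambda>\<gamma> t. fst (\<gamma> t)) K)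
     (\<lambda>x. \<exists>y\<in>params K. y \<noteq> x \<and> fst (point K y) = fst (point K x) \<and> snd (point K y) < snd (point K x))"

lemma params_diagram_below [simp]: "params (curves (diagram_below K)) = params K"
  by (simp add: diagram_below_def params_def)

lemma params_eq:
  assumes "x \<in> params \<Gamma>" "y \<in> params \<Gamma>" "fst x = fst y" "snd x - snd y \<in> \<int>"
  shows "x = y"
proof -
  have "\<bar>snd x - snd y\<bar> < 1" using assms by (auto simp: params_def)
  then have "snd x - snd y = 0" using assms(4) Ints_nonzero_abs_less1 by blast
  with assms(3) show ?thesis by (simp add: prod_eq_iff)
qed

lemma diagram_below_generic:
  assumes K: "oriented_link K" and gen: "generic_projection K"
  shows "link_diagram (diagram_below K)" "projects_to K (diagram_below K)"
proof -
  let ?D = "diagram_below K"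
  define c where "c i t = fst ((K ! i) t)" for i t
  have "smooth_curve (c i)" if "i < length K" for i
    unfolding c_def[abs_def] by (intro smooth_curve_fst oriented_linkD[OF K that])
  note smooth = this
  have periodic: "c i (t + 1) = c i t" if "i < length K" for i t
    by (simp add: c_def oriented_linkD[OF K that])
  have immersed: "vector_derivative (c i) (at t) \<noteq> 0" if "i < length K" for i t
    using gen that unfolding generic_projection_def c_def[abs_def] by meson
  have transverse: "i = j \<and> s - t \<in> \<int> \<or> det2 (vector_derivative (c i) (at s)) (vector_derivative (c j) (at t)) \<noteq> 0"
    if "i < length K" "j < length K" "c i s = c j t" for i j s t
    using gen that unfolding generic_projection_def c_def[abs_def] by meson
  have triple: "i = j \<and> s - t \<in> \<int> \<or> i = k \<and> s - u \<in> \<int> \<or> j = k \<and> t - u \<in> \<int>"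
    if "i < length K" "j < length K" "k < length K" "c i s = c j t" "c i s = c k u" for i j k s t u
    using gen that unfolding generic_projection_def c_def[abs_def] by meson
  have nth: "curves ?D ! i = c i" if "i < length K" for i
    using that by (simp add: diagram_below_def c_def[abs_def])
  have point: "point (curves ?D) x = c (fst x) (snd x)" if "x \<in> params K" for x
    using that by (auto simp: point_def nth params_def)
  have pointK: "fst (point K x) = c (fst x) (snd x)" for x
    by (simp add: point_def c_def)
  have unique: "z = x \<or> z = y"
    if "x \<in> params K" "y \<in> params K" "z \<in> params K" "x \<noteq> y" "c (fst x) (snd x) = c (fst y) (snd y)"
      "c (fst x) (snd x) = c (fst z) (snd z)" for x y z
  proof -
    have "fst x < length K" "fst y < length K" "fst z < length K"
      using that(1-3) by (auto simp: params_def)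
    from triple[OF this that(5,6)] show ?thesis
      using params_eq[OF that(1,2)] params_eq[OF that(1,3)] params_eq[OF that(2,3)] that(4) by blast
  qed
  have height: "snd (point K x) \<noteq> snd (point K y)"
    if "x \<in> params K" "y \<in> params K" "x \<noteq> y" "c (fst x) (snd x) = c (fst y) (snd y)" for x y
  proof
    assume "snd (point K x) = snd (point K y)"
    then have "point K x = point K y" using that(4) by (simp add: prod_eq_iff pointK)
    with K that show False unfolding oriented_link_def by (meson inj_onD)
  qed
  have over: "over ?D x \<longleftrightarrow> snd (point K y) < snd (point K x)"
    if "x \<in> params K" "y \<in> params K" "x \<noteq> y" "c (fst x) (snd x) = c (fst y) (snd y)" for x y
  proof
    assume "over ?D x"
    then obtain z where z: "z \<in> params K" "z \<noteq> x" "c (fst z) (snd z) = c (fst x) (snd x)"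
      "snd (point K z) < snd (point K x)"
      by (auto simp: diagram_below_def pointK)
    then have "z = y" using unique[OF that(1,2) z(1) that(3,4)] by simp
    with z show "snd (point K y) < snd (point K x)" by simp
  next
    assume "snd (point K y) < snd (point K x)"
    with that show "over ?D x"
      unfolding diagram_below_def diagram.sel pointK by (intro bexI[of _ y]) auto
  qed
  have "finite (crossings ?D)"
  proof -
    define Q where "Q i j = {(s, t). s \<in> {0..<1} \<and> t \<in> {0..<1} \<and> c i s = c j t \<and> \<not> (i = j \<and> s - t \<in> \<int>)}"
      for i j
    have "finite (Q i j)" if "i < length K" "j < length K" for i j
      unfolding Q_def
    proof (rule finite_transverse_double_points)
      show "(c i has_vector_derivative vector_derivative (c i) (at t)) (at t)"
        "(c j has_vector_derivative vector_derivative (c j) (at t)) (at t)" for t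
        using smooth smooth_curve_vector_derivative(1) that by blast+
      show "i = j \<Longrightarrow> c i = c j \<and> (\<forall>t. c i (t + 1) = c i t) \<and> (\<forall>t. vector_derivative (c i) (at t) \<noteq> 0) \<and>
          continuous_on UNIV (\<lambda>t. vector_derivative (c i) (at t))"
        using that periodic immersed
          smooth_curve_continuous_on[OF smooth_curve_vector_derivative(2)[OF smooth[OF that(1)]]] by auto
    qed (use that transverse in auto)
    then have "finite (\<Union>i<length K. \<Union>j<length K. (\<lambda>(s, t). ((i, s), (j, t))) ` Q i j)"
      by auto
    moreover have "crossings ?D \<subseteq> (\<Union>i<length K. \<Union>j<length K. (\<lambda>(s, t). ((i, s), (j, t))) ` Q i j)"
    proof
      fix q assume q: "q \<in> crossings ?D"
      obtain i s j t where q_eq: "q = ((i, s), (j, t))" by (metis surj_pair)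
      with q have m: "(i, s) \<in> params K" "(j, t) \<in> params K" "(i, s) \<noteq> (j, t)" "c i s = c j t"
        using point[of "(i, s)"] point[of "(j, t)"] by (auto simp: crossings_def)
      then have "(s, t) \<in> Q i j"
        using params_eq[OF m(1,2)] by (auto simp: Q_def params_def)
      with m show "q \<in> (\<Union>i<length K. \<Union>j<length K. (\<lambda>(s, t). ((i, s), (j, t))) ` Q i j)"
        unfolding q_eq by (intro UN_I[of i] UN_I[of j] image_eqI[of _ _ "(s, t)"]) (auto simp: params_def)
    qed
    ultimately show ?thesis by (rule finite_subset[rotated])
  qed
  moreover have "regular_closed_curve \<gamma>" if \<gamma>: "\<gamma> \<in> set (curves ?D)" for \<gamma>
  proof -
    have "length (curves ?D) = length K" by (simp add: diagram_below_def)
    moreover obtain i where "i < length (curves ?D)" "curves ?D ! i = \<gamma>"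
      using \<gamma> unfolding in_set_conv_nth by blast
    ultimately have i: "i < length K" "\<gamma> = c i" using nth[of i] by auto
    show ?thesis
      unfolding regular_closed_curve_def i(2)
      using smooth[OF i(1)] periodic[OF i(1)] immersed[OF i(1)] by blast
  qed
  moreover have "curves ?D \<noteq> []"
    using K by (simp add: diagram_below_def oriented_link_def)
  moreover have "det2 (velocity (curves ?D) x) (velocity (curves ?D) y) \<noteq> 0 \<and> (over ?D x \<longleftrightarrow> \<not> over ?D y) \<and>
      (\<forall>z\<in>params (curves ?D). point (curves ?D) z = point (curves ?D) x \<longrightarrow> z = x \<or> z = y)"
    if "x \<in> params (curves ?D)" "y \<in> params (curves ?D)" "x \<noteq> y \<and> point (curves ?D) x = point (curves ?D) y" for x y
  proof -
    have m: "x \<in> params K" "y \<in> params K" "x \<noteq> y" "c (fst x) (snd x) = c (fst y) (snd y)"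
      using that point by auto
    then have "fst x < length K" "fst y < length K" by (auto simp: params_def)
    then have "det2 (velocity (curves ?D) x) (velocity (curves ?D) y) \<noteq> 0"
      using transverse[of "fst x" "fst y" "snd x" "snd y"] m params_eq[OF m(1,2)] by (auto simp: velocity_def nth)
    moreover have "over ?D x \<longleftrightarrow> \<not> over ?D y"
      using over[OF m] over[OF m(2,1)] height[OF m] m by auto
    moreover have "z = x \<or> z = y" if "z \<in> params K" "point (curves ?D) z = point (curves ?D) x" for z
      using unique[OF m(1,2) that(1) m(3,4)] that m point by simp
    ultimately show ?thesis by auto
  qed
  ultimately show "link_diagram ?D"
    unfolding link_diagram_def by blast
  show "projects_to K ?D"
    unfolding projects_to_def
  proof (intro conjI ballI)
    show "curves ?D = map (\<lambda>\<gamma> t. fst (\<gamma> t)) K" by (simp add: diagram_below_def)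
    fix q assume q: "q \<in> crossings ?D"
    obtain x y where q_eq: "q = (x, y)" by (cases q)
    with q have m': "x \<in> params K" "y \<in> params K" "x \<noteq> y"
      "point (curves ?D) x = point (curves ?D) y" "over ?D x"
      by (auto simp: crossings_def)
    then have m: "x \<in> params K" "y \<in> params K" "x \<noteq> y" "c (fst x) (snd x) = c (fst y) (snd y)" "over ?D x"
      using point[OF m'(1)] point[OF m'(2)] by auto
    then show "case q of (x, y) \<Rightarrow> snd (point K x) > snd (point K y)"
      using over[OF m(1-4)] q_eq by simp
  qed
qed

section \<open>Writhe and winding number under Reidemeister moves\<close>

lemma link_diagramD:
  assumes "link_diagram D" "i < length (curves D)"
  shows "smooth_curve (curves D ! i)" "(curves D ! i) (t + 1) = (curves D ! i) t"
    "vector_derivative (curves D ! i) (at t) \<noteq> 0"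
  using assms nth_mem[of i "curves D"] unfolding link_diagram_def regular_closed_curve_def by blast+

lemma vector_derivative_periodic:
  assumes "\<And>t :: real. f (t + 1) = f t"
  shows "vector_derivative f (at (t + 1)) = vector_derivative f (at t)"
proof -
  have shift: "(f has_vector_derivative v) (at t)"
    if "(f has_vector_derivative v) (at (t + c))" "\<And>t. f (t + c) = f t" for c t :: real and v
  proof -
    have "((\<lambda>t. t + c) has_vector_derivative 1) (at t)"
      by (auto intro!: derivative_eq_intros)
    from vector_diff_chain_at[OF this that(1)] show ?thesis
      using that(2) by (simp add: o_def)
  qed
  have "f (t - 1) = f t" for t using assms[of "t - 1"] by simp
  then have "(f has_vector_derivative v) (at (t + 1)) \<longleftrightarrow> (f has_vector_derivative v) (at t)" for v
    using shift[of v t 1] shift[of v "t + 1" "- 1"] assms by auto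
  then show ?thesis by (simp add: vector_derivative_def)
qed

lemma vector_derivative_eq_on_interval:
  fixes f g :: "real \<Rightarrow> 'a::real_normed_vector"
  assumes f: "(f has_vector_derivative f') (at t)" and g: "(g has_vector_derivative g') (at t)"
    and ab: "a < b" "t \<in> {a..b}" and eq: "\<And>s. s \<in> {a..b} \<Longrightarrow> f s = g s"
  shows "f' = g'"
proof -
  have "(f has_vector_derivative f') (at t within {a..b})" "(g has_vector_derivative g') (at t within {a..b})"
    using f g by (auto intro: has_vector_derivative_at_within)
  moreover have "(f has_vector_derivative g') (at t within {a..b})"
    by (rule has_vector_derivative_transform[OF ab(2) eq calculation(2)])
  ultimately show ?thesis
    using ab vector_derivative_unique_within_closed_interval[of a b t f f' g'] by auto
qed

lemma tangle_in_arcs_disjoint: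
  assumes "tangle_in c r arcs D" "\<alpha> \<in> set arcs" "\<beta> \<in> set arcs" "x \<in> closed_arc \<alpha>" "x \<in> closed_arc \<beta>"
  shows "\<alpha> = \<beta>"
proof -
  obtain k l where k: "k < length arcs" "\<alpha> = arcs ! k" and l: "l < length arcs" "\<beta> = arcs ! l"
    using assms(2,3) by (metis in_set_conv_nth)
  have "closed_arc (arcs ! k) \<inter> closed_arc (arcs ! l) = {}" if "l < k" "k < length arcs" for k l
    using assms(1) that unfolding tangle_in_def by blast
  then have "\<not> l < k" "\<not> k < l" using k l assms(4,5) by blast+
  then show ?thesis using k l by auto
qed

lemma tangle_in_arc_bounds:
  assumes "tangle_in c r arcs D" "(i, a, b) \<in> set arcs"
  shows "0 < a" "a < b" "b < 1"
  using assms unfolding tangle_in_def by fast+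

lemma tangle_in_cball_iff:
  assumes "tangle_in c r arcs D" "x \<in> params (curves D)"
  shows "point (curves D) x \<in> cball c r \<longleftrightarrow> (\<exists>\<alpha>\<in>set arcs. x \<in> closed_arc \<alpha>)"
    and "point (curves D) x \<in> ball c r \<longleftrightarrow> (\<exists>\<alpha>\<in>set arcs. x \<in> open_arc \<alpha>)"
proof -
  have *: "{x \<in> params (curves D). point (curves D) x \<in> cball c r} = (\<Union>\<alpha>\<in>set arcs. closed_arc \<alpha>)"
    "{x \<in> params (curves D). point (curves D) x \<in> ball c r} = (\<Union>\<alpha>\<in>set arcs. open_arc \<alpha>)"
    using assms(1) unfolding tangle_in_def by blast+
  show "point (curves D) x \<in> cball c r \<longleftrightarrow> (\<exists>\<alpha>\<in>set arcs. x \<in> closed_arc \<alpha>)"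
    using arg_cong[OF *(1), of "\<lambda>S. x \<in> S"] assms(2) by simp
  show "point (curves D) x \<in> ball c r \<longleftrightarrow> (\<exists>\<alpha>\<in>set arcs. x \<in> open_arc \<alpha>)"
    using arg_cong[OF *(2), of "\<lambda>S. x \<in> S"] assms(2) by simp
qed

lemma tangle_in_closed_arc_params:
  assumes "tangle_in c r arcs D" "\<alpha> \<in> set arcs" "x \<in> closed_arc \<alpha>"
  shows "x \<in> params (curves D)"
proof -
  have "{x \<in> params (curves D). point (curves D) x \<in> cball c r} = (\<Union>\<alpha>\<in>set arcs. closed_arc \<alpha>)"
    using assms(1) unfolding tangle_in_def by blast
  then show ?thesis using assms by blast
qed

lemma open_arc_subset_closed_arc: "open_arc \<alpha> \<subseteq> closed_arc \<alpha>"
  by (auto simp: open_arc_def closed_arc_def)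

lemma local_change_params: "local_change c r arcs D D' \<Longrightarrow> params (curves D') = params (curves D)"
  by (auto simp: local_change_def params_def)

lemma local_change_outside:
  assumes "local_change c r arcs D D'" "x \<in> params (curves D)" "\<And>\<alpha>. \<alpha> \<in> set arcs \<Longrightarrow> x \<notin> open_arc \<alpha>"
  shows "point (curves D') x = point (curves D) x" "over D' x = over D x"
  using assms unfolding local_change_def by blast+

lemma local_change_sym:
  assumes "local_change c r arcs D D'"
  shows "local_change c r arcs D' D"
proof -
  have "params (curves D') = params (curves D)" by (rule local_change_params[OF assms])
  then show ?thesis using assms unfolding local_change_def by simp
qed

text \<open>
  The curves agree on an interval that contains the parameter, possibly as its end: at the
  start of an arc they agree before it, at its end behind it.  One side is enough to
  determine the derivative.
\<close>

lemma local_change_velocity: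
  assumes lc: "local_change c r arcs D D'" and x: "x \<in> params (curves D)"
    and out: "\<And>\<alpha>. \<alpha> \<in> set arcs \<Longrightarrow> x \<notin> open_arc \<alpha>"
  shows "velocity (curves D') x = velocity (curves D) x"
proof -
  obtain i t where it: "x = (i, t)" by (cases x)
  have i: "i < length (curves D)" "i < length (curves D')" "0 \<le> t" "t < 1"
    using x lc by (auto simp: it params_def local_change_def)
  have D: "link_diagram D" "link_diagram D'" and tangle: "tangle_in c r arcs D"
    using lc by (auto simp: local_change_def)
  let ?f = "curves D ! i" and ?g = "curves D' ! i"
  have out': "\<not> (a < t \<and> t < b)" if "(i, a, b) \<in> set arcs" for a b
    using out[OF that] by (auto simp: it open_arc_def)
  have eq: "?f s = ?g s" if "0 \<le> s" "s < 1" "\<forall>(j, a, b)\<in>set arcs. \<not> (j = i \<and> a < s \<and> s < b)" for s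
    using local_change_outside(1)[OF lc, of "(i, s)"] that i(1)
    by (fastforce simp: params_def point_def open_arc_def)
  have "\<exists>a b. a < b \<and> t \<in> {a..b} \<and> (\<forall>s\<in>{a..b}. ?f s = ?g s)"
  proof (cases "\<exists>b. (i, t, b) \<in> set arcs")
    case False
    have "eventually (\<lambda>s. \<forall>(j, a, b)\<in>set arcs. \<not> (j = i \<and> a < s \<and> s < b)) (at_right t)"
    proof (intro eventually_ball_finite ballI)
      fix \<alpha> assume \<alpha>: "\<alpha> \<in> set arcs"
      obtain j a b where jab: "\<alpha> = (j, a, b)" by (cases \<alpha>)
      consider "j \<noteq> i" | "j = i" "t < a" | "j = i" "b \<le> t"
        using out'[of a b] \<alpha> False jab by (metis linorder_neqE_linordered_idom not_le_imp_less)
      then show "eventually (\<lambda>s. case \<alpha> of (j, a, b) \<Rightarrow> \<not> (j = i \<and> a < s \<and> s < b)) (at_right t)"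
      proof cases
        case 2
        then show ?thesis using eventually_at_right_real[of t a] by (auto simp: jab elim!: eventually_mono)
      next
        case 3
        then show ?thesis using eventually_at_right_less[of t] by (auto simp: jab elim!: eventually_mono)
      qed (simp add: jab)
    qed simp
    moreover have "eventually (\<lambda>s. s \<in> {t<..<1}) (at_right t)"
      using i by (intro eventually_at_right_real)
    ultimately have "eventually (\<lambda>s. ?f s = ?g s) (at_right t)"
      by eventually_elim (use i in \<open>auto intro!: eq\<close>)
    then obtain b where b: "b > t" "\<And>s. t < s \<Longrightarrow> s < b \<Longrightarrow> ?f s = ?g s"
      by (auto simp: eventually_at_right_field)
    moreover have "?f t = ?g t"
      using out' i by (intro eq) auto
    ultimately show ?thesis
      by (intro exI[of _ t] exI[of _ "(t + b) / 2"]) (auto simp: le_less)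
  next
    case True
    then obtain b0 where b0: "(i, t, b0) \<in> set arcs" by blast
    have "eventually (\<lambda>s. \<forall>(j, a, b)\<in>set arcs. \<not> (j = i \<and> a < s \<and> s < b)) (at_left t)"
    proof (intro eventually_ball_finite ballI)
      fix \<alpha> assume \<alpha>: "\<alpha> \<in> set arcs"
      obtain j a b where jab: "\<alpha> = (j, a, b)" by (cases \<alpha>)
      have "t \<noteq> b" if "j = i"
      proof
        assume "t = b"
        then have "(i, t, b0) = \<alpha>"
          using tangle_in_arc_bounds(2)[OF tangle b0] tangle_in_arc_bounds(2)[OF tangle, of j a b] \<alpha> that jab
          by (intro tangle_in_arcs_disjoint[OF tangle b0 \<alpha>, of "(i, t)"]) (simp_all add: closed_arc_def)
        then have "(j, a, b) \<in> set arcs" "a = t" using b0 jab by auto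
        with tangle_in_arc_bounds(2)[OF tangle] \<open>t = b\<close> show False by blast
      qed
      then consider "j \<noteq> i" | "j = i" "b < t" | "j = i" "t \<le> a"
        using out'[of a b] \<alpha> jab by (metis linorder_neqE_linordered_idom not_le_imp_less)
      then show "eventually (\<lambda>s. case \<alpha> of (j, a, b) \<Rightarrow> \<not> (j = i \<and> a < s \<and> s < b)) (at_left t)"
      proof cases
        case 2
        then show ?thesis using eventually_at_left_real[of b t] by (auto simp: jab elim!: eventually_mono)
      next
        case 3
        then show ?thesis using eventually_at_left_real[of "t - 1" t] by (auto simp: jab elim!: eventually_mono)
      qed (simp add: jab)
    qed simp
    moreover have "eventually (\<lambda>s. s \<in> {0<..<t}) (at_left t)"
      using tangle_in_arc_bounds(1)[OF tangle b0] by (intro eventually_at_left_real)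
    ultimately have "eventually (\<lambda>s. ?f s = ?g s) (at_left t)"
      by eventually_elim (use i in \<open>auto intro!: eq\<close>)
    then obtain a where a: "a < t" "\<And>s. a < s \<Longrightarrow> s < t \<Longrightarrow> ?f s = ?g s"
      by (auto simp: eventually_at_left_field)
    moreover have "?f t = ?g t"
      using out' i by (intro eq) auto
    ultimately show ?thesis
      by (intro exI[of _ "(a + t) / 2"] exI[of _ t]) (auto simp: le_less)
  qed
  then obtain a b where ab: "a < b" "t \<in> {a..b}" "\<And>s. s \<in> {a..b} \<Longrightarrow> ?f s = ?g s" by blast
  have "vector_derivative ?f (at t) = vector_derivative ?g (at t)"
    by (rule vector_derivative_eq_on_interval[OF
          smooth_curve_vector_derivative(1)[OF link_diagramD(1)[OF D(1) i(1)]]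
          smooth_curve_vector_derivative(1)[OF link_diagramD(1)[OF D(2) i(2)]] ab])
  then show ?thesis by (simp add: velocity_def it)
qed

definition sign_value :: "crossing_sign \<Rightarrow> real" where
  "sign_value \<epsilon> = (if \<epsilon> = Pos then 1 else - 1)"

definition writhe :: "diagram \<Rightarrow> real" where
  "writhe D = (\<Sum>q\<in>crossings D. sign_value (sign_at D q))"

definition writhe_in :: "complex \<Rightarrow> real \<Rightarrow> diagram \<Rightarrow> real" where
  "writhe_in c r D = (\<Sum>q\<in>crossings_in c r D. sign_value (sign_at D q))"

lemma local_change_crossing_outside:
  assumes lc: "local_change c r arcs D D'" and q: "q \<in> crossings D - crossings_in c r D"
  shows "q \<in> crossings D' - crossings_in c r D'" "sign_at D' q = sign_at D q"
proof -
  obtain x y where xy: "q = (x, y)" by (cases q)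
  have h: "x \<in> params (curves D)" "y \<in> params (curves D)" "x \<noteq> y"
    "point (curves D) x = point (curves D) y" "over D x" "\<not> over D y" "point (curves D) x \<notin> cball c r"
    using q by (auto simp: xy crossings_def crossings_in_def)
  have tangle: "tangle_in c r arcs D" using lc by (simp add: local_change_def)
  have nx: "x \<notin> open_arc \<alpha>" if "\<alpha> \<in> set arcs" for \<alpha>
    using tangle_in_cball_iff(1)[OF tangle h(1)] h(7) that open_arc_subset_closed_arc by blast
  have ny: "y \<notin> open_arc \<alpha>" if "\<alpha> \<in> set arcs" for \<alpha>
    using tangle_in_cball_iff(1)[OF tangle h(2)] h(4,7) that open_arc_subset_closed_arc by fastforce
  note out = local_change_outside[OF lc h(1) nx] local_change_outside[OF lc h(2) ny]
  show "q \<in> crossings D' - crossings_in c r D'"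
    using h out local_change_params[OF lc] by (auto simp: xy crossings_def crossings_in_def)
  show "sign_at D' q = sign_at D q"
    using local_change_velocity[OF lc h(1) nx] local_change_velocity[OF lc h(2) ny]
    by (simp add: sign_at_def xy)
qed

lemma writhe_local_change:
  assumes lc: "local_change c r arcs D D'"
  shows "writhe D' - writhe_in c r D' = writhe D - writhe_in c r D"
proof -
  have "writhe D - writhe_in c r D = (\<Sum>q\<in>crossings D - crossings_in c r D. sign_value (sign_at D q))"
    if "link_diagram D" for D
    unfolding writhe_def writhe_in_def using that
    by (subst sum_diff) (auto simp: link_diagram_def crossings_in_def)
  moreover have "crossings D' - crossings_in c r D' = crossings D - crossings_in c r D"
    using local_change_crossing_outside(1)[OF lc] local_change_crossing_outside(1)[OF local_change_sym[OF lc]] by blast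
  moreover have "link_diagram D" "link_diagram D'" using lc by (auto simp: local_change_def)
  ultimately show ?thesis
    using local_change_crossing_outside(2)[OF lc] by simp
qed


lemma total_winding_eq_sum:
  "total_winding D =
     (\<Sum>i<length (curves D). Re (winding_number (\<lambda>t. vector_derivative (curves D ! i) (at t)) 0))"
  by (simp add: total_winding_def sum_list_sum_nth atLeast0LessThan)

text \<open>
  The arcs are replaced one at a time.  In between, the tangent loop is that of the new diagram on
  the arcs already replaced and that of the old one elsewhere.
\<close>

lemma total_winding_local_change:
  assumes lc: "local_change c r arcs D D'"
    and inj: "\<And>\<alpha>. \<alpha> \<in> set arcs \<Longrightarrow> inj_on (point (curves D)) (closed_arc \<alpha>)"
      "\<And>\<alpha>. \<alpha> \<in> set arcs \<Longrightarrow> inj_on (point (curves D')) (closed_arc \<alpha>)"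
  shows "total_winding D' = total_winding D"
proof -
  have D: "link_diagram D" "link_diagram D'" and tangle: "tangle_in c r arcs D" "tangle_in c r arcs D'"
    and len: "length (curves D') = length (curves D)"
    using lc by (auto simp: local_change_def)
  have "winding_number (\<lambda>t. vector_derivative (curves D ! i) (at t)) 0 =
        winding_number (\<lambda>t. vector_derivative (curves D' ! i) (at t)) 0" if i: "i < length (curves D)" for i
  proof -
    define \<gamma> \<delta> where "\<gamma> = curves D ! i" and "\<delta> = curves D' ! i"
    define f g where "f t = vector_derivative \<gamma> (at t)" and "g t = vector_derivative \<delta> (at t)" for t
    have i': "i < length (curves D')" using i len by simp
    note d = link_diagramD[OF D(1) i, folded \<gamma>_def] link_diagramD[OF D(2) i', folded \<delta>_def]
    have cont: "continuous_on S f" "continuous_on S g" for S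
      unfolding f_def[abs_def] g_def[abs_def]
      by (intro smooth_curve_continuous_on smooth_curve_vector_derivative(2) d)+
    have nz: "f t \<noteq> 0" "g t \<noteq> 0" for t
      unfolding f_def g_def by (rule d)+
    have per: "f 1 = f 0" "g 1 = g 0"
      using vector_derivative_periodic[of \<gamma> 0, OF d(2)] vector_derivative_periodic[of \<delta> 0, OF d(5)]
      by (simp_all add: f_def g_def)
    have fg: "f t = g t" if "0 \<le> t" "t \<le> 1" "\<And>a b. (i, a, b) \<in> set arcs \<Longrightarrow> t \<notin> {a<..<b}" for t
    proof -
      have fg': "f t = g t" if "0 \<le> t" "t < 1" "\<And>a b. (i, a, b) \<in> set arcs \<Longrightarrow> t \<notin> {a<..<b}" for t
        using local_change_velocity[OF lc, of "(i, t)"] that i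
        by (fastforce simp: velocity_def params_def open_arc_def f_def g_def \<gamma>_def \<delta>_def)
      have "0 \<notin> {a<..<b}" if "(i, a, b) \<in> set arcs" for a b
        using tangle_in_arc_bounds(1)[OF tangle(1) that] by simp
      then have "f 0 = g 0" by (intro fg') auto
      with per have "f 1 = g 1" by simp
      with fg' that show ?thesis by (cases "t = 1") auto
    qed
    \<comment> \<open>The tangent loop after the replacement of the arcs in \<open>as\<close>.\<close>
    define hybrid where "hybrid as t = (if \<exists>a b. (i, a, b) \<in> set as \<and> t \<in> {a..b} then g t else f t)"
      for as t
    have "set as \<subseteq> set arcs \<Longrightarrow> continuous_on UNIV (hybrid as) \<and> winding_number f 0 = winding_number (hybrid as) 0"
      for as
    proof (induction as)
      case Nil
      then show ?case using cont by (simp add: hybrid_def[abs_def])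
    next
      case (Cons \<alpha> as)
      then have IH: "continuous_on UNIV (hybrid as)" "winding_number f 0 = winding_number (hybrid as) 0"
        and \<alpha>: "\<alpha> \<in> set arcs" and as: "set as \<subseteq> set arcs" by auto
      obtain j a b where jab: "\<alpha> = (j, a, b)" by (cases \<alpha>)
      show ?case
      proof (cases "j = i \<and> \<alpha> \<notin> set as")
        case False
        then have "hybrid (\<alpha> # as) = hybrid as"
          unfolding hybrid_def using jab by (intro ext if_cong) auto
        with IH show ?thesis by simp
      next
        case True
        then have ab: "(i, a, b) \<in> set arcs" "0 < a" "a < b" "b < 1"
          using \<alpha> jab tangle_in_arc_bounds[OF tangle(1), of j a b] by auto
        have hybrid_Cons: "hybrid (\<alpha> # as) t = (if t \<in> {a..b} then g t else hybrid as t)" for t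
          using True jab by (auto simp: hybrid_def)
        have disjoint: "t \<notin> {a'..b'}" if "(i, a', b') \<in> set as" "t \<in> {a..b}" for a' b' t
          using tangle_in_arcs_disjoint[OF tangle(1) ab(1), of "(i, a', b')" "(i, t)"] that as True jab
          by (auto simp: closed_arc_def)
        then have hybrid_f: "hybrid as t = f t" if "t \<in> {a..b}" for t
          using that by (fastforce simp: hybrid_def)
        have ends_open: "x \<notin> open_arc \<beta>" if "x = (i, a) \<or> x = (i, b)" "\<beta> \<in> set arcs" for x \<beta>
        proof
          assume "x \<in> open_arc \<beta>"
          moreover have "x \<in> closed_arc (i, a, b)" using that(1) ab by (auto simp: closed_arc_def)
          ultimately have "\<beta> = (i, a, b)"
            using tangle_in_arcs_disjoint[OF tangle(1) that(2) ab(1)] open_arc_subset_closed_arc by blast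
          with \<open>x \<in> open_arc \<beta>\<close> that(1) show False by (auto simp: open_arc_def)
        qed
        have ends_params: "(i, a) \<in> params (curves D)" "(i, b) \<in> params (curves D)"
          using i ab by (auto simp: params_def)
        have fg_ends: "f a = g a" "f b = g b"
          using local_change_velocity[OF lc ends_params(1) ends_open] local_change_velocity[OF lc ends_params(2) ends_open]
          by (simp_all add: velocity_def f_def g_def \<gamma>_def \<delta>_def)
        have ends: "\<gamma> a = \<delta> a" "\<gamma> b = \<delta> b"
          using local_change_outside(1)[OF lc ends_params(1) ends_open] local_change_outside(1)[OF lc ends_params(2) ends_open]
          by (simp_all add: point_def \<gamma>_def \<delta>_def)
        have disc: "\<gamma> t \<in> cball c r" "\<delta> t \<in> cball c r" if "t \<in> {a..b}" for t
        proof -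
          have "(i, t) \<in> params (curves D)" "(i, t) \<in> closed_arc (i, a, b)"
            using that ab i by (auto simp: params_def closed_arc_def)
          then show "\<gamma> t \<in> cball c r" "\<delta> t \<in> cball c r"
            using tangle_in_cball_iff(1)[OF tangle(1), of "(i, t)"] tangle_in_cball_iff(1)[OF tangle(2), of "(i, t)"]
              ab(1) local_change_params[OF lc] by (auto simp: point_def \<gamma>_def \<delta>_def)
        qed
        have sphere: "\<gamma> a \<in> sphere c r" "\<gamma> b \<in> sphere c r"
        proof -
          have "\<gamma> t \<in> sphere c r" if "t = a \<or> t = b" for t
          proof -
            have "(i, t) \<in> params (curves D)" using that ends_params by auto
            moreover have "(i, t) \<notin> open_arc \<beta>" if "\<beta> \<in> set arcs" for \<beta>
              using ends_open[of "(i, t)" \<beta>] that \<open>t = a \<or> t = b\<close> by auto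
            ultimately have "\<gamma> t \<notin> ball c r"
              using tangle_in_cball_iff(2)[OF tangle(1), of "(i, t)"] by (auto simp: point_def \<gamma>_def)
            moreover have "\<gamma> t \<in> cball c r" using disc(1)[of t] that ab by auto
            ultimately show ?thesis by auto
          qed
          then show "\<gamma> a \<in> sphere c r" "\<gamma> b \<in> sphere c r" by auto
        qed
        have inj': "inj_on \<gamma> {a..b}" "inj_on \<delta> {a..b}"
          using inj(1)[OF ab(1)] inj(2)[OF ab(1)]
          by (auto simp: inj_on_def point_def closed_arc_def \<gamma>_def \<delta>_def)
        have cont_Cons: "continuous_on UNIV (hybrid (\<alpha> # as))"
        proof -
          have "continuous_on ({a..b} \<union> ({..a} \<union> {b..})) (\<lambda>t. if t \<in> {a..b} then g t else hybrid as t)"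
          proof (rule continuous_on_cases)
            show "\<forall>t. t \<in> {a..b} \<and> t \<notin> {a..b} \<or> t \<in> {..a} \<union> {b..} \<and> t \<in> {a..b} \<longrightarrow> g t = hybrid as t"
            proof (intro allI impI)
              fix t assume "t \<in> {a..b} \<and> t \<notin> {a..b} \<or> t \<in> {..a} \<union> {b..} \<and> t \<in> {a..b}"
              then have "t = a \<or> t = b" by auto
              then show "g t = hybrid as t" using fg_ends hybrid_f[of t] ab by auto
            qed
          qed (auto intro: cont continuous_on_subset[OF IH(1)])
          moreover have "{a..b} \<union> ({..a} \<union> {b..}) = UNIV" by auto
          ultimately show ?thesis by (simp add: hybrid_Cons[abs_def])
        qed
        have "winding_number (hybrid as) 0 = winding_number (hybrid (\<alpha> # as)) 0"
        proof (rule winding_number_replace_arc[where \<gamma> = \<gamma> and \<delta> = \<delta> and c = c and r = r])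
          show "hybrid as t \<noteq> 0" "hybrid (\<alpha> # as) t \<noteq> 0" for t
            using nz by (auto simp: hybrid_def)
          have at01: "hybrid bs 1 = f 1 \<and> hybrid bs 0 = f 0" if "set bs \<subseteq> set arcs" for bs
          proof -
            have "1 \<notin> {a'..b'} \<and> 0 \<notin> {a'..b'}" if "(i, a', b') \<in> set bs" for a' b'
            proof -
              have "(i, a', b') \<in> set arcs" using that \<open>set bs \<subseteq> set arcs\<close> by blast
              from tangle_in_arc_bounds[OF tangle(1) this] show ?thesis by simp
            qed
            then show ?thesis unfolding hybrid_def by meson
          qed
          show "hybrid as 1 = hybrid as 0" "hybrid (\<alpha> # as) 1 = hybrid (\<alpha> # as) 0"
            using at01[of as] at01[of "\<alpha> # as"] as \<alpha> per by auto
          show "hybrid as t = hybrid (\<alpha> # as) t" if "t \<in> {0..1} - {a<..<b}" for t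
          proof (cases "t \<in> {a..b}")
            case True
            then have "t = a \<or> t = b" using that by auto
            then show ?thesis using fg_ends hybrid_f[OF True] True by (auto simp: hybrid_Cons)
          qed (auto simp: hybrid_Cons)
          show "(\<gamma> has_vector_derivative hybrid as t) (at t within {a..b})" if "t \<in> {a..b}" for t
            unfolding hybrid_f[OF that] f_def
            by (rule has_vector_derivative_at_within[OF smooth_curve_vector_derivative(1)[OF d(1)]])
          show "(\<delta> has_vector_derivative hybrid (\<alpha> # as) t) (at t within {a..b})" if "t \<in> {a..b}" for t
            using that has_vector_derivative_at_within[OF smooth_curve_vector_derivative(1)[OF d(4)]]
            by (simp add: hybrid_Cons g_def)
        qed (use IH cont_Cons ab inj' ends sphere disc in auto)
        with IH cont_Cons show ?thesis by simp
      qed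
    qed
    from this[of arcs] have "winding_number f 0 = winding_number (hybrid arcs) 0" by simp
    also have "\<dots> = winding_number g 0"
    proof (rule winding_number_cong)
      fix t :: real assume t: "0 \<le> t" "t \<le> 1"
      show "hybrid arcs t = g t"
      proof (cases "\<exists>a b. (i, a, b) \<in> set arcs \<and> t \<in> {a..b}")
        case True
        then show ?thesis unfolding hybrid_def by (rule if_P)
      next
        case False
        then have "hybrid arcs t = f t" unfolding hybrid_def by (rule if_not_P)
        also have "f t = g t" using False by (intro fg t) (meson atLeastAtMost_iff greaterThanLessThan_iff less_imp_le)
        finally show ?thesis .
      qed
    qed
    finally show ?thesis by (simp add: f_def[abs_def] g_def[abs_def] \<gamma>_def \<delta>_def)
  qed
  then show ?thesis
    by (simp add: total_winding_eq_sum len)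
qed

lemma inj_on_closed_arc:
  assumes D: "link_diagram D" and tangle: "tangle_in c r arcs D" and \<alpha>: "\<alpha> \<in> set arcs"
    and cross: "\<And>p. p \<in> crossings_in c r D \<Longrightarrow> \<exists>\<beta>\<in>set arcs. \<exists>\<gamma>\<in>set arcs. \<beta> \<noteq> \<gamma> \<and> p \<in> closed_arc \<beta> \<times> closed_arc \<gamma>"
  shows "inj_on (point (curves D)) (closed_arc \<alpha>)"
proof (rule inj_onI, rule ccontr)
  fix x y assume x: "x \<in> closed_arc \<alpha>" and y: "y \<in> closed_arc \<alpha>" and eq: "point (curves D) x = point (curves D) y"
    and neq: "x \<noteq> y"
  have xy: "x \<in> params (curves D)" "y \<in> params (curves D)"
    using tangle_in_closed_arc_params[OF tangle \<alpha>] x y by auto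
  then have "over D x \<longleftrightarrow> \<not> over D y"
    using D eq neq unfolding link_diagram_def by blast
  moreover have "point (curves D) x \<in> cball c r" using tangle_in_cball_iff(1)[OF tangle xy(1)] x \<alpha> by blast
  ultimately have "(x, y) \<in> crossings_in c r D \<or> (y, x) \<in> crossings_in c r D"
    using xy eq neq by (auto simp: crossings_in_def crossings_def)
  then obtain \<beta> \<gamma> where "\<beta> \<in> set arcs" "\<gamma> \<in> set arcs" "\<beta> \<noteq> \<gamma>"
    "x \<in> closed_arc \<beta> \<and> y \<in> closed_arc \<gamma> \<or> y \<in> closed_arc \<beta> \<and> x \<in> closed_arc \<gamma>"
    using cross by (metis mem_Sigma_iff)
  then show False
    using tangle_in_arcs_disjoint[OF tangle] \<alpha> x y by metis
qed

lemma omega1_invariants: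
  assumes "omega1 \<epsilon> w D D'"
  shows "writhe D' = writhe D + sign_value \<epsilon>" "total_winding D' = total_winding D + w"
proof -
  obtain c r \<alpha> q where h: "local_change c r [\<alpha>] D D'" "crossings_in c r D = {}"
      "crossings_in c r D' = {q}" "sign_at D' q = \<epsilon>"
    using assms unfolding omega1_def by blast
  have "writhe_in c r D' = sign_value \<epsilon>" "writhe_in c r D = 0"
    using h by (simp_all add: writhe_in_def)
  then show "writhe D' = writhe D + sign_value \<epsilon>"
    using writhe_local_change[OF h(1)] by simp
  show "total_winding D' = total_winding D + w"
    using assms unfolding omega1_def by blast
qed

lemma omega2_invariants:
  assumes "omega2 \<epsilon> co D D'"
  shows "writhe D' = writhe D" "total_winding D' = total_winding D"
proof -
  obtain c r \<alpha> \<beta> p q where h: "local_change c r [\<alpha>, \<beta>] D D'" "crossings_in c r D = {}"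
      "crossings_in c r D' = {p, q}" "{p, q} \<subseteq> closed_arc \<alpha> \<times> closed_arc \<beta>"
      "snd (fst p) < snd (fst q)" "sign_at D' p = \<epsilon>" "sign_at D' q = opposite \<epsilon>"
    using assms unfolding omega2_def by blast
  have "p \<noteq> q" using h(5) by auto
  then have "writhe_in c r D' = 0" "writhe_in c r D = 0"
    using h by (cases \<epsilon>; simp add: writhe_in_def sign_value_def)+
  then show "writhe D' = writhe D"
    using writhe_local_change[OF h(1)] by simp
  have D: "link_diagram D" "link_diagram D'" "tangle_in c r [\<alpha>, \<beta>] D" "tangle_in c r [\<alpha>, \<beta>] D'"
    using h(1) by (auto simp: local_change_def)
  have "closed_arc \<beta> \<inter> closed_arc \<alpha> = {}"
  proof -
    have "\<forall>k<length [\<alpha>, \<beta>]. \<forall>l<k. closed_arc ([\<alpha>, \<beta>] ! k) \<inter> closed_arc ([\<alpha>, \<beta>] ! l) = {}"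
      using D(3) unfolding tangle_in_def by blast
    from this[rule_format, of 1 0] show ?thesis by simp
  qed
  moreover have "fst p \<in> closed_arc \<alpha>" using h(4) by auto
  ultimately have "\<alpha> \<noteq> \<beta>" by blast
  then show "total_winding D' = total_winding D"
    using h by (intro total_winding_local_change[OF h(1)] inj_on_closed_arc[OF D(1,3)] inj_on_closed_arc[OF D(2,4)]) auto
qed

lemma triangle_in_crossings:
  assumes "triangle_in c r \<alpha> \<beta> \<gamma> \<epsilon>1 \<epsilon>2 \<epsilon>3 b D" and tangle: "tangle_in c r [\<alpha>, \<beta>, \<gamma>] D"
  shows "writhe_in c r D = sign_value \<epsilon>1 + sign_value \<epsilon>2 + sign_value \<epsilon>3"
    and "p \<in> crossings_in c r D \<Longrightarrow>
      \<exists>\<delta>\<in>set [\<alpha>, \<beta>, \<gamma>]. \<exists>\<eta>\<in>set [\<alpha>, \<beta>, \<gamma>]. \<delta> \<noteq> \<eta> \<and> p \<in> closed_arc \<delta> \<times> closed_arc \<eta>"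
proof -
  obtain p1 p2 p3 where p: "crossings_in c r D = {p1, p2, p3}"
        "p1 \<in> closed_arc \<alpha> \<times> closed_arc \<beta>" "sign_at D p1 = \<epsilon>1"
        "p2 \<in> closed_arc \<alpha> \<times> closed_arc \<gamma>" "sign_at D p2 = \<epsilon>2"
        "p3 \<in> closed_arc \<beta> \<times> closed_arc \<gamma>" "sign_at D p3 = \<epsilon>3"
    using assms(1) unfolding triangle_in_def by blast
  have "\<forall>k<length [\<alpha>, \<beta>, \<gamma>]. \<forall>l<k. closed_arc ([\<alpha>, \<beta>, \<gamma>] ! k) \<inter> closed_arc ([\<alpha>, \<beta>, \<gamma>] ! l) = {}"
    using tangle unfolding tangle_in_def by blast
  from this[rule_format, of 1 0] this[rule_format, of 2 0] this[rule_format, of 2 1]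
  have disj: "closed_arc \<beta> \<inter> closed_arc \<alpha> = {}" "closed_arc \<gamma> \<inter> closed_arc \<alpha> = {}" "closed_arc \<gamma> \<inter> closed_arc \<beta> = {}"
    by simp_all
  have neq: "p1 \<noteq> p2" "p1 \<noteq> p3" "p2 \<noteq> p3" "\<alpha> \<noteq> \<beta>" "\<alpha> \<noteq> \<gamma>" "\<beta> \<noteq> \<gamma>"
    using p(2,4,6) disj by (auto simp: mem_Times_iff)
  then show "writhe_in c r D = sign_value \<epsilon>1 + sign_value \<epsilon>2 + sign_value \<epsilon>3"
    using p by (simp add: writhe_in_def)
  show "\<exists>\<delta>\<in>set [\<alpha>, \<beta>, \<gamma>]. \<exists>\<eta>\<in>set [\<alpha>, \<beta>, \<gamma>]. \<delta> \<noteq> \<eta> \<and> p \<in> closed_arc \<delta> \<times> closed_arc \<eta>"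
    if "p \<in> crossings_in c r D"
    using that p neq by auto
qed

lemma omega3_invariants:
  assumes "omega3 \<epsilon>1 \<epsilon>2 \<epsilon>3 D D'"
  shows "writhe D' = writhe D" "total_winding D' = total_winding D"
proof -
  obtain c r \<alpha> \<beta> \<gamma> where h: "local_change c r [\<alpha>, \<beta>, \<gamma>] D D'"
        "triangle_in c r \<alpha> \<beta> \<gamma> \<epsilon>1 \<epsilon>2 \<epsilon>3 True D" "triangle_in c r \<alpha> \<beta> \<gamma> \<epsilon>1 \<epsilon>2 \<epsilon>3 False D'"
    using assms unfolding omega3_def by blast
  have D: "link_diagram D" "link_diagram D'" "tangle_in c r [\<alpha>, \<beta>, \<gamma>] D" "tangle_in c r [\<alpha>, \<beta>, \<gamma>] D'"
    using h(1) by (auto simp: local_change_def)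
  show "writhe D' = writhe D"
    using writhe_local_change[OF h(1)] triangle_in_crossings(1)[OF h(2) D(3)] triangle_in_crossings(1)[OF h(3) D(4)]
    by simp
  show "total_winding D' = total_winding D"
    by (rule total_winding_local_change[OF h(1)])
       (rule inj_on_closed_arc[OF D(1,3) _ triangle_in_crossings(2)[OF h(2) D(3)]]
             inj_on_closed_arc[OF D(2,4) _ triangle_in_crossings(2)[OF h(3) D(4)]]; assumption)+
qed

section \<open>Writhe and winding number under planar isotopy\<close>

lemma det2_linear_image:
  assumes "linear J"
  shows "det2 (J u) (J v) = det2 (J 1) (J \<i>) * det2 u v"
proof -
  have *: "J u = Re u *\<^sub>R J 1 + Im u *\<^sub>R J \<i>" for u
  proof -
    have "u = Re u *\<^sub>R 1 + Im u *\<^sub>R \<i>" by (simp add: complex_eq_iff)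
    then have "J u = J (Re u *\<^sub>R 1 + Im u *\<^sub>R \<i>)" by simp
    then show ?thesis by (simp add: linear_add[OF assms] linear_scale[OF assms])
  qed
  show ?thesis
    unfolding *[of u] *[of v] by (simp add: det2_def algebra_simps)
qed

lemma det2_neq_0_if_bij:
  assumes "linear J" "bij J"
  shows "det2 (J 1) (J \<i>) \<noteq> 0"
proof
  assume "det2 (J 1) (J \<i>) = 0"
  then obtain a b where ab: "a \<noteq> 0 \<or> b \<noteq> 0" "a *\<^sub>R J 1 = b *\<^sub>R J \<i>"
    using det2_eq_0_imp_dependent by blast
  then have "J (a *\<^sub>R 1) = J (b *\<^sub>R \<i>)" by (simp add: linear_scale[OF assms(1)])
  then have "a *\<^sub>R (1 :: complex) = b *\<^sub>R \<i>" using bij_is_inj[OF assms(2)] by (meson injD)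
  with ab(1) show False by (simp add: complex_eq_iff)
qed

lemma linear_blinfun_apply: "linear (blinfun_apply f)"
  by (rule bounded_linear.linear[OF blinfun.bounded_linear_right])

lemma diffeotopyE:
  fixes h :: "real \<Rightarrow> 'a::euclidean_space \<Rightarrow> 'a"
  assumes "diffeotopy h"
  obtains h' where "\<And>s x. s \<in> {0..1} \<Longrightarrow> (h s has_derivative blinfun_apply (h' s x)) (at x)"
    "\<And>s x. s \<in> {0..1} \<Longrightarrow> bij (blinfun_apply (h' s x))"
    "continuous_on ({0..1} \<times> UNIV) (\<lambda>(s, x). h' s x)"
    "\<And>x v. blinfun_apply (h' 0 x) v = v"
proof -
  obtain h' where h': "\<And>s x. s \<in> {0..1} \<Longrightarrow> (h s has_derivative blinfun_apply (h' s x)) (at x)"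
     "\<And>s x. s \<in> {0..1} \<Longrightarrow> bij (blinfun_apply (h' s x))"
     "continuous_on ({0..1} \<times> UNIV) (\<lambda>(s, x). h' s x)"
    using assms unfolding diffeotopy_def by blast
  have "h 0 = id" using assms by (auto simp: diffeotopy_def)
  then have "blinfun_apply (h' 0 x) = id" for x
    using h'(1)[of 0 x] has_derivative_unique[OF _ has_derivative_id] by (metis atLeastAtMost_iff order_refl zero_le_one)
  then have "blinfun_apply (h' 0 x) v = v" for x v by simp
  with h' show ?thesis by (intro that[of h'])
qed

text \<open>
  The determinant is 1 at the start and vanishes nowhere on the way.
\<close>

lemma det2_pos_along_diffeotopy:
  fixes h' :: "real \<Rightarrow> complex \<Rightarrow> complex \<Rightarrow>\<^sub>L complex"
  assumes bij: "\<And>s. s \<in> {0..1} \<Longrightarrow> bij (blinfun_apply (h' s x))"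
    and cont: "continuous_on ({0..1} \<times> UNIV) (\<lambda>(s, x). h' s x)"
    and start: "\<And>v. blinfun_apply (h' 0 x) v = v"
  shows "det2 (blinfun_apply (h' 1 x) 1) (blinfun_apply (h' 1 x) \<i>) > 0"
proof (rule ccontr)
  define f where "f s = det2 (blinfun_apply (h' s x) 1) (blinfun_apply (h' s x) \<i>)" for s
  assume "\<not> ?thesis"
  then have "f 1 \<le> 0" by (simp add: f_def)
  have "continuous_on {0..1} (\<lambda>s. (case (s, x) of (s, x) \<Rightarrow> h' s x))"
    by (rule continuous_on_compose2[OF cont]) (auto intro!: continuous_intros)
  then have "continuous_on {0..1} f"
    unfolding f_def[abs_def] det2_def by (intro continuous_intros) simp_all
  moreover have "f 0 = 1" by (simp add: f_def start det2_def)
  ultimately obtain s where "s \<in> {0..1}" "f s = 0"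
    using IVT2'[of f 1 0 0] \<open>f 1 \<le> 0\<close> by auto
  then show False
    using det2_neq_0_if_bij[OF linear_blinfun_apply bij] by (simp add: f_def)
qed

lemma circle_reparamE:
  assumes "circle_reparam \<rho>"
  obtains \<rho>' where "continuous_on UNIV \<rho>'" "\<And>t. (\<rho> has_real_derivative \<rho>' t) (at t)" "\<And>t. \<rho>' t > 0"
    "\<And>t. \<rho> (t + 1) = \<rho> t + 1" "\<And>t. \<rho>' (t + 1) = \<rho>' t" "strict_mono \<rho>" "continuous_on UNIV \<rho>"
proof -
  obtain \<rho>' where r: "continuous_on UNIV \<rho>'" "\<And>t. (\<rho> has_real_derivative \<rho>' t) (at t)" "\<And>t. \<rho>' t > 0"
    and shift: "\<And>t. \<rho> (t + 1) = \<rho> t + 1"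
    using assms unfolding circle_reparam_def by blast
  have "\<rho>' (t + 1) = \<rho>' t" for t
  proof (rule DERIV_unique)
    have "((\<lambda>t. \<rho> t + 1) has_real_derivative \<rho>' (t + 1)) (at t)"
      using r(2)[of "t + 1"] unfolding DERIV_shift shift .
    then show "((\<lambda>t. \<rho> t + 1) has_real_derivative \<rho>' (t + 1)) (at t)" .
    show "((\<lambda>t. \<rho> t + 1) has_real_derivative \<rho>' t) (at t)"
      using r(2) by (auto intro!: derivative_eq_intros)
  qed
  moreover have "strict_mono \<rho>"
  proof (rule strict_monoI)
    fix x y :: real assume "x < y"
    then show "\<rho> x < \<rho> y"
      by (rule DERIV_pos_imp_increasing) (rule exI, rule conjI, rule r(2), rule r(3))
  qed
  moreover have "continuous_on UNIV \<rho>"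
    using r(2) by (meson DERIV_isCont continuous_at_imp_continuous_on)
  ultimately show ?thesis by (rule that[OF r shift])
qed

lemma circle_reparam_inj:
  assumes \<rho>: "circle_reparam \<rho>" and eq: "frac (\<rho> s) = frac (\<rho> t)"
  shows "s - t \<in> \<int>"
proof -
  obtain \<rho>' where \<rho>': "\<And>t. \<rho> (t + 1) = \<rho> t + 1" "strict_mono \<rho>"
    using circle_reparamE[OF \<rho>] by metis
  have "\<rho> s - \<rho> t \<in> \<int>" using eq by (rule frac_eq_imp_diff_Ints)
  then obtain k where k: "\<rho> s = \<rho> t + of_int k"
    by (metis Ints_cases diff_add_cancel add.commute)
  have "\<rho> (t + of_int k) - (t + of_int k) = \<rho> t - t"
    using periodic_int[of "\<lambda>t. \<rho> t - t" t k] \<rho>'(1) by simp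
  with k have "\<rho> s = \<rho> (t + of_int k)" by simp
  then have "s = t + of_int k" using \<rho>'(2) by (simp add: strict_mono_eq)
  then show ?thesis by simp
qed

lemma circle_reparam_surj:
  assumes \<rho>: "circle_reparam \<rho>" and \<tau>: "0 \<le> \<tau>" "\<tau> < 1"
  shows "\<exists>s. 0 \<le> s \<and> s < 1 \<and> frac (\<rho> s) = \<tau>"
proof -
  obtain \<rho>' where \<rho>': "\<And>t. \<rho> (t + 1) = \<rho> t + 1" "continuous_on UNIV \<rho>"
    using circle_reparamE[OF \<rho>] by metis
  define k where "k = \<lceil>\<rho> 0 - \<tau>\<rceil>"
  have k: "\<rho> 0 \<le> \<tau> + of_int k" "\<tau> + of_int k < \<rho> 1"
  proof -
    have "\<rho> 1 = \<rho> 0 + 1" using \<rho>'(1)[of 0] by simp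
    then show "\<rho> 0 \<le> \<tau> + of_int k" "\<tau> + of_int k < \<rho> 1"
      using ceiling_correct[of "\<rho> 0 - \<tau>"] unfolding k_def by linarith+
  qed
  then obtain s where s: "0 \<le> s" "s \<le> 1" "\<rho> s = \<tau> + of_int k"
    using IVT'[of \<rho> 0 "\<tau> + of_int k" 1] continuous_on_subset[OF \<rho>'(2), of "{0..1}"] by auto
  moreover have "s \<noteq> 1" using s k by auto
  moreover have "frac (\<tau> + of_int k) = \<tau>"
    using \<tau> by (simp add: frac_eq)
  ultimately show ?thesis by (intro exI[of _ s]) auto
qed

lemma carried_velocity:
  assumes h': "(f has_derivative J) (at (\<gamma> t))" and \<gamma>: "smooth_curve \<gamma>" and \<delta>: "smooth_curve \<delta>"
    and \<rho>: "(\<rho> has_real_derivative r) (at t)" and eq: "\<And>t. f (\<gamma> t) = \<delta> (\<rho> t)"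
  shows "J (vector_derivative \<gamma> (at t)) = r *\<^sub>R vector_derivative \<delta> (at (\<rho> t))"
proof -
  have "((\<lambda>t. f (\<gamma> t)) has_vector_derivative J (vector_derivative \<gamma> (at t))) (at t)"
    by (rule has_vector_derivative_image[OF h' smooth_curve_vector_derivative(1)[OF \<gamma>]])
  moreover have "((\<delta> \<circ> \<rho>) has_vector_derivative r *\<^sub>R vector_derivative \<delta> (at (\<rho> t))) (at t)"
    using \<rho> smooth_curve_vector_derivative(1)[OF \<delta>]
    by (intro vector_diff_chain_at) (simp_all add: has_real_derivative_iff_has_vector_derivative)
  moreover have "\<delta> \<circ> \<rho> = (\<lambda>t. f (\<gamma> t))" using eq by auto
  ultimately show ?thesis by (metis vector_derivative_unique_at)
qed

text \<open>
  The derivatives of the isotopy at its successive times give a homotopy from the tangent loop of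
  \<open>\<gamma>\<close> to a positive multiple of the reparametrised tangent loop of \<open>\<delta>\<close>; the reparametrisation is
  then deformed linearly to the identity.
\<close>

lemma winding_number_carried:
  fixes \<gamma> \<delta> :: "real \<Rightarrow> complex"
  assumes h: "diffeotopy h" and \<rho>: "circle_reparam \<rho>" and eq: "\<And>t. h 1 (\<gamma> t) = \<delta> (\<rho> t)"
    and \<gamma>: "smooth_curve \<gamma>" "\<And>t. \<gamma> (t + 1) = \<gamma> t" "\<And>t. vector_derivative \<gamma> (at t) \<noteq> 0"
    and \<delta>: "smooth_curve \<delta>" "\<And>t. \<delta> (t + 1) = \<delta> t" "\<And>t. vector_derivative \<delta> (at t) \<noteq> 0"
  shows "winding_number (\<lambda>t. vector_derivative \<delta> (at t)) 0 = winding_number (\<lambda>t. vector_derivative \<gamma> (at t)) 0"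
proof -
  define f g where "f t = vector_derivative \<gamma> (at t)" and "g t = vector_derivative \<delta> (at t)" for t
  have cont: "continuous_on UNIV f" "continuous_on UNIV g" "continuous_on UNIV \<gamma>"
    unfolding f_def[abs_def] g_def[abs_def]
    by (intro smooth_curve_continuous_on smooth_curve_vector_derivative(2) \<gamma> \<delta>)+
  have per: "f (t + 1) = f t" "g (t + 1) = g t" for t
    using vector_derivative_periodic[of \<gamma> t, OF \<gamma>(2)] vector_derivative_periodic[of \<delta> t, OF \<delta>(2)]
    by (simp_all add: f_def g_def)
  obtain h' where h': "\<And>s x. s \<in> {0..1} \<Longrightarrow> (h s has_derivative blinfun_apply (h' s x)) (at x)"
    "\<And>s x. s \<in> {0..1} \<Longrightarrow> bij (blinfun_apply (h' s x))"
    "continuous_on ({0..1} \<times> UNIV) (\<lambda>(s, x). h' s x)"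
    "\<And>x v. blinfun_apply (h' 0 x) v = v"
    using diffeotopyE[OF h] by blast
  obtain \<rho>' where \<rho>': "continuous_on UNIV \<rho>'" "\<And>t. (\<rho> has_real_derivative \<rho>' t) (at t)" "\<And>t. \<rho>' t > 0"
    "\<And>t. \<rho> (t + 1) = \<rho> t + 1" "\<And>t. \<rho>' (t + 1) = \<rho>' t" "continuous_on UNIV \<rho>"
    using circle_reparamE[OF \<rho>] by metis
  define H where "H u t = blinfun_apply (h' u (\<gamma> t)) (f t)" for u t
  have H1: "H 1 t = \<rho>' t *\<^sub>R g (\<rho> t)" for t
    unfolding H_def f_def g_def by (rule carried_velocity[OF h'(1) \<gamma>(1) \<delta>(1) \<rho>'(2) eq]) simp
  have "winding_number (H 0) 0 = winding_number (H 1) 0"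
  proof (rule winding_number_loop_homotopy)
    have "continuous_on ({0..1} \<times> {0..1}) (\<lambda>p. case (fst p, \<gamma> (snd p)) of (s, x) \<Rightarrow> h' s x)"
      by (rule continuous_on_compose2[OF h'(3)])
         (auto intro!: continuous_intros continuous_on_compose2[OF cont(3)])
    moreover have "continuous_on ({0..1} \<times> {0..1}) (\<lambda>p :: real \<times> real. f (snd p))"
      by (rule continuous_on_compose2[OF cont(1)]) (auto intro!: continuous_intros)
    ultimately show "continuous_on ({0..1} \<times> {0..1}) (\<lambda>(u, t). H u t)"
      unfolding H_def case_prod_beta fst_conv snd_conv by (rule blinfun.continuous_on)
    show "H u t \<noteq> 0" if "u \<in> {0..1}" for u t
    proof
      assume "H u t = 0"
      then have "f t = 0"
        using injD[OF bij_is_inj[OF h'(2)[OF that]], of "\<gamma> t" "f t" 0] by (simp add: H_def)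
      with \<gamma>(3) show False by (simp add: f_def)
    qed
    show "H u 1 = H u 0" for u
      using \<gamma>(2)[of 0] per(1)[of 0] by (simp add: H_def)
  qed
  moreover have "H 0 = f" by (simp add: H_def h'(4) fun_eq_iff)
  moreover define K where "K u t = ((1 - u) * \<rho>' t + u) *\<^sub>R g ((1 - u) * \<rho> t + u * t)" for u t
  have "winding_number (K 0) 0 = winding_number (K 1) 0"
  proof (rule winding_number_loop_homotopy)
    show "continuous_on ({0..1} \<times> {0..1}) (\<lambda>(u, t). K u t)"
      unfolding K_def case_prod_beta
      by (intro continuous_intros continuous_on_compose2[OF \<rho>'(1)] continuous_on_compose2[OF cont(2)]
          continuous_on_compose2[OF \<rho>'(6)]) auto
    show "K u t \<noteq> 0" if u: "u \<in> {0..1}" for u t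
    proof -
      have "(1 - u) * \<rho>' t + u > 0"
        using u \<rho>'(3)[of t] by (cases "u = 0") (auto intro: add_nonneg_pos)
      then show ?thesis using \<delta>(3) by (simp add: K_def g_def)
    qed
    show "K u 1 = K u 0" for u
    proof -
      have "(1 - u) * \<rho> 1 + u = (1 - u) * \<rho> 0 + 1"
        using \<rho>'(4)[of 0] by (simp add: algebra_simps)
      then show ?thesis using \<rho>'(5)[of 0] per(2) by (simp add: K_def)
    qed
  qed
  moreover have "K 0 = H 1" "K 1 = g" by (auto simp: K_def H1 fun_eq_iff)
  ultimately show ?thesis by (simp add: f_def[abs_def] g_def[abs_def])
qed

text \<open>
  Parameters correspond bijectively, and so do crossings: a double point has exactly one upper
  strand, so the correspondence cannot exchange over and under on the way back.  Signs are preserved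
  because both velocities at a crossing are transformed by the same linear map of positive
  determinant, up to positive factors.
\<close>

lemma planar_isotopic_invariants:
  assumes "planar_isotopic D D'"
  shows "total_winding D' = total_winding D" "writhe D' = writhe D"
proof -
  obtain h \<sigma> \<rho> where D: "link_diagram D" "link_diagram D'" and h: "diffeotopy h"
    and c: "carries (h 1) \<sigma> \<rho> (curves D) (curves D')"
    and cross: "\<forall>(x, y)\<in>crossings D. (carry_param \<sigma> \<rho> x, carry_param \<sigma> \<rho> y) \<in> crossings D'"
    using assms unfolding planar_isotopic_def by blast
  define n where "n = length (curves D)"
  have len: "length (curves D') = n" and \<sigma>: "bij_betw \<sigma> {..<n} {..<n}"
    and \<rho>: "\<And>i. i < n \<Longrightarrow> circle_reparam (\<rho> i)"
    and eq: "\<And>i t. i < n \<Longrightarrow> h 1 ((curves D ! i) t) = (curves D' ! \<sigma> i) (\<rho> i t)"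
    using c by (auto simp: carries_def n_def)
  have \<sigma>_less: "\<sigma> i < length (curves D')" if "i < n" for i
    using bij_betwE[OF \<sigma>] that len by auto
  note d = link_diagramD[OF D(1), folded n_def] link_diagramD[OF D(2) \<sigma>_less]
  have "total_winding D' = (\<Sum>i<n. Re (winding_number (\<lambda>t. vector_derivative (curves D' ! \<sigma> i) (at t)) 0))"
    unfolding total_winding_eq_sum len by (rule sum.reindex_bij_betw[OF \<sigma>, symmetric])
  also have "\<dots> = total_winding D"
    unfolding total_winding_eq_sum n_def[symmetric]
  proof (rule sum.cong[OF refl])
    fix i assume "i \<in> {..<n}"
    then have i: "i < n" by simp
    show "Re (winding_number (\<lambda>t. vector_derivative (curves D' ! \<sigma> i) (at t)) 0) =
        Re (winding_number (\<lambda>t. vector_derivative (curves D ! i) (at t)) 0)"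
      by (subst winding_number_carried[OF h \<rho>[OF i] eq[OF i] d(1-3)[OF i] d(4-6)[OF i]]) simp
  qed
  finally show "total_winding D' = total_winding D" .

  let ?c = "carry_param \<sigma> \<rho>"
  have inj: "x = y" if "x \<in> params (curves D)" "y \<in> params (curves D)" "?c x = ?c y" for x y
  proof -
    have i: "fst x < n" "fst y < n" using that by (auto simp: params_def n_def)
    have "fst x = fst y"
      using that(3) bij_betw_imp_inj_on[OF \<sigma>] i by (auto simp: carry_param_def inj_on_def)
    moreover have "snd x - snd y \<in> \<int>"
      using that(3) calculation by (intro circle_reparam_inj[OF \<rho>[OF i(1)]]) (simp add: carry_param_def)
    ultimately show ?thesis using params_eq that by blast
  qed
  have surj: "\<exists>x\<in>params (curves D). x' = ?c x" if "x' \<in> params (curves D')" for x'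
  proof -
    have "fst x' < n" "0 \<le> snd x'" "snd x' < 1"
      using that len by (auto simp: params_def)
    moreover then obtain i where i: "i < n" "\<sigma> i = fst x'"
      using \<sigma> by (auto simp: bij_betw_def) (metis imageE lessThan_iff)
    ultimately obtain s where "0 \<le> s" "s < 1" "frac (\<rho> i s) = snd x'"
      using circle_reparam_surj[OF \<rho>] by blast
    with i show ?thesis
      by (intro bexI[of _ "(i, s)"]) (auto simp: carry_param_def params_def n_def prod_eq_iff)
  qed
  have image: "point (curves D') (?c x) = h 1 (point (curves D) x)"
    "velocity (curves D') (?c x) = vector_derivative (curves D' ! \<sigma> (fst x)) (at (\<rho> (fst x) (snd x)))"
    if "x \<in> params (curves D)" for x
  proof -
    have i: "fst x < n" using that by (auto simp: params_def n_def)
    let ?\<delta> = "curves D' ! \<sigma> (fst x)"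
    show "point (curves D') (?c x) = h 1 (point (curves D) x)"
      using periodic_frac[of ?\<delta>, OF d(5)[OF i]] eq[OF i] by (simp add: point_def carry_param_def)
    show "velocity (curves D') (?c x) = vector_derivative ?\<delta> (at (\<rho> (fst x) (snd x)))"
      using periodic_frac[of "\<lambda>t. vector_derivative ?\<delta> (at t)", OF vector_derivative_periodic[of ?\<delta>, OF d(5)[OF i]]]
      by (simp add: velocity_def carry_param_def)
  qed
  have "bij_betw (map_prod ?c ?c) (crossings D) (crossings D')"
    unfolding bij_betw_def
  proof
    show "inj_on (map_prod ?c ?c) (crossings D)"
    proof (rule inj_onI)
      fix p q assume "p \<in> crossings D" "q \<in> crossings D" "map_prod ?c ?c p = map_prod ?c ?c q"
      then show "p = q"
        using inj[of "fst p" "fst q"] inj[of "snd p" "snd q"] by (auto simp: crossings_def prod_eq_iff)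
    qed
    show "map_prod ?c ?c ` crossings D = crossings D'"
    proof
      show "map_prod ?c ?c ` crossings D \<subseteq> crossings D'" using cross by auto
      show "crossings D' \<subseteq> map_prod ?c ?c ` crossings D"
      proof
        fix q assume q: "q \<in> crossings D'"
        obtain x' y' where q_eq: "q = (x', y')" by (cases q)
        have xy': "x' \<in> params (curves D')" "y' \<in> params (curves D')" "x' \<noteq> y'"
            "point (curves D') x' = point (curves D') y'" "over D' x'" "\<not> over D' y'"
          using q by (auto simp: q_eq crossings_def)
        obtain x y where xy: "x \<in> params (curves D)" "y \<in> params (curves D)" "x' = ?c x" "y' = ?c y"
          using surj xy'(1,2) by blast
        have "inj (h 1)" using h by (auto simp: diffeotopy_def bij_is_inj)
        then have "point (curves D) x = point (curves D) y"
          using xy'(4) image(1)[OF xy(1)] image(1)[OF xy(2)] xy(3,4) by (simp add: inj_eq)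
        moreover have "x \<noteq> y" using xy xy' by auto
        ultimately have "over D x \<longleftrightarrow> \<not> over D y"
          using D(1) xy(1,2) unfolding link_diagram_def by blast
        with \<open>point _ x = point _ y\<close> \<open>x \<noteq> y\<close> xy have "(x, y) \<in> crossings D \<or> (y, x) \<in> crossings D"
          by (auto simp: crossings_def)
        moreover have "(y, x) \<notin> crossings D"
        proof
          assume "(y, x) \<in> crossings D"
          then have "(?c y, ?c x) \<in> crossings D'" using cross by fast
          with xy'(6) xy(4) show False by (simp add: crossings_def)
        qed
        ultimately show "q \<in> map_prod ?c ?c ` crossings D"
          using xy q_eq by force
      qed
    qed
  qed
  moreover have "sign_at D' (map_prod ?c ?c q) = sign_at D q" if q: "q \<in> crossings D" for q
  proof -
    obtain x y where q_eq: "q = (x, y)" by (cases q)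
    have xy: "x \<in> params (curves D)" "y \<in> params (curves D)" "point (curves D) x = point (curves D) y"
      using q by (auto simp: q_eq crossings_def)
    obtain h' where h': "\<And>s x. s \<in> {0..1} \<Longrightarrow> (h s has_derivative blinfun_apply (h' s x)) (at x)"
      "\<And>s x. s \<in> {0..1} \<Longrightarrow> bij (blinfun_apply (h' s x))"
      "continuous_on ({0..1} \<times> UNIV) (\<lambda>(s, x). h' s x)"
      "\<And>x v. blinfun_apply (h' 0 x) v = v"
      using diffeotopyE[OF h] by blast
    define J where "J = blinfun_apply (h' 1 (point (curves D) x))"
    have J: "linear J" "det2 (J 1) (J \<i>) > 0"
      unfolding J_def using det2_pos_along_diffeotopy[OF h'(2,3,4)] by (auto simp: linear_blinfun_apply)
    have scaled: "\<exists>r>0. J (velocity (curves D) z) = r *\<^sub>R velocity (curves D') (?c z)"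
      if "z \<in> params (curves D)" "point (curves D) z = point (curves D) x" for z
    proof -
      have i: "fst z < n" using that by (auto simp: params_def n_def)
      obtain \<rho>' where \<rho>': "\<And>t. (\<rho> (fst z) has_real_derivative \<rho>' t) (at t)" "\<And>t. \<rho>' t > 0"
        using circle_reparamE[OF \<rho>[OF i]] by metis
      have J_z: "J = blinfun_apply (h' 1 ((curves D ! fst z) (snd z)))"
        using that(2) unfolding J_def point_def by simp
      have "J (velocity (curves D) z) = \<rho>' (snd z) *\<^sub>R velocity (curves D') (?c z)"
        unfolding image(2)[OF that(1)] J_z velocity_def[of "curves D"]
        by (rule carried_velocity[OF h'(1) d(1)[OF i] d(4)[OF i] \<rho>'(1) eq[OF i]]) simp
      with \<rho>'(2) show ?thesis by blast
    qed
    obtain r where r: "r > 0" "J (velocity (curves D) x) = r *\<^sub>R velocity (curves D') (?c x)"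
      using scaled[OF xy(1)] by auto
    obtain r' where r': "r' > 0" "J (velocity (curves D) y) = r' *\<^sub>R velocity (curves D') (?c y)"
      using scaled[OF xy(2)] xy(3) by auto
    have "(r * r') * det2 (velocity (curves D') (?c x)) (velocity (curves D') (?c y)) =
        det2 (J 1) (J \<i>) * det2 (velocity (curves D) x) (velocity (curves D) y)"
      unfolding det2_linear_image[OF J(1), symmetric] r(2) r'(2) by (simp add: det2_def algebra_simps)
    moreover have "r * r' > 0" using r r' by simp
    ultimately have "det2 (velocity (curves D') (?c x)) (velocity (curves D') (?c y)) > 0 \<longleftrightarrow>
        det2 (velocity (curves D) x) (velocity (curves D) y) > 0"
      using J(2) by (metis zero_less_mult_pos zero_less_mult_iff)
    then show ?thesis by (simp add: sign_at_def q_eq)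
  qed
  ultimately show "writhe D' = writhe D"
    unfolding writhe_def
    using sum.reindex_bij_betw[of "map_prod ?c ?c" "crossings D" "crossings D'" "\<lambda>q. sign_value (sign_at D' q)"]
    by simp
qed

section \<open>Deforming a link to have nonzero winding number\<close>

definition tangent :: "link \<Rightarrow> nat \<Rightarrow> real \<Rightarrow> complex" where
  "tangent K i t = vector_derivative (\<lambda>t. fst ((K ! i) t)) (at t)"

definition climb :: "link \<Rightarrow> nat \<Rightarrow> real \<Rightarrow> real" where
  "climb K i t = vector_derivative (\<lambda>t. snd ((K ! i) t)) (at t)"

definition immersed_projection :: "link \<Rightarrow> bool" where
  "immersed_projection K \<longleftrightarrow> (\<forall>i<length K. \<forall>t. tangent K i t \<noteq> 0)"

definition projection_winding :: "link \<Rightarrow> real" where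
  "projection_winding K = (\<Sum>i<length K. Re (winding_number (tangent K i) 0))"

lemma total_winding_diagram_below: "total_winding (diagram_below K) = projection_winding K"
  unfolding total_winding_eq_sum projection_winding_def
  by (simp add: diagram_below_def tangent_def[abs_def])

lemma generic_projection_immersed: "generic_projection K \<Longrightarrow> immersed_projection K"
  unfolding generic_projection_def immersed_projection_def tangent_def by meson

context
  fixes K :: link and i :: nat
  assumes K: "oriented_link K" and i: "i < length K"
begin

lemma
  shows has_vector_derivative_fst_curve: "((\<lambda>t. fst ((K ! i) t)) has_vector_derivative tangent K i t) (at t)"
    and has_vector_derivative_snd_curve: "((\<lambda>t. snd ((K ! i) t)) has_vector_derivative climb K i t) (at t)"
    and has_vector_derivative_curve: "((K ! i) has_vector_derivative (tangent K i t, climb K i t)) (at t)"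
    and smooth_tangent: "smooth_curve (tangent K i)"
    and smooth_climb: "smooth_curve (climb K i)"
    and smooth_fst_curve: "smooth_curve (\<lambda>t. fst ((K ! i) t))"
    and smooth_snd_curve: "smooth_curve (\<lambda>t. snd ((K ! i) t))"
    and tangent_periodic: "tangent K i (t + 1) = tangent K i t"
proof -
  note d = oriented_linkD[OF K i]
  show s: "smooth_curve (\<lambda>t. fst ((K ! i) t))" "smooth_curve (\<lambda>t. snd ((K ! i) t))"
    by (intro smooth_curve_intros d)+
  show *: "((\<lambda>t. fst ((K ! i) t)) has_vector_derivative tangent K i t) (at t)"
    "((\<lambda>t. snd ((K ! i) t)) has_vector_derivative climb K i t) (at t)"
    unfolding tangent_def climb_def by (intro smooth_curve_vector_derivative s)+
  show "((K ! i) has_vector_derivative (tangent K i t, climb K i t)) (at t)"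
    using has_vector_derivative_Pair[OF *] by simp
  show "smooth_curve (tangent K i)" "smooth_curve (climb K i)"
    unfolding tangent_def[abs_def] climb_def[abs_def] by (intro smooth_curve_vector_derivative s)+
  show "tangent K i (t + 1) = tangent K i t"
    unfolding tangent_def by (intro vector_derivative_periodic) (simp add: d)
qed

lemma continuous_on_tangent: "continuous_on S (tangent K i)"
  and continuous_on_climb: "continuous_on S (climb K i)"
  by (intro smooth_curve_continuous_on smooth_tangent smooth_climb)+

lemma tangent_image_link:
  assumes "(F has_derivative D) (at ((K ! i) t))"
  shows "tangent (image_link F K) i t = fst (D (tangent K i t, climb K i t))"
    and "climb (image_link F K) i t = snd (D (tangent K i t, climb K i t))"
proof -
  have "((\<lambda>t. F ((K ! i) t)) has_vector_derivative D (tangent K i t, climb K i t)) (at t)"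
    by (rule has_vector_derivative_image[OF assms has_vector_derivative_curve])
  then have "((\<lambda>t. fst (F ((K ! i) t))) has_vector_derivative fst (D (tangent K i t, climb K i t))) (at t)"
    "((\<lambda>t. snd (F ((K ! i) t))) has_vector_derivative snd (D (tangent K i t, climb K i t))) (at t)"
    by (auto intro: bounded_linear.has_vector_derivative[OF bounded_linear_fst]
        bounded_linear.has_vector_derivative[OF bounded_linear_snd])
  then show "tangent (image_link F K) i t = fst (D (tangent K i t, climb K i t))"
    "climb (image_link F K) i t = snd (D (tangent K i t, climb K i t))"
    using i by (simp_all add: tangent_def climb_def nth_image_link vector_derivative_at)
qed

end

lemma small_multiple:
  fixes v :: "real \<Rightarrow> 'a::real_normed_vector" and g :: "real \<Rightarrow> real"
  assumes "compact S" "continuous_on S v" "continuous_on S g" "\<And>t. t \<in> S \<Longrightarrow> v t \<noteq> 0"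
  shows "\<exists>e>0. \<forall>t\<in>S. e * \<bar>g t\<bar> < norm (v t)"
proof -
  have "compact ((\<lambda>t. \<bar>g t\<bar> / norm (v t)) ` S)"
    using assms by (intro compact_continuous_image continuous_intros) auto
  then obtain B where B0: "B > 0" "\<forall>x\<in>(\<lambda>t. \<bar>g t\<bar> / norm (v t)) ` S. norm x \<le> B"
    using compact_imp_bounded bounded_pos by blast
  have B: "\<bar>g t\<bar> / norm (v t) \<le> B" "B > 0" if "t \<in> S" for t
    using B0 that by auto
  have "1 / (B + 1) * \<bar>g t\<bar> < norm (v t)" if "t \<in> S" for t
  proof -
    have "\<bar>g t\<bar> \<le> B * norm (v t)"
      using B(1)[OF that] assms(4)[OF that] by (simp add: divide_le_eq)
    also have "\<dots> < (B + 1) * norm (v t)"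
      using assms(4)[OF that] by simp
    finally show ?thesis using B0(1) by (simp add: divide_less_eq mult.commute)
  qed
  then show ?thesis using B0(1) by (intro exI[of _ "1 / (B + 1)"]) auto
qed

lemma common_epsilon:
  assumes "\<And>i. i < (n :: nat) \<Longrightarrow> \<exists>e>0. P i e"
    and "\<And>i e e'. P i e \<Longrightarrow> 0 < e' \<Longrightarrow> e' \<le> (e :: real) \<Longrightarrow> P i e'"
  shows "\<exists>e>0. \<forall>i<n. P i e"
  using assms(1)
proof (induction n)
  case 0
  then show ?case by (intro exI[of _ 1]) auto
next
  case (Suc n)
  then obtain e where e: "e > 0" "\<forall>i<n. P i e" by auto
  obtain e' where e': "e' > 0" "P n e'" using Suc.prems[of n] by auto
  have "P i (min e e')" if "i < Suc n" for i
  proof (cases "i = n")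
    case True
    then show ?thesis using assms(2)[OF e'(2), of "min e e'"] e e' by simp
  next
    case False
    then show ?thesis using assms(2)[of i e "min e e'"] e e' that by simp
  qed
  then show ?case using e(1) e'(1) by (intro exI[of _ "min e e'"]) auto
qed

lemma periodic_cover:
  fixes c t :: real
  obtains k :: int where "t + of_int k \<in> {c..c + 1}"
  by (rule that[of "- \<lfloor>t - c\<rfloor>"]) (simp, linarith)

text \<open>
  A small shear changes the tangents by less than their lengths.
\<close>

lemma exists_generic_shear_same_winding:
  assumes K: "oriented_link K" and imm: "immersed_projection K"
  shows "\<exists>F. deformation F \<and> generic_projection (image_link F K) \<and>
    projection_winding (image_link F K) = projection_winding K"
proof -
  let ?z = "\<lambda>i t. snd ((K ! i) t)"
  define P where "P i e \<longleftrightarrow> (\<forall>t\<in>{0..1}. e * \<bar>\<bar>climb K i t\<bar> + \<bar>2 * ?z i t * climb K i t\<bar>\<bar> < norm (tangent K i t))" for i e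
  have "\<exists>e>0. \<forall>i<length K. P i e"
  proof (rule common_epsilon)
    fix i assume i: "i < length K"
    show "\<exists>e>0. P i e"
      unfolding P_def
      using imm i by (intro small_multiple continuous_intros continuous_on_tangent[OF K i] continuous_on_climb[OF K i]
          smooth_curve_continuous_on[OF smooth_snd_curve[OF K i]]) (auto simp: immersed_projection_def)
  next
    fix i and e e' :: real assume "P i e" "0 < e'" "e' \<le> e"
    then show "P i e'"
      unfolding P_def using mult_right_mono[OF \<open>e' \<le> e\<close> abs_ge_zero] by (meson order_le_less_trans)
  qed
  then obtain e where e: "e > 0" "\<And>i. i < length K \<Longrightarrow> P i e" by blast
  obtain A B where AB: "norm A < e" "norm B < e" "generic_projection (image_link (quadratic_shear A B) K)"
    using exists_small_generic_shear[OF K e(1)] by blast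
  let ?K = "image_link (quadratic_shear A B) K"
  have K': "oriented_link ?K" by (intro oriented_link_image_link K deformation_quadratic_shear)
  have "winding_number (tangent ?K i) 0 = winding_number (tangent K i) 0" if i: "i < length K" for i
  proof (rule winding_number_nearby_loops_eq)
    have i': "i < length ?K" using i by simp
    show "path (tangent K i)" "path (tangent ?K i)"
      unfolding path_def by (intro continuous_on_tangent K K' i i')+
    show "pathfinish (tangent K i) = pathstart (tangent K i)" "pathfinish (tangent ?K i) = pathstart (tangent ?K i)"
      using tangent_periodic[OF K i, of 0] tangent_periodic[OF K' i', of 0]
      by (simp_all add: pathstart_def pathfinish_def)
    fix t :: real assume t: "t \<in> {0..1}"
    have "tangent ?K i t = tangent K i t + climb K i t *\<^sub>R A + (2 * ?z i t * climb K i t) *\<^sub>R B"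
    proof -
      have "(quadratic_shear A B has_derivative (\<lambda>v. (fst v + snd v *\<^sub>R A + (2 * snd p * snd v) *\<^sub>R B, snd v))) (at p)" for p
        unfolding quadratic_shear_def[abs_def] by (auto intro!: derivative_eq_intros)
      from tangent_image_link(1)[OF K i this] show ?thesis by simp
    qed
    then have "norm (tangent ?K i t - tangent K i t) = norm (climb K i t *\<^sub>R A + (2 * ?z i t * climb K i t) *\<^sub>R B)"
      by (simp add: algebra_simps)
    also have "\<dots> \<le> \<bar>climb K i t\<bar> * norm A + \<bar>2 * ?z i t * climb K i t\<bar> * norm B"
      by (rule order_trans[OF norm_triangle_ineq]) simp
    also have "\<dots> \<le> \<bar>climb K i t\<bar> * e + \<bar>2 * ?z i t * climb K i t\<bar> * e"
      using AB by (intro add_mono mult_left_mono) auto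
    also have "\<dots> = e * \<bar>\<bar>climb K i t\<bar> + \<bar>2 * ?z i t * climb K i t\<bar>\<bar>"
      by (simp add: algebra_simps)
    also have "\<dots> < norm (tangent K i t - 0)"
      using e(2)[OF i] t by (simp add: P_def)
    finally show "norm (tangent ?K i t - tangent K i t) < norm (tangent K i t - 0)" .
  qed
  then have "projection_winding ?K = projection_winding K"
    by (simp add: projection_winding_def)
  with AB(3) show ?thesis using deformation_quadratic_shear by blast
qed


lemma eventually_power_small:
  fixes a u x :: "real \<Rightarrow> real"
  assumes Q: "compact Q" and cont: "continuous_on Q a" "continuous_on Q u" "continuous_on Q x"
    and u: "\<And>t. t \<in> Q \<Longrightarrow> 0 \<le> u t \<and> u t < 1" and x: "\<And>t. t \<in> Q \<Longrightarrow> x t \<noteq> 0"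
  shows "eventually (\<lambda>N. \<forall>t\<in>Q. \<bar>a t\<bar> * u t ^ N < \<bar>x t\<bar>) sequentially"
proof (cases "Q = {}")
  case False
  obtain e where e: "e > 0" "\<And>t. t \<in> Q \<Longrightarrow> e * \<bar>a t\<bar> < \<bar>x t\<bar>"
    using small_multiple[OF Q cont(3) cont(1) x] by auto
  obtain m where m: "m \<in> Q" "\<And>t. t \<in> Q \<Longrightarrow> u t \<le> u m"
    using continuous_attains_sup[OF Q False cont(2)] by blast
  obtain N0 where N0: "u m ^ N0 < e"
    using real_arch_pow_inv[OF e(1)] u[OF m(1)] by blast
  have "\<bar>a t\<bar> * u t ^ N < \<bar>x t\<bar>" if "N \<ge> N0" "t \<in> Q" for N t
  proof -
    have "u t ^ N \<le> u m ^ N" using m(2) u that by (intro power_mono) auto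
    also have "\<dots> \<le> u m ^ N0" using u[OF m(1)] that by (intro power_decreasing) auto
    finally have "\<bar>a t\<bar> * u t ^ N \<le> \<bar>a t\<bar> * e" using N0 by (intro mult_left_mono) auto
    with e(2)[OF that(2)] show ?thesis by (simp add: mult.commute)
  qed
  then show ?thesis unfolding eventually_sequentially by blast
qed simp

lemma compact_link_values:
  fixes f :: "complex \<times> real \<Rightarrow> real"
  assumes K: "oriented_link K" and f: "continuous_on UNIV f"
  defines "S \<equiv> (\<Union>i<length K. (\<lambda>t. f ((K ! i) t)) ` {0..1})"
  shows "compact S" "S \<noteq> {}" "i < length K \<Longrightarrow> f ((K ! i) t) \<in> S"
proof -
  show "compact S"
    unfolding S_def
    by (intro compact_UN finite_lessThan compact_continuous_image compact_Icc continuous_on_compose2[OF f]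
        smooth_curve_continuous_on oriented_linkD[OF K]) auto
  show mem: "f ((K ! i) t) \<in> S" if i: "i < length K" for i t
  proof -
    have "(K ! i) (frac t) = (K ! i) t" by (rule periodic_frac) (rule oriented_linkD(2)[OF K i])
    then have "f ((K ! i) t) = f ((K ! i) (frac t))" by simp
    moreover have "frac t \<in> {0..1}" using frac_lt_1[of t] by (simp add: frac_ge_0 less_imp_le)
    ultimately show ?thesis unfolding S_def using i by blast
  qed
  have "0 < length K" using K by (simp add: oriented_link_def)
  from mem[OF this] show "S \<noteq> {}" by blast
qed

lemma deformation_ident: "deformation (\<lambda>p. p)"
  using deformation_shear[of "\<lambda>p. 0" "\<lambda>p v. 0"] by (simp add: smooth_curve_const)

lemma image_link_ident [simp]: "image_link (\<lambda>p. p) K = K"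
  by (simp add: image_link_def)

text \<open>
  A shear in the direction of \<open>x\<close>.  If \<open>l * (y - b)\<close> is 1 at the maximum of \<open>y\<close> on the link and lies
  in \<open>[0, 1)\<close> at all other points, then a large \<open>N\<close> concentrates the effect on the link near the maximum.
\<close>

definition bulge :: "real \<Rightarrow> real \<Rightarrow> real \<Rightarrow> nat \<Rightarrow> complex \<times> real \<Rightarrow> complex \<times> real" where
  "bulge C l b N p = (fst p + of_real (C * snd p * (l * (Im (fst p) - b)) ^ N), snd p)"

text \<open>
  The derivative in direction \<open>v\<close> of the displacement caused by \<open>bulge\<close> at \<open>p\<close>.
\<close>

definition bulge_speed :: "real \<Rightarrow> real \<Rightarrow> real \<Rightarrow> nat \<Rightarrow> complex \<times> real \<Rightarrow> complex \<times> real \<Rightarrow> real" where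
  "bulge_speed C l b N p v = C * (snd v * (l * (Im (fst p) - b)) ^ N +
     snd p * (real N * (l * Im (fst v)) * (l * (Im (fst p) - b)) ^ (N - 1)))"

lemma deformation_bulge: "deformation (bulge C l b N)"
  and bulge_has_derivative:
    "(bulge C l b N has_derivative (\<lambda>v. (fst v + of_real (bulge_speed C l b N p v), snd v))) (at p)"
proof -
  let ?\<Psi> = "\<lambda>p :: complex \<times> real. (complex_of_real (C * snd p * (l * (Im (fst p) - b)) ^ N), 0 :: real)"
  have eq: "bulge C l b N = (\<lambda>p. p + ?\<Psi> p)" by (auto simp: bulge_def fun_eq_iff)
  have D: "(?\<Psi> has_derivative (\<lambda>v. (of_real (bulge_speed C l b N p v), 0))) (at p)" for p
    unfolding bulge_speed_def
    by (rule derivative_eq_intros | rule has_derivative_Im | simp add: algebra_simps)+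
  show "(bulge C l b N has_derivative (\<lambda>v. (fst v + of_real (bulge_speed C l b N p v), snd v))) (at p)"
    unfolding eq using has_derivative_add[OF has_derivative_ident D]
    by (rule has_derivative_eq_rhs) (auto simp: fun_eq_iff prod_eq_iff)
  show "deformation (bulge C l b N)"
    unfolding eq
  proof (rule deformation_shear)
    show "(?\<Psi> has_derivative (\<lambda>v. (of_real (bulge_speed C l b N p v), 0))) (at p)" for p by (rule D)
    show "continuous_on UNIV (\<lambda>p. (complex_of_real (bulge_speed C l b N p v), 0 :: real))" for v
      unfolding bulge_speed_def by (intro continuous_intros)
    show "smooth_curve (\<lambda>t. (complex_of_real (C * snd (\<gamma> t) * (l * (Im (fst (\<gamma> t)) - b)) ^ N), 0 :: real))"
      if "smooth_curve \<gamma>" for \<gamma> :: "real \<Rightarrow> complex \<times> real"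
      by (intro smooth_curve_intros smooth_curve_bounded_linear[OF bounded_linear_of_real] that)
  qed simp
qed

text \<open>
  The bulge adds to the tangent a real function \<open>G\<close>, so the imaginary part \<open>y'\<close> stays the same.
  The quotient of the new and the old tangent is real only where \<open>G\<close> or \<open>y'\<close> vanishes; in the first
  case it is 1.  At a zero of \<open>y'\<close> the function \<open>G\<close> is
  \<open>C * z' * u ^ N\<close>, which is negligible against \<open>x'\<close> except at the maximum, where it equals
  \<open>- 2 * x'\<close>.  So the quotient is a negative real number at the maximum only, and the winding number
  of one component changes.
\<close>

lemma deformation_with_nonzero_winding_if_strict_maximum:
  assumes K: "oriented_link K" and imm: "immersed_projection K" and i0: "i0 < length K"
    and max: "\<And>i t. i < length K \<Longrightarrow> Im (fst ((K ! i) t)) < Im (fst ((K ! i0) t0)) \<or> i = i0 \<and> t - t0 \<in> \<int>"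
    and d: "d > 0" "\<And>t. t \<in> {t0 - d<..<t0} \<Longrightarrow> Im (tangent K i0 t) > 0"
      "\<And>t. t \<in> {t0<..<t0 + d} \<Longrightarrow> Im (tangent K i0 t) < 0"
    and crit: "Im (tangent K i0 t0) = 0" and climb: "climb K i0 t0 \<noteq> 0"
  shows "\<exists>F. deformation F \<and> immersed_projection (image_link F K) \<and> projection_winding (image_link F K) \<noteq> 0"
proof (cases "projection_winding K = 0")
  case False
  then show ?thesis using imm deformation_ident by (intro exI[of _ "\<lambda>p. p"]) simp
next
  case True
  define x' y' z' z y where "x' i t = Re (tangent K i t)" and "y' i t = Im (tangent K i t)"
    and "z' i t = climb K i t" and "z i t = snd ((K ! i) t)" and "y i t = Im (fst ((K ! i) t))" for i t
  have x'_neq: "x' i t \<noteq> 0" if "i < length K" "y' i t = 0" for i t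
    using imm that by (auto simp: immersed_projection_def x'_def y'_def complex_eq_iff)
  have "compact (\<Union>i<length K. (\<lambda>t. Im (fst ((K ! i) t))) ` {0..1})"
    by (rule compact_link_values(1)[OF K]) (intro continuous_intros)
  then obtain b0 where b0: "\<And>s. s \<in> (\<Union>i<length K. (\<lambda>t. Im (fst ((K ! i) t))) ` {0..1}) \<Longrightarrow> norm s \<le> b0"
    by (meson bounded_iff compact_imp_bounded)
  define b where "b = - b0 - 1"
  have b: "b < y i t" if "i < length K" for i t
  proof -
    have "y i t \<in> (\<Union>i<length K. (\<lambda>t. Im (fst ((K ! i) t))) ` {0..1})"
      unfolding y_def by (rule compact_link_values(3)[OF K _ that]) (intro continuous_intros)
    from b0[OF this] show ?thesis by (simp add: b_def)
  qed
  define l where "l = 1 / (y i0 t0 - b)"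
  have l: "l > 0" using b[OF i0, of t0] by (simp add: l_def)
  define u where "u i t = l * (y i t - b)" for i t
  have u_max: "u i0 t0 = 1" using b[OF i0, of t0] by (simp add: u_def l_def)
  have u: "0 \<le> u i t" "u i t < 1 \<or> i = i0 \<and> t - t0 \<in> \<int>" if "i < length K" for i t
  proof -
    show "0 \<le> u i t" using b[OF that, of t] l by (simp add: u_def)
    have "u i t < u i0 t0" if "y i t < y i0 t0"
      unfolding u_def using that l by simp
    then show "u i t < 1 \<or> i = i0 \<and> t - t0 \<in> \<int>"
      using max[OF that, of t] u_max by (auto simp: y_def)
  qed
  \<comment> \<open>With this factor \<open>G\<close> turns \<open>x'\<close> into \<open>- x'\<close> at the maximum.\<close>
  define C where "C = - 2 * x' i0 t0 / z' i0 t0"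
  define I where "I = {t0 - 1/2..t0 + 1/2}"
  \<comment> \<open>The zeros of \<open>y'\<close> apart from the maximum: there is no other zero within distance \<open>d\<close> of it.\<close>
  define Q where "Q i = {t \<in> I. y' i t = 0 \<and> (i = i0 \<longrightarrow> d \<le> \<bar>t - t0\<bar>)}" for i
  have cont: "continuous_on S (x' i)" "continuous_on S (y' i)" "continuous_on S (z' i)"
      "continuous_on S (z i)" "continuous_on S (y i)" if "i < length K" for S i
    unfolding x'_def[abs_def] y'_def[abs_def] z'_def[abs_def] z_def[abs_def] y_def[abs_def]
    by (intro continuous_intros continuous_on_tangent[OF K that] continuous_on_climb[OF K that]
        smooth_curve_continuous_on smooth_snd_curve[OF K that] smooth_fst_curve[OF K that])+
  have "eventually (\<lambda>N. \<forall>i\<in>{..<length K}. \<forall>t\<in>Q i. \<bar>C * z' i t\<bar> * u i t ^ N < \<bar>x' i t\<bar>) sequentially"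
  proof (rule eventually_ball_finite[OF finite_lessThan], rule ballI)
    fix i assume "i \<in> {..<length K}"
    then have i: "i < length K" by simp
    show "eventually (\<lambda>N. \<forall>t\<in>Q i. \<bar>C * z' i t\<bar> * u i t ^ N < \<bar>x' i t\<bar>) sequentially"
    proof (rule eventually_power_small)
      have "closed {t. y' i t = 0}" "closed {t. i = i0 \<longrightarrow> d \<le> \<bar>t - t0\<bar>}"
        by (intro closed_Collect_eq closed_Collect_imp open_Collect_const closed_Collect_le continuous_intros cont i)+
      then have "compact (I \<inter> ({t. y' i t = 0} \<inter> {t. i = i0 \<longrightarrow> d \<le> \<bar>t - t0\<bar>}))"
        unfolding I_def by (intro compact_Int_closed compact_Icc closed_Int)
      moreover have "Q i = I \<inter> ({t. y' i t = 0} \<inter> {t. i = i0 \<longrightarrow> d \<le> \<bar>t - t0\<bar>})"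
        by (auto simp: Q_def)
      ultimately show "compact (Q i)" by simp
      show "continuous_on (Q i) (\<lambda>t. C * z' i t)" "continuous_on (Q i) (u i)" "continuous_on (Q i) (x' i)"
        unfolding u_def[abs_def] by (intro continuous_intros cont i)+
      fix t assume t: "t \<in> Q i"
      then show "x' i t \<noteq> 0" using x'_neq i by (simp add: Q_def)
      have "\<not> (i = i0 \<and> t - t0 \<in> \<int>)"
      proof
        assume *: "i = i0 \<and> t - t0 \<in> \<int>"
        have "\<bar>t - t0\<bar> < 1" using t by (auto simp: Q_def I_def)
        then have "t - t0 = 0" using * Ints_nonzero_abs_less1 by blast
        then show False using t d(1) * by (simp add: Q_def)
      qed
      then show "0 \<le> u i t \<and> u i t < 1" using u[OF i, of t] by blast
    qed
  qed
  then obtain N where N: "\<And>i t. i < length K \<Longrightarrow> t \<in> Q i \<Longrightarrow> \<bar>C * z' i t\<bar> * u i t ^ N < \<bar>x' i t\<bar>"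
    using eventually_happens'[OF sequentially_bot] by fastforce

  let ?K = "image_link (bulge C l b N) K"
  have K': "oriented_link ?K" by (intro oriented_link_image_link K deformation_bulge)
  define G where "G i t = bulge_speed C l b N ((K ! i) t) (tangent K i t, climb K i t)" for i t
  have T: "tangent ?K i t = tangent K i t + of_real (G i t)" if "i < length K" for i t
    unfolding G_def using tangent_image_link(1)[OF K that bulge_has_derivative] by simp
  have G_crit: "G i t = C * z' i t * u i t ^ N" if "y' i t = 0" for i t
    using that by (simp add: G_def bulge_speed_def y'_def z'_def u_def y_def)
  have G_small: "\<bar>G i t\<bar> < \<bar>x' i t\<bar>" if "i < length K" "t \<in> I" "y' i t = 0" "\<not> (i = i0 \<and> t = t0)" for i t
  proof -
    have "d \<le> \<bar>t - t0\<bar>" if "i = i0"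
    proof (rule ccontr)
      assume "\<not> d \<le> \<bar>t - t0\<bar>"
      then have "t \<in> {t0 - d<..<t0} \<or> t \<in> {t0<..<t0 + d}"
        using \<open>\<not> (i = i0 \<and> t = t0)\<close> that by auto
      then have "y' i t \<noteq> 0" using d(2,3)[of t] that by (auto simp: y'_def)
      with \<open>y' i t = 0\<close> show False by simp
    qed
    then have "t \<in> Q i" using that by (simp add: Q_def)
    from N[OF that(1) this] show ?thesis
      using G_crit[OF that(3)] u(1)[OF that(1), of t] by (simp add: abs_mult power_abs)
  qed
  have G_max: "G i0 t0 = - 2 * x' i0 t0"
    using G_crit[of i0 t0] crit climb u_max by (simp add: y'_def C_def z'_def)
  have T_neq: "tangent ?K i t \<noteq> 0" if i: "i < length K" "t \<in> I" for i t
  proof (cases "y' i t = 0")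
    case True
    then have "x' i t + G i t \<noteq> 0"
      using G_small[OF i True] G_max x'_neq[OF i(1) True] by (cases "i = i0 \<and> t = t0") auto
    then show ?thesis using T[OF i(1)] by (auto simp: x'_def complex_eq_iff)
  next
    case False
    then show ?thesis using T[OF i(1)] by (auto simp: y'_def complex_eq_iff)
  qed
  have imm': "immersed_projection ?K"
    unfolding immersed_projection_def
  proof (intro allI impI)
    fix i t assume "i < length ?K"
    then have i: "i < length K" "i < length ?K" by simp_all
    obtain k where k: "t + of_int k \<in> {t0 - 1/2..(t0 - 1/2) + 1}" by (rule periodic_cover)
    have "tangent ?K i t = tangent ?K i (t + of_int k)"
      by (rule periodic_int[symmetric]) (rule tangent_periodic[OF K' i(2)])
    then show "tangent ?K i t \<noteq> 0" using T_neq[OF i(1), of "t + of_int k"] k by (simp add: I_def)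
  qed
  have loops: "continuous_on UNIV (tangent K i)" "\<And>t. tangent K i t \<noteq> 0" "\<And>t. tangent K i (t + 1) = tangent K i t"
     "continuous_on UNIV (tangent ?K i)" "\<And>t. tangent ?K i t \<noteq> 0" "\<And>t. tangent ?K i (t + 1) = tangent ?K i t"
    if "i < length K" for i
    using that imm imm' continuous_on_tangent[OF K] continuous_on_tangent[OF K'] tangent_periodic[OF K]
      tangent_periodic[OF K'] by (auto simp: immersed_projection_def)

  have other: "winding_number (tangent ?K i) 0 = winding_number (tangent K i) 0" if i: "i < length K" "i \<noteq> i0" for i
  proof (rule winding_number_loops_linear_eq)
    note L = loops[OF i(1)]
    show "path (tangent K i)" "path (tangent ?K i)"
      using continuous_on_subset[OF L(1)] continuous_on_subset[OF L(4)] by (auto simp: path_def)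
    show "pathfinish (tangent K i) = pathstart (tangent K i)" "pathfinish (tangent ?K i) = pathstart (tangent ?K i)"
      using L(3)[of 0] L(6)[of 0] by (simp_all add: pathstart_def pathfinish_def)
    fix t :: real
    obtain k where k: "t + of_int k \<in> {t0 - 1/2..(t0 - 1/2) + 1}" by (rule periodic_cover)
    define s where "s = t + of_int k"
    have s: "tangent K i t = tangent K i s" "tangent ?K i t = tangent ?K i s" "s \<in> I"
      using periodic_int[of "tangent K i" t k, OF L(3)] periodic_int[of "tangent ?K i" t k, OF L(6)] k
      by (simp_all add: s_def I_def)
    show "0 \<notin> closed_segment (tangent K i t) (tangent ?K i t)"
    proof
      assume "0 \<in> closed_segment (tangent K i t) (tangent ?K i t)"
      then obtain a where a: "0 \<le> a" "a \<le> 1" "(1 - a) *\<^sub>R tangent K i s + a *\<^sub>R tangent ?K i s = 0"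
        unfolding s in_segment by auto
      then have "tangent K i s + of_real (a * G i s) = 0"
        using T[OF i(1), of s] by (simp add: algebra_simps scaleR_conv_of_real)
      then have "y' i s = 0" "x' i s = - (a * G i s)"
        by (auto simp: complex_eq_iff x'_def y'_def)
      moreover have "\<bar>a * G i s\<bar> \<le> \<bar>G i s\<bar>"
        using a(1,2) by (simp add: abs_mult mult_left_le_one_le)
      ultimately show False using G_small[OF i(1) s(3)] i(2) by auto
    qed
  qed
  have changed: "winding_number (tangent K i0) 0 \<noteq> winding_number (tangent ?K i0) 0"
  proof -
    note L = loops[OF i0]
    let ?r = "\<lambda>t. tangent ?K i0 t * cnj (tangent K i0 t)"
    have Re_r: "Re (?r t) = (x' i0 t + G i0 t) * x' i0 t + (y' i0 t)\<^sup>2"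
      and Im_r: "Im (?r t) = - (G i0 t * y' i0 t)" for t
      using T[OF i0, of t] by (simp_all add: x'_def y'_def algebra_simps power2_eq_square)
    have away: "?r t \<notin> \<real>\<^sub>\<le>\<^sub>0" if t: "t \<in> {t0 - 1/2..t0 + 1/2}" "t \<noteq> t0" for t
    proof
      assume "?r t \<in> \<real>\<^sub>\<le>\<^sub>0"
      then have r: "Re (?r t) \<le> 0" "Im (?r t) = 0" by (simp_all add: complex_nonpos_Reals_iff)
      show False
      proof (cases "y' i0 t = 0")
        case True
        then have "\<bar>G i0 t\<bar> < \<bar>x' i0 t\<bar>" using G_small[OF i0 _ True] t by (simp add: I_def)
        then have "(x' i0 t + G i0 t) * x' i0 t > 0"
          by (auto simp: zero_less_mult_iff abs_if split: if_splits)
        then show False using r(1) Re_r[of t] True by simp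
      next
        case False
        then have "G i0 t = 0" using r(2) Im_r[of t] by simp
        then have "Re (?r t) > 0" using Re_r[of t] False by (simp add: add_nonneg_pos)
        with r(1) show False by simp
      qed
    qed
    have at: "?r t0 \<in> \<real>\<^sub>\<le>\<^sub>0"
      using Re_r[of t0] Im_r[of t0] G_max crit by (simp add: complex_nonpos_Reals_iff y'_def)
    have at': "cnj (?r t) \<in> \<real>\<^sub>\<le>\<^sub>0 \<longleftrightarrow> ?r t \<in> \<real>\<^sub>\<le>\<^sub>0" for t
      by (auto simp: complex_nonpos_Reals_iff)
    have cnj_r: "tangent K i0 t * cnj (tangent ?K i0 t) = cnj (?r t)" for t by simp
    have G_neq: "G i0 t0 \<noteq> 0" using G_max x'_neq[OF i0] crit by (simp add: y'_def)
    have "continuous_on UNIV (G i0)"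
      unfolding G_def[abs_def] bulge_speed_def
      by (intro continuous_intros continuous_on_tangent[OF K i0] continuous_on_climb[OF K i0]
          smooth_curve_continuous_on oriented_linkD(1)[OF K i0])
    then have "isCont (G i0) t0" by (simp add: continuous_on_eq_continuous_at)
    then obtain e where e: "e > 0" "\<And>t. \<bar>t - t0\<bar> < e \<Longrightarrow> \<bar>G i0 t - G i0 t0\<bar> < \<bar>G i0 t0\<bar>"
      using G_neq unfolding continuous_at_eps_delta dist_real_def by (meson zero_less_abs_iff)
    define m where "m = min d e"
    have m: "m > 0" "m \<le> d" "m \<le> e" using d(1) e(1) by (auto simp: m_def)
    have y'_right: "y' i0 t < 0" if "t \<in> {t0<..<t0 + m}" for t using d(3)[of t] that m by (simp add: y'_def)
    have y'_left: "y' i0 t > 0" if "t \<in> {t0 - m<..<t0}" for t using d(2)[of t] that m by (simp add: y'_def)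
    show ?thesis
    proof (cases "G i0 t0 > 0")
      case True
      then have pos: "G i0 t > 0" if "\<bar>t - t0\<bar> < m" for t using e(2)[of t] that m by linarith
      show ?thesis
      proof (rule winding_number_neq_if_one_negative_crossing[OF L away at m(1)])
        show "Im (?r t) > 0" if "t \<in> {t0<..<t0 + m}" for t
          using Im_r[of t] y'_right[OF that] pos[of t] that by (simp add: mult_pos_neg)
        show "Im (?r t) < 0" if "t \<in> {t0 - m<..<t0}" for t
          using Im_r[of t] y'_left[OF that] pos[of t] that by simp
      qed
    next
      case False
      then have "G i0 t0 < 0" using G_neq by simp
      then have neg: "G i0 t < 0" if "\<bar>t - t0\<bar> < m" for t using e(2)[of t] that m by linarith
      have "winding_number (tangent ?K i0) 0 \<noteq> winding_number (tangent K i0) 0"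
      proof (rule winding_number_neq_if_one_negative_crossing[OF L(4-6) L(1-3) _ _ m(1)])
        show "tangent K i0 t * cnj (tangent ?K i0 t) \<notin> \<real>\<^sub>\<le>\<^sub>0" if "t \<in> {t0 - 1/2..t0 + 1/2}" "t \<noteq> t0" for t
          unfolding cnj_r at' by (rule away[OF that])
        show "tangent K i0 t0 * cnj (tangent ?K i0 t0) \<in> \<real>\<^sub>\<le>\<^sub>0"
          unfolding cnj_r at' by (rule at)
        show "Im (tangent K i0 t * cnj (tangent ?K i0 t)) > 0" if "t \<in> {t0<..<t0 + m}" for t
          unfolding cnj_r complex_cnj using Im_r[of t] mult_neg_neg[OF neg[of t] y'_right[OF that]] that by simp
        show "Im (tangent K i0 t * cnj (tangent ?K i0 t)) < 0" if "t \<in> {t0 - m<..<t0}" for t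
          unfolding cnj_r complex_cnj using Im_r[of t] mult_neg_pos[OF neg[of t] y'_left[OF that]] that by simp
      qed
      then show ?thesis by metis
    qed
  qed
  have int: "winding_number (tangent M i0) 0 \<in> \<int>" if "M = K \<or> M = ?K" for M
  proof (rule integer_winding_number)
    show "path (tangent M i0)" "pathfinish (tangent M i0) = pathstart (tangent M i0)" "0 \<notin> path_image (tangent M i0)"
      using that loops(2,5)[OF i0] loops(3,6)[OF i0, of 0]
        continuous_on_subset[OF loops(1)[OF i0] subset_UNIV] continuous_on_subset[OF loops(4)[OF i0] subset_UNIV]
      by (auto simp: path_def pathstart_def pathfinish_def path_image_def)
  qed
  have "Re (winding_number (tangent K i0) 0) \<noteq> Re (winding_number (tangent ?K i0) 0)"
    using int[of K] int[of ?K] changed by (auto elim!: Ints_cases)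
  moreover have "projection_winding ?K - Re (winding_number (tangent ?K i0) 0) =
      projection_winding K - Re (winding_number (tangent K i0) 0)"
    unfolding projection_winding_def length_image_link using i0 other
    by (simp add: sum.remove[of "{..<length K}" i0])
  ultimately have "projection_winding ?K \<noteq> 0" using True by auto
  with imm' deformation_bulge show ?thesis by blast
qed


text \<open>
  Lowers \<open>y\<close> by a multiple of the squared distance from the line in direction \<open>y\<close> through
  \<open>(x0, z0)\<close>.  If \<open>y\<close> is maximal on a link at a point of this line, then that point
  becomes the only maximum of \<open>y\<close>, and a nondegenerate one.
\<close>

definition cap :: "real \<Rightarrow> real \<Rightarrow> real \<Rightarrow> complex \<times> real \<Rightarrow> complex \<times> real" where
  "cap \<kappa> x0 z0 p = (fst p - (\<kappa> * ((Re (fst p) - x0)\<^sup>2 + (snd p - z0)\<^sup>2)) *\<^sub>R \<i>, snd p)"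

lemma deformation_cap: "deformation (cap \<kappa> x0 z0)"
  and cap_has_derivative: "(cap \<kappa> x0 z0 has_derivative
     (\<lambda>v. (fst v - (\<kappa> * (2 * ((Re (fst p) - x0) * Re (fst v) + (snd p - z0) * snd v))) *\<^sub>R \<i>, snd v))) (at p)"
proof -
  let ?\<Psi> = "\<lambda>p :: complex \<times> real. (- (\<kappa> * ((Re (fst p) - x0)\<^sup>2 + (snd p - z0)\<^sup>2)) *\<^sub>R \<i>, 0 :: real)"
  let ?D = "\<lambda>p v :: complex \<times> real.
     (- (\<kappa> * (2 * ((Re (fst p) - x0) * Re (fst v) + (snd p - z0) * snd v))) *\<^sub>R \<i>, 0 :: real)"
  have eq: "cap \<kappa> x0 z0 = (\<lambda>p. p + ?\<Psi> p)" by (auto simp: cap_def fun_eq_iff)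
  have D: "(?\<Psi> has_derivative ?D p) (at p)" for p
    by (rule derivative_eq_intros | rule has_derivative_Re | simp add: algebra_simps)+
  show "(cap \<kappa> x0 z0 has_derivative
     (\<lambda>v. (fst v - (\<kappa> * (2 * ((Re (fst p) - x0) * Re (fst v) + (snd p - z0) * snd v))) *\<^sub>R \<i>, snd v))) (at p)"
    unfolding eq using has_derivative_add[OF has_derivative_ident D]
    by (rule has_derivative_eq_rhs) (auto simp: fun_eq_iff prod_eq_iff)
  show "deformation (cap \<kappa> x0 z0)"
    unfolding eq
  proof (rule deformation_shear[OF _ D])
    show "continuous_on UNIV (\<lambda>p. ?D p v)" for v
      by (intro continuous_intros)
    show "smooth_curve (\<lambda>t. ?\<Psi> (\<gamma> t))"
      if "smooth_curve \<gamma>" for \<gamma> :: "real \<Rightarrow> complex \<times> real"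
      by (intro smooth_curve_intros smooth_curve_bounded_linear[OF bounded_linear_minus[OF bounded_linear_ident]] that)
  qed simp
qed

text \<open>
  For nonzero \<open>c\<close> this gives vertical velocity to a curve wherever its velocity is in the direction of \<open>x\<close>.
\<close>

definition tilt :: "real \<Rightarrow> complex \<times> real \<Rightarrow> complex \<times> real" where
  "tilt c p = (fst p, snd p + c * Re (fst p))"

lemma deformation_tilt: "deformation (tilt c)"
  and tilt_has_derivative: "(tilt c has_derivative (\<lambda>v. (fst v, snd v + c * Re (fst v)))) (at p)"
proof -
  let ?\<Psi> = "\<lambda>p :: complex \<times> real. (0 :: complex, c * Re (fst p))"
  have eq: "tilt c = (\<lambda>p. p + ?\<Psi> p)" by (auto simp: tilt_def fun_eq_iff)
  have D: "(?\<Psi> has_derivative ?\<Psi>) (at p)" for p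
    by (rule derivative_eq_intros | rule has_derivative_Re | simp)+
  show "(tilt c has_derivative (\<lambda>v. (fst v, snd v + c * Re (fst v)))) (at p)"
    unfolding eq using has_derivative_add[OF has_derivative_ident D]
    by (rule has_derivative_eq_rhs) (auto simp: fun_eq_iff prod_eq_iff)
  show "deformation (tilt c)"
    unfolding eq
  proof (rule deformation_shear[OF _ D])
    show "smooth_curve (\<lambda>t. ?\<Psi> (\<gamma> t))" if "smooth_curve \<gamma>" for \<gamma> :: "real \<Rightarrow> complex \<times> real"
      by (intro smooth_curve_intros that)
  qed (auto intro!: continuous_intros)
qed

lemma second_derivative_at_maximum:
  fixes f :: "real \<Rightarrow> real"
  assumes f: "\<And>t. (f has_real_derivative f' t) (at t)" and f': "(f' has_real_derivative f'') (at t0)"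
    and max: "\<And>t. f t \<le> f t0"
  shows "f' t0 = 0" "f'' \<le> 0"
proof -
  show crit: "f' t0 = 0"
    using DERIV_local_max[OF f[of t0], of 1] max by simp
  show "f'' \<le> 0"
  proof (rule ccontr)
    assume "\<not> f'' \<le> 0"
    then obtain d where d: "d > 0" "\<And>h. h > 0 \<Longrightarrow> h < d \<Longrightarrow> f' t0 < f' (t0 + h)"
      using DERIV_pos_inc_right[OF f'] by auto
    have "f t0 < f (t0 + d)"
    proof (rule DERIV_pos_imp_increasing_open[of t0 "t0 + d" f])
      show "t0 < t0 + d" using d(1) by simp
      show "\<exists>y. (f has_real_derivative y) (at t) \<and> 0 < y" if "t0 < t" "t < t0 + d" for t
        using f[of t] d(2)[of "t - t0"] that crit by auto
      show "continuous_on {t0..t0 + d} f"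
        using f by (meson DERIV_isCont continuous_at_imp_continuous_on)
    qed
    with max[of "t0 + d"] show False by simp
  qed
qed

text \<open>
  A generic shear makes the projection an immersion, and a small cap centred at a maximum
  of \<open>y\<close> keeps it one.  At the maximum
  \<open>y'\<close> vanishes, so \<open>x'\<close> does not, and a tilt provides vertical velocity there if necessary.
\<close>

lemma exists_deformation_with_nonzero_winding:
  assumes L: "oriented_link L"
  shows "\<exists>F. deformation F \<and> immersed_projection (image_link F L) \<and> projection_winding (image_link F L) \<noteq> 0"
proof -
  obtain A B where "generic_projection (image_link (quadratic_shear A B) L)"
    using exists_small_generic_shear[OF L, of 1] by auto
  define K where "K = image_link (quadratic_shear A B) L"
  have K: "oriented_link K" and imm: "immersed_projection K"
    unfolding K_def using \<open>generic_projection _\<close>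
    by (intro oriented_link_image_link L deformation_quadratic_shear generic_projection_immersed)+
  define x y z where "x i t = Re (fst ((K ! i) t))" and "y i t = Im (fst ((K ! i) t))"
    and "z i t = snd ((K ! i) t)" for i t
  define x' y' z' where "x' i t = Re (tangent K i t)" and "y' i t = Im (tangent K i t)"
    and "z' i t = climb K i t" for i t
  have "continuous_on UNIV (\<lambda>p :: complex \<times> real. Im (fst p))" by (intro continuous_intros)
  note vals = compact_link_values[OF K this]
  obtain m where m: "m \<in> (\<Union>i<length K. (\<lambda>t. Im (fst ((K ! i) t))) ` {0..1})"
    "\<And>s. s \<in> (\<Union>i<length K. (\<lambda>t. Im (fst ((K ! i) t))) ` {0..1}) \<Longrightarrow> s \<le> m"
    using compact_attains_sup[OF vals(1,2)] by blast
  then obtain i0 t0 where i0: "i0 < length K" "m = y i0 t0" by (auto simp: y_def)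
  have max: "y i t \<le> y i0 t0" if "i < length K" for i t
    using m(2) vals(3)[OF that, of t] i0(2) by (simp add: y_def)
  have y: "(y i0 has_real_derivative y' i0 t) (at t)" and x: "(x i0 has_real_derivative x' i0 t) (at t)"
    and z: "(z i0 has_real_derivative z' i0 t) (at t)" for t
    unfolding x_def[abs_def] y_def[abs_def] z_def[abs_def] x'_def y'_def z'_def has_real_derivative_iff_has_vector_derivative
    by (intro bounded_linear.has_vector_derivative[OF bounded_linear_Im] bounded_linear.has_vector_derivative[OF bounded_linear_Re]
        has_vector_derivative_fst_curve[OF K i0(1)] has_vector_derivative_snd_curve[OF K i0(1)])+
  obtain T where T: "(tangent K i0 has_vector_derivative T) (at t0)"
    using smooth_curve_vector_derivative(1)[OF smooth_tangent[OF K i0(1)]] by blast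
  obtain z'' where z'': "(z' i0 has_real_derivative z'') (at t0)"
    using smooth_curve_vector_derivative(1)[OF smooth_climb[OF K i0(1)]]
    unfolding z'_def[abs_def] has_real_derivative_iff_has_vector_derivative by blast
  have y': "(y' i0 has_real_derivative Im T) (at t0)" and x': "(x' i0 has_real_derivative Re T) (at t0)"
    unfolding x'_def[abs_def] y'_def[abs_def] has_real_derivative_iff_has_vector_derivative
    by (intro bounded_linear.has_vector_derivative[OF bounded_linear_Im] bounded_linear.has_vector_derivative[OF bounded_linear_Re] T)+
  have crit: "y' i0 t0 = 0" "Im T \<le> 0"
    using second_derivative_at_maximum[OF y y'] max[OF i0(1)] by auto
  have x'_neq: "x' i0 t0 \<noteq> 0"
  proof -
    have "tangent K i0 t0 \<noteq> 0" using imm i0(1) by (simp add: immersed_projection_def)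
    then show ?thesis using crit(1) by (simp add: x'_def y'_def complex_eq_iff)
  qed

  define g where "g i t = 2 * ((x i t - x i0 t0) * x' i t + (z i t - z i0 t0) * z' i t)" for i t
  have "\<exists>e>0. \<forall>i<length K. \<forall>t\<in>{0..1}. e * \<bar>g i t\<bar> < norm (tangent K i t)"
  proof (rule common_epsilon)
    fix i assume i: "i < length K"
    show "\<exists>e>0. \<forall>t\<in>{0..1}. e * \<bar>g i t\<bar> < norm (tangent K i t)"
    proof (rule small_multiple)
      have "continuous_on {0..1} (x i)" "continuous_on {0..1} (x' i)"
        unfolding x_def[abs_def] x'_def[abs_def]
        by (intro continuous_on_Re smooth_curve_continuous_on smooth_fst_curve[OF K i] smooth_tangent[OF K i])+
      moreover have "continuous_on {0..1} (z i)" "continuous_on {0..1} (z' i)"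
        unfolding z_def[abs_def] z'_def[abs_def]
        by (intro smooth_curve_continuous_on smooth_snd_curve[OF K i] smooth_climb[OF K i])+
      ultimately show "continuous_on {0..1} (g i)"
        unfolding g_def[abs_def] by (intro continuous_intros)
      show "tangent K i t \<noteq> 0" for t using imm i by (simp add: immersed_projection_def)
    qed (simp_all add: continuous_on_tangent[OF K i])
  next
    fix i and e e' :: real assume "\<forall>t\<in>{0..1}. e * \<bar>g i t\<bar> < norm (tangent K i t)" "0 < e'" "e' \<le> e"
    then show "\<forall>t\<in>{0..1}. e' * \<bar>g i t\<bar> < norm (tangent K i t)"
      using mult_right_mono[OF \<open>e' \<le> e\<close> abs_ge_zero] by (meson order_le_less_trans)
  qed
  then obtain \<kappa> where \<kappa>: "\<kappa> > 0" "\<And>i t. i < length K \<Longrightarrow> t \<in> {0..1} \<Longrightarrow> \<kappa> * \<bar>g i t\<bar> < norm (tangent K i t)"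
    by blast
  define M where "M = image_link (cap \<kappa> (x i0 t0) (z i0 t0)) K"
  have M: "oriented_link M" and len_M: "length M = length K"
    unfolding M_def by (intro oriented_link_image_link K deformation_cap) simp
  have fst_M: "fst ((M ! i) t) = fst ((K ! i) t) - (\<kappa> * ((x i t - x i0 t0)\<^sup>2 + (z i t - z i0 t0)\<^sup>2)) *\<^sub>R \<i>"
    if "i < length K" for i t
    using that by (simp add: M_def nth_image_link cap_def x_def z_def)
  have tangent_M: "tangent M i t = tangent K i t - (\<kappa> * g i t) *\<^sub>R \<i>" if "i < length K" for i t
    unfolding M_def using tangent_image_link(1)[OF K that cap_has_derivative]
    by (simp add: g_def x_def z_def x'_def z'_def)
  have imm_M: "immersed_projection M"
    unfolding immersed_projection_def
  proof (intro allI impI)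
    fix i t assume "i < length M"
    then have i: "i < length K" "i < length M" by (simp_all add: len_M)
    have "tangent M i (frac t) = tangent M i t"
      by (rule periodic_frac) (rule tangent_periodic[OF M i(2)])
    moreover have "frac t \<in> {0..1}" using frac_lt_1[of t] by (simp add: frac_ge_0 less_imp_le)
    then have "\<kappa> * \<bar>g i (frac t)\<bar> < norm (tangent K i (frac t))" by (rule \<kappa>(2)[OF i(1)])
    then have "norm ((\<kappa> * g i (frac t)) *\<^sub>R \<i>) < norm (tangent K i (frac t))"
      using \<kappa>(1) by (simp add: abs_mult)
    then have "tangent M i (frac t) \<noteq> 0"
      using tangent_M[OF i(1), of "frac t"] by (metis eq_iff_diff_eq_0 less_irrefl)
    ultimately show "tangent M i t \<noteq> 0" by simp
  qed
  have max_M: "Im (fst ((M ! i) t)) < Im (fst ((M ! i0) t0)) \<or> i = i0 \<and> t - t0 \<in> \<int>" if i: "i < length K" for i t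
  proof (cases "Im (fst ((M ! i) t)) < Im (fst ((M ! i0) t0))")
    case False
    have "Im (fst ((M ! i) t)) = y i t - \<kappa> * ((x i t - x i0 t0)\<^sup>2 + (z i t - z i0 t0)\<^sup>2)"
      "Im (fst ((M ! i0) t0)) = y i0 t0"
      using fst_M[OF i, of t] fst_M[OF i0(1), of t0] by (simp_all add: y_def)
    with False max[OF i, of t] have "\<kappa> * ((x i t - x i0 t0)\<^sup>2 + (z i t - z i0 t0)\<^sup>2) \<le> 0"
      and eq: "y i t - \<kappa> * ((x i t - x i0 t0)\<^sup>2 + (z i t - z i0 t0)\<^sup>2) \<ge> y i0 t0" by auto
    then have "(x i t - x i0 t0)\<^sup>2 + (z i t - z i0 t0)\<^sup>2 \<le> 0"
      using \<kappa>(1) by (simp add: mult_le_0_iff)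
    then have "x i t = x i0 t0" "z i t = z i0 t0"
      by (simp_all add: sum_power2_le_zero_iff)
    moreover then have "y i t = y i0 t0" using eq max[OF i, of t] by simp
    ultimately have "(K ! i) t = (K ! i0) t0"
      by (simp add: x_def y_def z_def prod_eq_iff complex_eq_iff)
    then show ?thesis using oriented_link_injective[OF K i i0(1)] by blast
  qed simp
  have g0: "g i0 t0 = 0" by (simp add: g_def)
  have tangent_M0: "tangent M i0 t0 = tangent K i0 t0"
    using tangent_M[OF i0(1), of t0] g0 by simp
  have "(g i0 has_real_derivative 2 * ((x' i0 t0)\<^sup>2 + (z' i0 t0)\<^sup>2)) (at t0)"
    unfolding g_def[abs_def]
    by (rule derivative_eq_intros x[of t0] z[of t0] x' z'' refl | simp add: power2_eq_square)+
  then have "((\<lambda>t. y' i0 t - \<kappa> * g i0 t) has_real_derivative Im T - \<kappa> * (2 * ((x' i0 t0)\<^sup>2 + (z' i0 t0)\<^sup>2))) (at t0)"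
    by (intro DERIV_diff y' DERIV_cmult)
  moreover have "(\<lambda>t. y' i0 t - \<kappa> * g i0 t) = (\<lambda>t. Im (tangent M i0 t))"
    using tangent_M[OF i0(1)] by (simp add: y'_def)
  ultimately have deriv: "((\<lambda>t. Im (tangent M i0 t)) has_real_derivative Im T - \<kappa> * (2 * ((x' i0 t0)\<^sup>2 + (z' i0 t0)\<^sup>2))) (at t0)"
    by simp
  have "(x' i0 t0)\<^sup>2 + (z' i0 t0)\<^sup>2 > 0" using x'_neq by (simp add: sum_power2_gt_zero_iff)
  then have "\<kappa> * (2 * ((x' i0 t0)\<^sup>2 + (z' i0 t0)\<^sup>2)) > 0" using \<kappa>(1) by simp
  then have neg: "Im T - \<kappa> * (2 * ((x' i0 t0)\<^sup>2 + (z' i0 t0)\<^sup>2)) < 0" using crit(2) by linarith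
  have Im0: "Im (tangent M i0 t0) = 0" using crit(1) tangent_M0 by (simp add: y'_def)
  obtain d1 where d1: "d1 > 0" "\<And>h. h > 0 \<Longrightarrow> h < d1 \<Longrightarrow> Im (tangent M i0 t0) < Im (tangent M i0 (t0 - h))"
    using DERIV_neg_dec_left[OF deriv neg] by blast
  obtain d2 where d2: "d2 > 0" "\<And>h. h > 0 \<Longrightarrow> h < d2 \<Longrightarrow> Im (tangent M i0 t0) > Im (tangent M i0 (t0 + h))"
    using DERIV_neg_dec_right[OF deriv neg] by blast

  define c where "c = (if climb M i0 t0 = 0 then 1 else 0 :: real)"
  define N where "N = image_link (tilt c) M"
  have N: "oriented_link N" and len_N: "length N = length K"
    unfolding N_def by (intro oriented_link_image_link M deformation_tilt) (simp add: len_M)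
  have fst_N: "fst ((N ! i) t) = fst ((M ! i) t)" if "i < length K" for i t
    using that by (simp add: N_def nth_image_link tilt_def len_M)
  have tangent_N: "tangent N i t = tangent M i t" "climb N i t = climb M i t + c * Re (tangent M i t)"
    if "i < length K" for i t
    unfolding N_def using tangent_image_link[OF M _ tilt_has_derivative] that by (simp_all add: len_M)
  have "\<exists>F. deformation F \<and> immersed_projection (image_link F N) \<and> projection_winding (image_link F N) \<noteq> 0"
  proof (rule deformation_with_nonzero_winding_if_strict_maximum[OF N, of i0 t0 "min d1 d2"])
    show "i0 < length N" using i0(1) len_N by simp
    show "immersed_projection N"
      using imm_M by (simp add: immersed_projection_def len_M len_N tangent_N)
    show "Im (fst ((N ! i) t)) < Im (fst ((N ! i0) t0)) \<or> i = i0 \<and> t - t0 \<in> \<int>" if "i < length N" for i t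
      using max_M[of i t] that i0(1) by (simp add: fst_N len_N)
    show "min d1 d2 > 0" using d1 d2 by simp
    show "Im (tangent N i0 t0) = 0" using Im0 i0(1) by (simp add: tangent_N)
    show "Im (tangent N i0 t) > 0" if "t \<in> {t0 - min d1 d2<..<t0}" for t
    proof -
      have "t0 - t > 0" "t0 - t < d1" using that by auto
      then show ?thesis using d1(2)[of "t0 - t"] Im0 i0(1) by (simp add: tangent_N)
    qed
    show "Im (tangent N i0 t) < 0" if "t \<in> {t0<..<t0 + min d1 d2}" for t
    proof -
      have "t - t0 > 0" "t - t0 < d2" using that by auto
      then show ?thesis using d2(2)[of "t - t0"] Im0 i0(1) by (simp add: tangent_N)
    qed
    have "Re (tangent M i0 t0) \<noteq> 0" using x'_neq by (simp add: tangent_M0 x'_def)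
    then show "climb N i0 t0 \<noteq> 0" using i0(1) by (simp add: tangent_N c_def)
  qed
  then obtain F where F: "deformation F" "immersed_projection (image_link F N)" "projection_winding (image_link F N) \<noteq> 0"
    by blast
  let ?F = "F \<circ> (tilt c \<circ> (cap \<kappa> (x i0 t0) (z i0 t0) \<circ> quadratic_shear A B))"
  have "image_link ?F L = image_link F N"
    unfolding N_def M_def K_def image_link_compose by (simp add: o_assoc)
  moreover have "deformation ?F"
    by (intro deformation_compose F deformation_tilt deformation_cap deformation_quadratic_shear)
  ultimately show ?thesis using F by metis
qed

section \<open>The half turn and the conclusion\<close>

text \<open>
  The rotation of space by \<open>pi\<close> about the axis of \<open>x\<close>.
\<close>

definition half_turn :: "complex \<times> real \<Rightarrow> complex \<times> real" where
  "half_turn p = (cnj (fst p), - snd p)"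

lemma deformation_half_turn: "deformation half_turn"
proof -
  define R where "R s p = (of_real (Re (fst p)) + (cos (pi * s) * Im (fst p) - sin (pi * s) * snd p) *\<^sub>R \<i>,
      sin (pi * s) * Im (fst p) + cos (pi * s) * snd p)" for s :: real and p :: "complex \<times> real"
  have D: "(R s has_derivative R s) (at p)" for s p
    unfolding R_def[abs_def]
    by (rule derivative_eq_intros has_derivative_Re has_derivative_Im refl | simp)+
  have inverse: "R (- s) (R s p) = p" for s p
  proof -
    have "cos (pi * s) * (cos (pi * s) * a) + sin (pi * s) * (sin (pi * s) * a) = a" for a
      using sin_cos_squared_add3[of "pi * s"] by (metis distrib_right mult.assoc mult.left_neutral)
    then show ?thesis
      by (simp add: R_def prod_eq_iff complex_eq_iff algebra_simps)
  qed
  have "diffeotopy R"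
  proof (rule diffeotopyI[where D = "\<lambda>s p. R s" and g = "\<lambda>s. R (- s)" and E = "\<lambda>s p. R (- s)"])
    show "R 0 p = p" for p by (simp add: R_def prod_eq_iff complex_eq_iff)
    show "continuous_on ({0..1} \<times> UNIV) (\<lambda>(s, p). R s p)"
      unfolding R_def case_prod_beta by (intro continuous_intros)
    show "continuous_on ({0..1} \<times> UNIV) (\<lambda>(s, p :: complex \<times> real). R s v)" for v
      unfolding R_def case_prod_beta by (intro continuous_intros)
    show "R s (R (- s) p) = p" for s p using inverse[of "- s" p] by simp
  qed (rule inverse D)+
  moreover have "R 1 = half_turn"
    by (simp add: R_def half_turn_def fun_eq_iff complex_eq_iff)
  moreover have "smooth_curve (\<lambda>t. half_turn (\<gamma> t))" if "smooth_curve \<gamma>" for \<gamma>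
    unfolding half_turn_def
    by (intro smooth_curve_Pair smooth_curve_bounded_linear[OF bounded_linear_cnj]
        smooth_curve_bounded_linear[OF bounded_linear_minus[OF bounded_linear_ident]] smooth_curve_intros that)
  ultimately show ?thesis unfolding deformation_def by blast
qed

text \<open>
  The diagram of a link after the half turn.
\<close>

definition reflected :: "diagram \<Rightarrow> diagram" where
  "reflected D = Diagram (map (\<lambda>\<gamma> t. cnj (\<gamma> t)) (curves D)) (\<lambda>x. \<not> over D x)"

context
  fixes D :: diagram
  assumes D: "link_diagram D"
begin

lemma params_reflected [simp]: "params (curves (reflected D)) = params (curves D)"
  by (simp add: reflected_def params_def)

lemma vector_derivative_reflected:
  assumes "i < length (curves D)"
  shows "vector_derivative (curves (reflected D) ! i) (at t) = cnj (vector_derivative (curves D ! i) (at t))"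
  using assms
  by (auto simp: reflected_def intro!: vector_derivative_at
      bounded_linear.has_vector_derivative[OF bounded_linear_cnj]
      smooth_curve_vector_derivative link_diagramD[OF D])

lemma
  assumes "x \<in> params (curves D)"
  shows point_reflected: "point (curves (reflected D)) x = cnj (point (curves D) x)"
    and velocity_reflected: "velocity (curves (reflected D)) x = cnj (velocity (curves D) x)"
  using assms vector_derivative_reflected[of "fst x" "snd x"]
  by (auto simp: params_def point_def velocity_def reflected_def)

lemma crossings_reflected: "crossings (reflected D) = prod.swap ` crossings D"
proof -
  have "(x, y) \<in> crossings (reflected D) \<longleftrightarrow> (y, x) \<in> crossings D" for x y
  proof -
    have "over (reflected D) x \<longleftrightarrow> \<not> over D x" for x by (simp add: reflected_def)
    then show ?thesis
      using point_reflected[of x] point_reflected[of y] unfolding crossings_def mem_Collect_eq prod.case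
      by (metis complex_cnj_cancel_iff params_reflected)
  qed
  then show ?thesis by (auto simp: image_iff) (metis prod.swap_def fst_conv snd_conv)+
qed

lemma det2_cnj: "det2 (cnj u) (cnj v) = - det2 u v"
  by (simp add: det2_def)

lemma link_diagram_reflected: "link_diagram (reflected D)"
  unfolding link_diagram_def
proof (intro conjI ballI impI)
  show "curves (reflected D) \<noteq> []" using D by (simp add: link_diagram_def reflected_def)
  show "finite (crossings (reflected D))" unfolding crossings_reflected using D by (simp add: link_diagram_def)
  fix \<gamma> assume "\<gamma> \<in> set (curves (reflected D))"
  then obtain i where i: "i < length (curves D)" "\<gamma> = curves (reflected D) ! i"
    unfolding in_set_conv_nth by (auto simp: reflected_def)
  have "\<gamma> = (\<lambda>t. cnj ((curves D ! i) t))" using i by (simp add: reflected_def)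
  moreover have "smooth_curve (\<lambda>t. cnj ((curves D ! i) t))"
    by (intro smooth_curve_bounded_linear[OF bounded_linear_cnj] link_diagramD[OF D i(1)])
  ultimately show "regular_closed_curve \<gamma>"
    using vector_derivative_reflected[OF i(1)] link_diagramD[OF D i(1)] i(2)
    by (simp add: regular_closed_curve_def)
next
  fix x y assume xy': "x \<in> params (curves (reflected D))" "y \<in> params (curves (reflected D))"
    "x \<noteq> y \<and> point (curves (reflected D)) x = point (curves (reflected D)) y"
  then have xy: "x \<in> params (curves D)" "y \<in> params (curves D)"
    "x \<noteq> y \<and> point (curves D) x = point (curves D) y"
    by (simp_all add: point_reflected)
  have *: "det2 (velocity (curves D) x) (velocity (curves D) y) \<noteq> 0"
     "over D x \<longleftrightarrow> \<not> over D y" "\<forall>z\<in>params (curves D). point (curves D) z = point (curves D) x \<longrightarrow> z = x \<or> z = y"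
    using D xy unfolding link_diagram_def by blast+
  show "det2 (velocity (curves (reflected D)) x) (velocity (curves (reflected D)) y) \<noteq> 0"
    using *(1) xy by (simp add: velocity_reflected det2_cnj)
  show "over (reflected D) x \<longleftrightarrow> \<not> over (reflected D) y" using *(2) by (simp add: reflected_def)
  fix z assume "z \<in> params (curves (reflected D))" "point (curves (reflected D)) z = point (curves (reflected D)) x"
  then show "z = x \<or> z = y" using *(3) xy(1) by (simp add: point_reflected)
qed

lemma writhe_reflected: "writhe (reflected D) = writhe D"
proof -
  have "sign_at (reflected D) (prod.swap q) = sign_at D q" if q: "q \<in> crossings D" for q
  proof -
    have "fst q \<in> params (curves D)" "snd q \<in> params (curves D)" using q by (auto simp: crossings_def)
    then show ?thesis
      by (simp add: sign_at_def velocity_reflected) (simp add: det2_def mult.commute)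
  qed
  then show ?thesis
    unfolding writhe_def crossings_reflected
    by (subst sum.reindex) (auto simp: inj_on_def)
qed

lemma total_winding_reflected: "total_winding (reflected D) = - total_winding D"
proof -
  have "Re (winding_number (\<lambda>t. vector_derivative (curves (reflected D) ! i) (at t)) 0) =
      - Re (winding_number (\<lambda>t. vector_derivative (curves D ! i) (at t)) 0)"
    if i: "i < length (curves D)" for i
  proof -
    let ?v = "\<lambda>t. vector_derivative (curves D ! i) (at t)"
    have "path ?v"
      unfolding path_def by (intro smooth_curve_continuous_on smooth_curve_vector_derivative link_diagramD[OF D i])
    moreover have "0 \<notin> path_image ?v"
      using link_diagramD(3)[OF D i] by (metis (no_types, lifting) image_iff path_image_def)
    ultimately have "winding_number (cnj \<circ> ?v) (cnj 0) = - cnj (winding_number ?v 0)"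
      by (rule winding_number_cnj)
    moreover have "cnj \<circ> ?v = (\<lambda>t. vector_derivative (curves (reflected D) ! i) (at t))"
      using vector_derivative_reflected[OF i] by auto
    ultimately show ?thesis by simp
  qed
  moreover have "length (curves (reflected D)) = length (curves D)" by (simp add: reflected_def)
  ultimately show ?thesis
    unfolding total_winding_eq_sum by (simp add: sum_negf)
qed

lemma projects_to_reflected:
  assumes "projects_to K D"
  shows "projects_to (image_link half_turn K) (reflected D)"
  unfolding projects_to_def
proof (intro conjI ballI)
  have c: "curves D = map (\<lambda>\<gamma> t. fst (\<gamma> t)) K" using assms by (simp add: projects_to_def)
  then show "curves (reflected D) = map (\<lambda>\<gamma> t. fst (\<gamma> t)) (image_link half_turn K)"
    by (simp add: reflected_def image_link_def half_turn_def)
  fix q assume "q \<in> crossings (reflected D)"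
  then obtain x y where q: "q = (y, x)" "(x, y) \<in> crossings D" unfolding crossings_reflected by auto
  then have "snd (point K x) > snd (point K y)" using assms by (auto simp: projects_to_def)
  moreover have "fst x < length K" "fst y < length K"
    using q(2) c by (auto simp: crossings_def params_def)
  ultimately show "case q of (x, y) \<Rightarrow> snd (point (image_link half_turn K) y) < snd (point (image_link half_turn K) x)"
    by (simp add: q(1) point_def nth_image_link half_turn_def)
qed

end

lemma exists_diagrams_with_opposite_winding:
  assumes L: "oriented_link L"
  obtains D D' where "diagram_of L D" "diagram_of L D'" "writhe D' = writhe D"
    "total_winding D' = - total_winding D" "total_winding D \<noteq> 0"
proof -
  obtain F where F: "deformation F" "immersed_projection (image_link F L)"
      "projection_winding (image_link F L) \<noteq> 0"
    using exists_deformation_with_nonzero_winding[OF L] by blast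
  obtain G where G: "deformation G" "generic_projection (image_link G (image_link F L))"
      "projection_winding (image_link G (image_link F L)) = projection_winding (image_link F L)"
    using exists_generic_shear_same_winding[OF oriented_link_image_link[OF L F(1)] F(2)] by blast
  define K where "K = image_link (G \<circ> F) L"
  have GF: "deformation (G \<circ> F)" by (rule deformation_compose[OF F(1) G(1)])
  have K: "oriented_link K" "generic_projection K" "projection_winding K \<noteq> 0"
    using G F oriented_link_image_link[OF L GF] by (simp_all add: K_def image_link_compose)
  let ?D = "diagram_below K"
  note D = diagram_below_generic[OF K(1,2)]
  have iso: "ambient_isotopic L K" unfolding K_def by (rule ambient_isotopic_image_link[OF GF])
  have K': "oriented_link (image_link half_turn K)"
    by (rule oriented_link_image_link[OF K(1) deformation_half_turn])
  have iso': "ambient_isotopic L (image_link half_turn K)"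
    unfolding K_def image_link_compose
    by (rule ambient_isotopic_image_link[OF deformation_compose[OF GF deformation_half_turn]])
  show ?thesis
  proof (rule that)
    show "diagram_of L ?D" unfolding diagram_of_def using D K(1) iso by blast
    show "diagram_of L (reflected ?D)"
      unfolding diagram_of_def using link_diagram_reflected[OF D(1)] projects_to_reflected[OF D] K' iso' by blast
    show "writhe (reflected ?D) = writhe ?D" by (rule writhe_reflected[OF D(1)])
    show "total_winding (reflected ?D) = - total_winding ?D" by (rule total_winding_reflected[OF D(1)])
    show "total_winding ?D \<noteq> 0" using K(3) by (simp add: total_winding_diagram_below)
  qed
qed

lemma forward_move_invariants:
  assumes "forward_move m D D'"
  shows "writhe D' = writhe D + (case m of Omega1a \<Rightarrow> 1 | Omega1b \<Rightarrow> 1 | Omega1c \<Rightarrow> -1 | Omega1d \<Rightarrow> -1 | _ \<Rightarrow> 0)"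
    and "total_winding D' = total_winding D + (case m of Omega1a \<Rightarrow> -1 | Omega1b \<Rightarrow> 1 | Omega1c \<Rightarrow> -1 | Omega1d \<Rightarrow> 1 | _ \<Rightarrow> 0)"
  using assms omega1_invariants[of _ _ D D'] omega2_invariants[of _ _ D D'] omega3_invariants[of _ _ _ D D']
  by (cases m; force simp: sign_value_def)+

lemma directed_move_invariants:
  assumes "directed_move m D D'"
  shows "writhe D' - total_winding D' = writhe D - total_winding D +
           (if m \<in> {(Omega1a, Forward), (Omega1d, Backward)} then 2
            else if m \<in> {(Omega1a, Backward), (Omega1d, Forward)} then - 2 else 0)" (is ?I)
    and "writhe D' + total_winding D' = writhe D + total_winding D +
           (if m \<in> {(Omega1b, Forward), (Omega1c, Backward)} then 2
            else if m \<in> {(Omega1b, Backward), (Omega1c, Forward)} then - 2 else 0)" (is ?J)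
proof -
  obtain t d where m: "m = (t, d)" by (cases m)
  have "?I \<and> ?J"
  proof (cases d)
    case Forward
    then have "forward_move t D D'" using assms m by simp
    from forward_move_invariants[OF this] show ?thesis
      by (cases t) (simp_all add: m Forward)
  next
    case Backward
    then have "forward_move t D' D" using assms m by simp
    from forward_move_invariants[OF this] show ?thesis
      by (cases t) (simp_all add: m Backward)
  qed
  then show ?I ?J by blast+
qed

lemma step_invariants:
  assumes "step A D D'"
  shows "A \<inter> {(Omega1a, Forward), (Omega1d, Backward)} = {} \<Longrightarrow>
           writhe D' - total_winding D' \<le> writhe D - total_winding D"
    and "A \<inter> {(Omega1a, Backward), (Omega1d, Forward)} = {} \<Longrightarrow>
           writhe D - total_winding D \<le> writhe D' - total_winding D'"
    and "A \<inter> {(Omega1b, Forward), (Omega1c, Backward)} = {} \<Longrightarrow>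
           writhe D' + total_winding D' \<le> writhe D + total_winding D"
    and "A \<inter> {(Omega1b, Backward), (Omega1c, Forward)} = {} \<Longrightarrow>
           writhe D + total_winding D \<le> writhe D' + total_winding D'"
proof -
  have cases: "planar_isotopic D D' \<or> (\<exists>m\<in>A. directed_move m D D')"
    using assms by (simp add: step_def)
  show "writhe D' - total_winding D' \<le> writhe D - total_winding D"
    if "A \<inter> {(Omega1a, Forward), (Omega1d, Backward)} = {}"
    using cases
  proof
    assume "\<exists>m\<in>A. directed_move m D D'"
    then obtain m where "m \<in> A" "directed_move m D D'" by blast
    with that directed_move_invariants(1)[of m D D'] show ?thesis by (auto split: if_splits)
  qed (use planar_isotopic_invariants[of D D'] in simp)
  show "writhe D - total_winding D \<le> writhe D' - total_winding D'"
    if "A \<inter> {(Omega1a, Backward), (Omega1d, Forward)} = {}"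
    using cases
  proof
    assume "\<exists>m\<in>A. directed_move m D D'"
    then obtain m where "m \<in> A" "directed_move m D D'" by blast
    with that directed_move_invariants(1)[of m D D'] show ?thesis by (auto split: if_splits)
  qed (use planar_isotopic_invariants[of D D'] in simp)
  show "writhe D' + total_winding D' \<le> writhe D + total_winding D"
    if "A \<inter> {(Omega1b, Forward), (Omega1c, Backward)} = {}"
    using cases
  proof
    assume "\<exists>m\<in>A. directed_move m D D'"
    then obtain m where "m \<in> A" "directed_move m D D'" by blast
    with that directed_move_invariants(2)[of m D D'] show ?thesis by (auto split: if_splits)
  qed (use planar_isotopic_invariants[of D D'] in simp)
  show "writhe D + total_winding D \<le> writhe D' + total_winding D'"
    if "A \<inter> {(Omega1b, Backward), (Omega1c, Forward)} = {}"
    using cases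
  proof
    assume "\<exists>m\<in>A. directed_move m D D'"
    then obtain m where "m \<in> A" "directed_move m D D'" by blast
    with that directed_move_invariants(2)[of m D D'] show ?thesis by (auto split: if_splits)
  qed (use planar_isotopic_invariants[of D D'] in simp)
qed

lemma monotone_along_steps:
  fixes I :: "diagram \<Rightarrow> real"
  assumes "(step A)\<^sup>*\<^sup>* D D'" and "\<And>D D'. step A D D' \<Longrightarrow> I D' \<le> I D"
  shows "I D' \<le> I D"
  using assms(1) by induction (use assms(2) order_trans in blast)+

theorem theorem5:
  fixes L :: link and A :: "directed_move set"
  assumes "oriented_link L"
    and "generating L A"
  shows "A \<inter> {(Omega1a, Forward), (Omega1d, Backward)} \<noteq> {} \<and>
         A \<inter> {(Omega1a, Backward), (Omega1d, Forward)} \<noteq> {} \<and>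
         A \<inter> {(Omega1b, Forward), (Omega1c, Backward)} \<noteq> {} \<and>
         A \<inter> {(Omega1b, Backward), (Omega1c, Forward)} \<noteq> {}"
proof -
  obtain D D' where D: "diagram_of L D" "diagram_of L D'" "writhe D' = writhe D"
    "total_winding D' = - total_winding D" "total_winding D \<noteq> 0"
    using exists_diagrams_with_opposite_winding[OF assms(1)] by blast
  have steps: "(step A)\<^sup>*\<^sup>* D D'" "(step A)\<^sup>*\<^sup>* D' D"
    using assms(2) D(1,2) unfolding generating_def by blast+
  \<comment> \<open>Moves lead from each of the two diagrams to the other, so what is monotone along all moves
    agrees on them.\<close>
  have not_monotone: False
    if "\<And>E E'. step A E E' \<Longrightarrow> I E' \<le> I E" "I D \<noteq> I D'" for I :: "diagram \<Rightarrow> real"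
    using monotone_along_steps[of A D D' I, OF steps(1) that(1)]
      monotone_along_steps[of A D' D I, OF steps(2) that(1)] that(2) by linarith
  show ?thesis
  proof (intro conjI notI)
    assume "A \<inter> {(Omega1a, Forward), (Omega1d, Backward)} = {}"
    from step_invariants(1)[OF _ this] show False
      by (rule not_monotone[of "\<lambda>D. writhe D - total_winding D"]) (use D in auto)
  next
    assume "A \<inter> {(Omega1a, Backward), (Omega1d, Forward)} = {}"
    from step_invariants(2)[OF _ this] show False
      by (intro not_monotone[of "\<lambda>D. total_winding D - writhe D"]) (use D in \<open>auto simp: algebra_simps\<close>)
  next
    assume "A \<inter> {(Omega1b, Forward), (Omega1c, Backward)} = {}"
    from step_invariants(3)[OF _ this] show False
      by (rule not_monotone[of "\<lambda>D. writhe D + total_winding D"]) (use D in auto)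
  next
    assume "A \<inter> {(Omega1b, Backward), (Omega1c, Forward)} = {}"
    from step_invariants(4)[OF _ this] show False
      by (intro not_monotone[of "\<lambda>D. - writhe D - total_winding D"]) (use D in \<open>auto simp: algebra_simps\<close>)
  qed
qed

end
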